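(* Let $(Y^7,\varphi)$ be a torsion-free $G_2$ manifold. With the canonical complexes $(G_1^\bullet,d_1)$ and $(E^\bullet,e)$, the coupling $b^k:E^k\to G_1^{k+1}$ and the weighted covariant codifferential operator $L_E^k:E^k\to G_1^k$ (as defined in the context), the coupling $b$ is null-homotopic: $$b^k=d_1^kL_E^k-L_E^{k+1}e^k,\qquad k=0,1,2,3,$$ where all maps out of degree $3$ and $L_E^4$ are zero.
   Context: Geometry. $Y$ is a smooth seven-manifold with a positive three-form $\varphi$ (a $G_2$ structure), with associated metric $g$ and orientation, normalized so that locally there is an oriented $g$-orthonormal coframe with $\varphi=e^{123}+e^{145}+e^{167}+e^{246}-e^{257}-e^{347}-e^{356}$; $\psi=*\varphi$. Torsion-free means $\mathrm d\varphi=0$ and $\mathrm d\psi=0$; equivalently the Levi-Civita connection $\nabla$ preserves $\varphi$ and $\psi$. No compactness is assumed. $R(X,Y)=[\nabla_X,\nabla_Y]-\nabla_{[X,Y]}$ is the Riemann curvature, regarded as an $\operatorname{End}(TY)$-valued two-form. $(e_i)$ denotes a local $g$-orthonormal frame. Canonical complexes. $\Lambda^2=\Lambda^2_7\oplus\Lambda^2_{14}$ with $\Lambda^2_7=\{\iota_X\varphi\}$, $\Lambda^2_{14}=\{\eta:\eta\wedge\psi=0\}$, and $\Lambda^3_1=\mathbb R\varphi\subset\Lambda^3$. Put $\Lambda^0_{\rm can}=\Lambda^0$, $\Lambda^1_{\rm can}=\Lambda^1$, $\Lambda^2_{\rm can}=\Lambda^2_7$, $\Lambda^3_{\rm can}=\Lambda^3_1$,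 and zero in other degrees; $\Pi_k:\Lambda^k\to\Lambda^k_{\rm can}$ is the orthogonal projection ($\Pi_0,\Pi_1$ identities, $\Pi_4=0$). For a bundle $W$ with connection, $\mathcal C^k(W)=\Gamma(\Lambda^k_{\rm can}T^*Y\otimes W)$. With $E=\operatorname{End}_0(TY)$ the trace-free endomorphism bundle, $G^\bullet=\mathcal C^\bullet(T^*Y)$ has differential $d^k=\Pi_{k+1}\mathrm d_\nabla$ and $E^\bullet=\mathcal C^\bullet(E)$ has differential $e^k=\Pi_{k+1}\mathrm d_E$, where $\mathrm d_\nabla,\mathrm d_E$ are the exterior covariant derivatives induced by $\nabla$. $\epsilon$ is a formal parameter with $\epsilon^2=0$; $G_1^\bullet=\epsilon G^\bullet$ with $d_1(\epsilon x)=\epsilon\,dx$. Operators. $\tau(S,T)=\operatorname{tr}_7(ST)$ is the real matrix trace on $TY$; for matrix-valued forms $\tau(\alpha\wedge\beta)$ is the trace of the wedge–matrix product in the displayed order. $\iota_ZR$ is the $\operatorname{End}(TY)$-valued one-form $X\mapsto R(Z,X)$. For an $E$-valued $p$-form $a$, $\mathfrak b a$ is the $\epsilon$-multiple of a $T^*Y$-valued $(p+1)$-form given by $(\mathfrak b a)(Z)=-\frac{\epsilon}{4}\tau(\iota_ZR\wedge a)$ ($(\cdot)(Z)$ is evaluation of the $T^*Y$ factor), and $b^k=\Pi_{k+1}\mathfrak b:E^k\to G_1^{k+1}$. For $a\in\Omega^p(Y,E)$, $a^-(X,Y)=\frac12(g(X,aY)-g(Y,aX))$ is its metric-skew part, viewed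 as a $\Lambda^pT^*Y$-valued two-form, and $\ell a=\frac12d_\nabla^*a^-$, i.e. $(\ell a)(Z)=-\frac12\sum_j(\nabla_{e_j}a^-)(e_j,Z)$, viewed in $\Omega^p(Y,T^*Y)$. Since $\nabla\Pi_k=0$, $\ell$ commutes with the $\Pi_k$, and $L_E^k=\epsilon\ell:E^k\to G_1^k$. *)

theory Defs
  imports "HOL-Analysis.Analysis"
begin

section \<open>Smooth seven-manifolds and tensor fields in charts\<close>

fun Ck_on :: "nat \<Rightarrow> 'a::euclidean_space set \<Rightarrow> ('a \<Rightarrow> 'b::real_normed_vector) \<Rightarrow> bool" where
  "Ck_on 0 S f \<longleftrightarrow> continuous_on S f"
| "Ck_on (Suc n) S f \<longleftrightarrow>
     f differentiable_on S \<and> (\<forall>v. Ck_on n S (\<lambda>x. frechet_derivative f (at x) v))"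

text \<open>Only used on open sets \<open>S\<close>.\<close>

definition smooth_on :: "'a::euclidean_space set \<Rightarrow> ('a \<Rightarrow> 'b::real_normed_vector) \<Rightarrow> bool" where
  "smooth_on S f \<longleftrightarrow> (\<forall>n. Ck_on n S f)"

type_synonym 'a chart = "'a set \<times> ('a \<Rightarrow> real^7)"

definition chart_im :: "'a chart \<Rightarrow> (real^7) set" where
  "chart_im c = snd c ` fst c"

definition chart_inv :: "'a chart \<Rightarrow> real^7 \<Rightarrow> 'a" where
  "chart_inv c = inv_into (fst c) (snd c)"

definition transition :: "'a chart \<Rightarrow> 'a chart \<Rightarrow> real^7 \<Rightarrow> real^7" where
  "transition c c' = snd c' \<circ> chart_inv c"

definition overlap :: "'a chart \<Rightarrow> 'a chart \<Rightarrow> (real^7) set" where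
  "overlap c c' = snd c ` (fst c \<inter> fst c')"

definition jac :: "'a chart \<Rightarrow> 'a chart \<Rightarrow> real^7 \<Rightarrow> real^7^7" where
  "jac c c' x = matrix (frechet_derivative (transition c c') (at x))"

text \<open>The manifold \<open>Y\<close> is the whole type \<open>'a\<close>; the Hausdorff and second countability
  axioms are its type classes.\<close>

definition smooth_atlas :: "'a::{t2_space,second_countable_topology} chart set \<Rightarrow> bool" where
  "smooth_atlas A \<longleftrightarrow>
     (\<Union>c\<in>A. fst c) = UNIV \<and>
     (\<forall>c\<in>A. open (fst c) \<and> open (chart_im c) \<and>
        homeomorphism (fst c) (chart_im c) (snd c) (chart_inv c)) \<and>
     (\<forall>c\<in>A. \<forall>c'\<in>A. smooth_on (overlap c c') (transition c c'))"

text \<open>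
  A \<open>W\<close>-valued \<open>p\<close>-form on \<open>Y\<close>, where \<open>W\<close> is a tensor bundle with fibre \<open>'w\<close>, is given by its
  expressions \<open>\<omega> c\<close> in the charts \<open>c\<close> of the atlas: \<open>\<omega> c x [v1,\<dots>,vp]\<close> is its value at the point
  with coordinates \<open>x \<in> chart_im c\<close> on tangent vectors with components \<open>v1,\<dots>,vp\<close>, in the
  trivialisation of \<open>W\<close> by the coordinate frame. It vanishes on lists of any other length, and what
  it does outside \<open>chart_im c\<close> is irrelevant. Fibres: \<open>real\<close> for the trivial bundle; \<open>real^7\<close> for
  \<open>T*Y\<close> (a covector \<open>\<xi>\<close> has \<open>\<xi>(Z) = \<xi> \<bullet> Z\<close>); \<open>real^7^7\<close> for \<open>End(TY)\<close>, and also for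
  \<open>T*Y \<otimes> T*Y\<close> (where \<open>B(X,Y) = X \<bullet> (B *v Y)\<close>).
\<close>

type_synonym 'w tensor_form = "(real^7) list \<Rightarrow> 'w"
type_synonym ('a, 'w) field = "'a chart \<Rightarrow> real^7 \<Rightarrow> 'w tensor_form"

definition alt_forms :: "nat \<Rightarrow> 'w::real_vector tensor_form set" where
  "alt_forms p = {\<omega>.
     (\<forall>vs. length vs \<noteq> p \<longrightarrow> \<omega> vs = 0) \<and>
     (\<forall>vs. length vs = p \<longrightarrow> (\<forall>i<p. linear (\<lambda>v. \<omega> (vs[i := v])))) \<and>
     (\<forall>vs. length vs = p \<longrightarrow> (\<forall>i<p. \<forall>j<p. i \<noteq> j \<longrightarrow> vs ! i = vs ! j \<longrightarrow> \<omega> vs = 0))}"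

text \<open>Change of trivialisation of the bundles under a Jacobian \<open>J\<close>.\<close>

definition chg_triv :: "real^7^7 \<Rightarrow> real \<Rightarrow> real" where
  "chg_triv J r = r"

definition chg_End :: "real^7^7 \<Rightarrow> real^7^7 \<Rightarrow> real^7^7" where
  "chg_End J S = J ** S ** matrix_inv J"

definition forms :: "'a chart set \<Rightarrow> (real^7^7 \<Rightarrow> 'w \<Rightarrow> 'w) \<Rightarrow> nat \<Rightarrow> ('a, 'w::real_normed_vector) field set" where
  "forms A chg p = {\<omega>. \<forall>c\<in>A.
     (\<forall>x\<in>chart_im c. \<omega> c x \<in> alt_forms p) \<and>
     (\<forall>vs. smooth_on (chart_im c) (\<lambda>x. \<omega> c x vs)) \<and>
     (\<forall>c'\<in>A. \<forall>x\<in>overlap c c'. \<forall>vs. length vs = p \<longrightarrow>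
        \<omega> c' (transition c c' x) (map ((*v) (jac c c' x)) vs) = chg (jac c c' x) (\<omega> c x vs))}"

section \<open>Metric, orientation, connection\<close>

definition bil :: "real^7^7 \<Rightarrow> real^7 \<Rightarrow> real^7 \<Rightarrow> real" where
  "bil B X Y = X \<bullet> (B *v Y)"

definition riemannian_metric :: "'a chart set \<Rightarrow> ('a chart \<Rightarrow> real^7 \<Rightarrow> real^7^7) \<Rightarrow> bool" where
  "riemannian_metric A g \<longleftrightarrow> (\<forall>c\<in>A.
     smooth_on (chart_im c) (g c) \<and>
     (\<forall>x\<in>chart_im c. (\<forall>X Y. bil (g c x) X Y = bil (g c x) Y X) \<and> (\<forall>X. X \<noteq> 0 \<longrightarrow> bil (g c x) X X > 0)) \<and>
     (\<forall>c'\<in>A. \<forall>x\<in>overlap c c'. \<forall>X Y.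
        bil (g c' (transition c c' x)) (jac c c' x *v X) (jac c c' x *v Y) = bil (g c x) X Y))"

text \<open>\<open>ori c x = 1\<close> if the coordinate frame of \<open>c\<close> is positively oriented at \<open>x\<close>, and \<open>- 1\<close>
  otherwise.\<close>

definition orientation :: "'a chart set \<Rightarrow> ('a chart \<Rightarrow> real^7 \<Rightarrow> real) \<Rightarrow> bool" where
  "orientation A ori \<longleftrightarrow> (\<forall>c\<in>A.
     continuous_on (chart_im c) (ori c) \<and>
     (\<forall>x\<in>chart_im c. ori c x \<in> {1, -1}) \<and>
     (\<forall>c'\<in>A. \<forall>x\<in>overlap c c'. ori c' (transition c c' x) = sgn (det (jac c c' x)) * ori c x))"

text \<open>A \<open>g\<close>-orthonormal frame at a point. Every expression below that uses it is a
  metric contraction, hence independent of the choice.\<close>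

definition onframe :: "real^7^7 \<Rightarrow> 7 \<Rightarrow> real^7" where
  "onframe G = (SOME e. \<forall>i j. bil G (e i) (e j) = (if i = j then 1 else 0))"

abbreviation dirder :: "(real^7 \<Rightarrow> 'w::real_normed_vector) \<Rightarrow> real^7 \<Rightarrow> real^7 \<Rightarrow> 'w" where
  "dirder f x u \<equiv> frechet_derivative f (at x) u"

text \<open>
  A connection on \<open>TY\<close> is given by its connection matrices in the coordinate frames:
  \<open>\<nabla>\<^sub>u V = D\<^sub>u V + \<Gamma>(u) V\<close>. The third condition is the resulting transformation law.
\<close>

type_synonym 'a conn = "'a chart \<Rightarrow> real^7 \<Rightarrow> real^7 \<Rightarrow> real^7^7"

definition connection :: "'a chart set \<Rightarrow> 'a conn \<Rightarrow> bool" where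
  "connection A \<Gamma> \<longleftrightarrow> (\<forall>c\<in>A.
     (\<forall>u. smooth_on (chart_im c) (\<lambda>x. \<Gamma> c x u)) \<and>
     (\<forall>x\<in>chart_im c. linear (\<Gamma> c x)) \<and>
     (\<forall>c'\<in>A. \<forall>x\<in>overlap c c'. \<forall>u v.
        \<Gamma> c' (transition c c' x) (jac c c' x *v u) *v (jac c c' x *v v) =
          jac c c' x *v (\<Gamma> c x u *v v) - dirder (\<lambda>y. dirder (transition c c') y v) x u))"

text \<open>The action of a connection matrix \<open>M\<close> on the trivial bundle, on \<open>T*Y\<close>, on \<open>End(TY)\<close> and on
  \<open>T*Y \<otimes> T*Y\<close>, so that \<open>\<nabla>\<^sub>u = D\<^sub>u + act (\<Gamma>(u))\<close> is the induced connection.\<close>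

definition act_triv :: "real^7^7 \<Rightarrow> real \<Rightarrow> real" where
  "act_triv M r = 0"

definition act_cot :: "real^7^7 \<Rightarrow> real^7 \<Rightarrow> real^7" where
  "act_cot M \<xi> = - (transpose M *v \<xi>)"

definition act_End :: "real^7^7 \<Rightarrow> real^7^7 \<Rightarrow> real^7^7" where
  "act_End M S = M ** S - S ** M"

definition act_bil :: "real^7^7 \<Rightarrow> real^7^7 \<Rightarrow> real^7^7" where
  "act_bil M B = - (transpose M ** B) - B ** M"

definition levi_civita :: "'a chart set \<Rightarrow> ('a chart \<Rightarrow> real^7 \<Rightarrow> real^7^7) \<Rightarrow> 'a conn \<Rightarrow> bool" where
  "levi_civita A g \<Gamma> \<longleftrightarrow> connection A \<Gamma> \<and>
     (\<forall>c\<in>A. \<forall>x\<in>chart_im c. \<forall>u v.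
        \<Gamma> c x u *v v = \<Gamma> c x v *v u \<and>
        dirder (g c) x u + act_bil (\<Gamma> c x u) (g c x) = 0)"

text \<open>\<open>R(u,v) = [\<nabla>\<^sub>u, \<nabla>\<^sub>v] - \<nabla>\<^bsub>[u,v]\<^esub>\<close> for the (commuting) constant coordinate fields \<open>u\<close>, \<open>v\<close>.\<close>

definition curv :: "'a conn \<Rightarrow> 'a chart \<Rightarrow> real^7 \<Rightarrow> real^7 \<Rightarrow> real^7 \<Rightarrow> real^7^7" where
  "curv \<Gamma> c x u v =
     dirder (\<lambda>y. \<Gamma> c y v) x u - dirder (\<lambda>y. \<Gamma> c y u) x v + \<Gamma> c x u ** \<Gamma> c x v - \<Gamma> c x v ** \<Gamma> c x u"

definition drop_nth :: "nat \<Rightarrow> 'b list \<Rightarrow> 'b list" where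
  "drop_nth i vs = take i vs @ drop (Suc i) vs"

text \<open>Exterior covariant derivative, by Cartan's formula on constant coordinate fields.\<close>

definition ext_cov :: "(real^7^7 \<Rightarrow> 'w \<Rightarrow> 'w) \<Rightarrow> 'a conn \<Rightarrow> ('a, 'w::real_normed_vector) field \<Rightarrow> ('a, 'w) field" where
  "ext_cov act \<Gamma> \<omega> c x vs = (\<Sum>i<length vs. (-1) ^ i *\<^sub>R
     (dirder (\<lambda>y. \<omega> c y (drop_nth i vs)) x (vs ! i) + act (\<Gamma> c x (vs ! i)) (\<omega> c x (drop_nth i vs))))"

definition ext_d :: "('a, real) field \<Rightarrow> ('a, real) field" where
  "ext_d = ext_cov act_triv (\<lambda>c x u. 0)"

text \<open>Covariant derivative in the direction \<open>u\<close> of a section of \<open>\<Lambda>\<^sup>pT*Y \<otimes> W\<close>.\<close>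

definition cov :: "(real^7^7 \<Rightarrow> 'w \<Rightarrow> 'w) \<Rightarrow> 'a conn \<Rightarrow> ('a, 'w::real_normed_vector) field \<Rightarrow>
    'a chart \<Rightarrow> real^7 \<Rightarrow> real^7 \<Rightarrow> 'w tensor_form" where
  "cov act \<Gamma> \<omega> c x u vs =
     dirder (\<lambda>y. \<omega> c y vs) x u + act (\<Gamma> c x u) (\<omega> c x vs)
     - (\<Sum>i<length vs. \<omega> c x (vs[i := \<Gamma> c x u *v (vs ! i)]))"

section \<open>Torsion-free \<open>G\<^sub>2\<close> structures\<close>

definition form_inner :: "real^7^7 \<Rightarrow> nat \<Rightarrow> real tensor_form \<Rightarrow> real tensor_form \<Rightarrow> real" where
  "form_inner G p \<alpha> \<beta> =
     (\<Sum>I\<in>{I. length I = p}. \<alpha> (map (onframe G) I) * \<beta> (map (onframe G) I)) / fact p"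

text \<open>In \<open>vol\<close>, \<open>vector vs\<close> is the matrix with rows \<open>vs\<close>; \<open>s\<close> is the sign given by the orientation.
  In \<open>hodge\<close>, the sum runs over all multi-indices of length \<open>p\<close>, whence the factor \<open>1 / p!\<close>; the
  convention is \<open>\<alpha> \<and> *\<beta> = \<langle>\<alpha>,\<beta>\<rangle> vol\<close>.\<close>

definition vol :: "real^7^7 \<Rightarrow> real \<Rightarrow> real tensor_form" where
  "vol G s vs = (if length vs = 7 then s * sqrt (det G) * det (vector vs :: real^7^7) else 0)"

definition hodge :: "real^7^7 \<Rightarrow> real \<Rightarrow> nat \<Rightarrow> real tensor_form \<Rightarrow> real tensor_form" where
  "hodge G s p \<alpha> ws =
     (\<Sum>I\<in>{I. length I = p}. \<alpha> (map (onframe G) I) * vol G s (map (onframe G) I @ ws)) / fact p"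

definition e3 :: "7 \<Rightarrow> 7 \<Rightarrow> 7 \<Rightarrow> real^7 \<Rightarrow> real^7 \<Rightarrow> real^7 \<Rightarrow> real" where
  "e3 i j k u v w =
     det (vector [vector [u $ i, u $ j, u $ k], vector [v $ i, v $ j, v $ k], vector [w $ i, w $ j, w $ k]] :: real^3^3)"

definition phi0 :: "real^7 \<Rightarrow> real^7 \<Rightarrow> real^7 \<Rightarrow> real" where
  "phi0 u v w = e3 1 2 3 u v w + e3 1 4 5 u v w + e3 1 6 7 u v w + e3 2 4 6 u v w
     - e3 2 5 7 u v w - e3 3 4 7 u v w - e3 3 5 6 u v w"

text \<open>The local coframe \<open>(e\<^sup>1,\<dots>,e\<^sup>7)\<close> is the matrix \<open>\<theta>\<close> with \<open>e\<^sup>i(v) = (\<theta> *v v) $ i\<close>. Its existence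
  says that \<open>\<phi>\<close> is positive and determines \<open>g\<close> and \<open>ori\<close> from \<open>\<phi>\<close>.\<close>

definition G2_structure :: "'a chart set \<Rightarrow> ('a, real) field \<Rightarrow> ('a chart \<Rightarrow> real^7 \<Rightarrow> real^7^7) \<Rightarrow>
    ('a chart \<Rightarrow> real^7 \<Rightarrow> real) \<Rightarrow> bool" where
  "G2_structure A \<phi> g ori \<longleftrightarrow>
     \<phi> \<in> forms A chg_triv 3 \<and> riemannian_metric A g \<and> orientation A ori \<and>
     (\<forall>c\<in>A. \<forall>x\<in>chart_im c. \<exists>N \<theta>. open N \<and> x \<in> N \<and> N \<subseteq> chart_im c \<and> smooth_on N \<theta> \<and>
        (\<forall>y\<in>N. ori c y * det (\<theta> y) > 0 \<and>
           (\<forall>u v. bil (g c y) u v = (\<theta> y *v u) \<bullet> (\<theta> y *v v)) \<and>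
           (\<forall>u v w. \<phi> c y [u, v, w] = phi0 (\<theta> y *v u) (\<theta> y *v v) (\<theta> y *v w))))"

definition torsion_free :: "'a chart set \<Rightarrow> ('a, real) field \<Rightarrow> ('a chart \<Rightarrow> real^7 \<Rightarrow> real^7^7) \<Rightarrow>
    ('a chart \<Rightarrow> real^7 \<Rightarrow> real) \<Rightarrow> bool" where
  "torsion_free A \<phi> g ori \<longleftrightarrow>
     (\<forall>c\<in>A. \<forall>x\<in>chart_im c. \<forall>vs.
        ext_d \<phi> c x vs = 0 \<and> ext_d (\<lambda>c x. hodge (g c x) (ori c x) 3 (\<phi> c x)) c x vs = 0)"

section \<open>The canonical complexes\<close>

text \<open>The fibre of \<open>\<Lambda>\<^sup>k\<^sub>can\<close>; for \<open>k = 2\<close> this is \<open>\<Lambda>\<^sup>2\<^sub>7 = {\<iota>\<^sub>X \<phi>}\<close>.\<close>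

definition can :: "real tensor_form \<Rightarrow> nat \<Rightarrow> real tensor_form set" where
  "can \<phi> k =
     (if k \<le> 1 then alt_forms k
      else if k = 2 then {\<lambda>vs. \<phi> (X # vs) | X. True}
      else if k = 3 then {\<lambda>vs. r * \<phi> vs | r. True}
      else {\<lambda>vs. 0})"

definition proj_can :: "real^7^7 \<Rightarrow> real tensor_form \<Rightarrow> nat \<Rightarrow> real tensor_form \<Rightarrow> real tensor_form" where
  "proj_can G \<phi> k \<omega> =
     (THE \<eta>. \<eta> \<in> can \<phi> k \<and> (\<forall>\<zeta>\<in>can \<phi> k. form_inner G k (\<lambda>vs. \<omega> vs - \<eta> vs) \<zeta> = 0))"

text \<open>\<open>\<Pi>\<^sub>k\<close> on \<open>W\<close>-valued forms is \<open>\<Pi>\<^sub>k \<otimes> id\<^sub>W\<close>, computed in a basis of the fibre.\<close>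

definition Pi_can :: "('a chart \<Rightarrow> real^7 \<Rightarrow> real^7^7) \<Rightarrow> ('a, real) field \<Rightarrow> nat \<Rightarrow>
    ('a, 'w::euclidean_space) field \<Rightarrow> ('a, 'w) field" where
  "Pi_can g \<phi> k \<omega> c x vs =
     (\<Sum>b\<in>Basis. proj_can (g c x) (\<phi> c x) k (\<lambda>us. \<omega> c x us \<bullet> b) vs *\<^sub>R b)"

definition can_forms :: "'a chart set \<Rightarrow> ('a, real) field \<Rightarrow> (real^7^7 \<Rightarrow> 'w \<Rightarrow> 'w) \<Rightarrow> nat \<Rightarrow>
    ('a, 'w::euclidean_space) field set" where
  "can_forms A \<phi> chg k = {\<omega> \<in> forms A chg k.
     \<forall>c\<in>A. \<forall>x\<in>chart_im c. \<forall>b\<in>Basis. (\<lambda>vs. \<omega> c x vs \<bullet> b) \<in> can (\<phi> c x) k}"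

definition E_cx :: "'a chart set \<Rightarrow> ('a, real) field \<Rightarrow> nat \<Rightarrow> ('a, real^7^7) field set" where
  "E_cx A \<phi> k = {a \<in> can_forms A \<phi> chg_End k. \<forall>c\<in>A. \<forall>x\<in>chart_im c. \<forall>vs. trace (a c x vs) = 0}"

definition d_E :: "('a chart \<Rightarrow> real^7 \<Rightarrow> real^7^7) \<Rightarrow> ('a, real) field \<Rightarrow> 'a conn \<Rightarrow> nat \<Rightarrow>
    ('a, real^7^7) field \<Rightarrow> ('a, real^7^7) field" where
  "d_E g \<phi> \<Gamma> k a = Pi_can g \<phi> (k + 1) (ext_cov act_End \<Gamma> a)"

definition d_G :: "('a chart \<Rightarrow> real^7 \<Rightarrow> real^7^7) \<Rightarrow> ('a, real) field \<Rightarrow> 'a conn \<Rightarrow> nat \<Rightarrow>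
    ('a, real^7) field \<Rightarrow> ('a, real^7) field" where
  "d_G g \<phi> \<Gamma> k \<gamma> = Pi_can g \<phi> (k + 1) (ext_cov act_cot \<Gamma> \<gamma>)"

text \<open>The module \<open>W[\<epsilon>]/\<epsilon>\<^sup>2 = W \<oplus> \<epsilon>W\<close> is \<open>'w \<times> 'w\<close>, the pair \<open>(x, y)\<close> standing for \<open>x + \<epsilon>y\<close>; so
  \<open>eps x\<close> is \<open>\<epsilon>x\<close>, and \<open>G\<^sub>1 = \<epsilon>G\<close> consists of fields with values \<open>(0, y)\<close>.\<close>

definition eps :: "'w::zero \<Rightarrow> 'w \<times> 'w" where
  "eps x = (0, x)"

definition d_G1 :: "('a chart \<Rightarrow> real^7 \<Rightarrow> real^7^7) \<Rightarrow> ('a, real) field \<Rightarrow> 'a conn \<Rightarrow> nat \<Rightarrow>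
    ('a, (real^7) \<times> (real^7)) field \<Rightarrow> ('a, (real^7) \<times> (real^7)) field" where
  "d_G1 g \<phi> \<Gamma> k \<gamma> c x vs = eps (d_G g \<phi> \<Gamma> k (\<lambda>c x vs. snd (\<gamma> c x vs)) c x vs)"

section \<open>The coupling and the weighted codifferential\<close>

text \<open>Wedge product of a one-form with a form, the values being multiplied by \<open>m\<close>.\<close>

definition wedge1 :: "('u \<Rightarrow> 'v \<Rightarrow> 'w::real_vector) \<Rightarrow> (real^7 \<Rightarrow> 'u) \<Rightarrow> 'v tensor_form \<Rightarrow> 'w tensor_form" where
  "wedge1 m \<alpha> \<beta> vs = (\<Sum>i<length vs. (-1) ^ i *\<^sub>R m (\<alpha> (vs ! i)) (\<beta> (drop_nth i vs)))"

definition frakb :: "'a conn \<Rightarrow> ('a, real^7^7) field \<Rightarrow> ('a, (real^7) \<times> (real^7)) field" where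
  "frakb \<Gamma> a c x vs =
     eps (\<chi> i. - (1/4) * trace (wedge1 (**) (curv \<Gamma> c x (axis i 1)) (a c x) vs))"

definition b_map :: "('a chart \<Rightarrow> real^7 \<Rightarrow> real^7^7) \<Rightarrow> ('a, real) field \<Rightarrow> 'a conn \<Rightarrow> nat \<Rightarrow>
    ('a, real^7^7) field \<Rightarrow> ('a, (real^7) \<times> (real^7)) field" where
  "b_map g \<phi> \<Gamma> k a = Pi_can g \<phi> (k + 1) (frakb \<Gamma> a)"

definition skew_part :: "('a chart \<Rightarrow> real^7 \<Rightarrow> real^7^7) \<Rightarrow> ('a, real^7^7) field \<Rightarrow> ('a, real^7^7) field" where
  "skew_part g a c x vs =
     (\<chi> i j. (1/2) * (bil (g c x) (axis i 1) (a c x vs *v axis j 1)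
                     - bil (g c x) (axis j 1) (a c x vs *v axis i 1)))"

definition ell :: "('a chart \<Rightarrow> real^7 \<Rightarrow> real^7^7) \<Rightarrow> 'a conn \<Rightarrow> ('a, real^7^7) field \<Rightarrow> ('a, real^7) field" where
  "ell g \<Gamma> a c x vs =
     (\<chi> i. - (1/2) * (\<Sum>j\<in>UNIV.
        bil (cov act_bil \<Gamma> (skew_part g a) c x (onframe (g c x) j) vs) (onframe (g c x) j) (axis i 1)))"

text \<open>\<open>L\<^sub>E\<^sup>k\<close> is given by the same formula in every degree \<open>k\<close>.\<close>

definition L_E :: "('a chart \<Rightarrow> real^7 \<Rightarrow> real^7^7) \<Rightarrow> 'a conn \<Rightarrow> ('a, real^7^7) field \<Rightarrow>
    ('a, (real^7) \<times> (real^7)) field" where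
  "L_E g \<Gamma> a c x vs = eps (ell g \<Gamma> a c x vs)"

end

theory Submission
  imports Defs
begin

text \<open>
  The identity is pointwise, so it is proved inside one chart, for a torsion-free connection that preserves the
  metric. The operator \<open>\<ell>\<close> is a weighted divergence: since the metric is parallel,
  \<open>\<ell> a = \<Sum>\<^sub>j K(e\<^sub>j, \<nabla>\<^bsub>e\<^sub>j\<^esub> a)\<close> for an algebraic contraction \<open>K\<close> (\<open>ell_eq\<close>). Since \<open>\<nabla>\<close> has no torsion,
  \<open>d\<^sub>\<nabla>\<close> is the alternation of \<open>\<nabla>\<close>. Therefore \<open>d\<^sub>\<nabla> \<ell> a - \<ell> d\<^sub>\<nabla> a\<close> is an alternated contraction of the
  antisymmetrised second covariant derivative of \<open>a\<close>, and by the Ricci identity this is the curvature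
  acting on \<open>a\<close> (\<open>ell_ext_cov_commutator\<close>). The curvature acts in two places.

  On the endomorphism factor. Two of the four terms are traces of the curvature over its own frame index;
  they vanish because the metric is Ricci flat. The pair symmetry and the first Bianchi identity combine the
  other two into \<open>- 1/4 tr (R(Z, v) a)\<close>, which is the coupling (\<open>codiff_curvature_End\<close>).

  On the form indices. The Bianchi identity rewrites this part so that both form indices of the curvature are
  arguments of the resulting form. The curvature annihilates \<open>\<phi>\<close>, so by pair symmetry it is a two-form with
  values in \<open>\<Lambda>\<^sup>2\<^sub>1\<^sub>4\<close> (\<open>phi_curv_form\<close>), whereas \<open>\<Pi>\<^sub>2\<close> and \<open>\<Pi>\<^sub>3\<close> contract two arguments with \<open>\<phi>\<close>. So the
  projection removes this part (\<open>form_defect_2\<close>, \<open>form_defect_3\<close>); in degree zero there are no form indices.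

  Projecting the commutator gives the theorem once \<open>\<ell>\<close> is known to commute with \<open>\<Pi>\<close>. This holds because \<open>\<Pi>\<close> is a
  contraction with a kernel built from \<open>\<phi>\<close> and the metric, which are parallel (\<open>cov_Pi_can\<close>, \<open>ell_Pi_can\<close>).
  In degree three both sides vanish since \<open>\<Pi>\<^sub>4 = 0\<close>.

  Two facts about torsion-free G2 structures enter. The first is the theorem of Fernandez and Gray that
  \<open>d\<phi> = 0\<close> and \<open>d*\<phi> = 0\<close> imply \<open>\<nabla>\<phi> = 0\<close> (\<open>torsion_free_parallel\<close>). In an adapted coframe \<open>\<nabla>\<phi>\<close> is determined by
  the seven-dimensional component of the connection matrices, that is by 49 numbers, and the two equations are
  a linear system for these numbers with only the zero solution (\<open>intrinsic_torsion_zero\<close>). The second is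
  Ricci flatness (\<open>ricci_flat\<close>), which follows from \<open>R \<cdot> \<phi> = 0\<close>, the cross product identity for \<open>\<phi>\<close> and the
  Bianchi identity.
\<close>

section \<open>Calculus on open sets\<close>

lemma has_derivative_dirder:
  "f differentiable (at x) \<Longrightarrow> (f has_derivative dirder f x) (at x)"
  by (simp add: frechet_derivative_works)

lemma dirder_eq:
  "(f has_derivative f') (at x) \<Longrightarrow> dirder f x u = f' u"
  by (metis frechet_derivative_at)

lemma frechet_derivative_cong_open:
  assumes "open S" "x \<in> S" "\<And>y. y \<in> S \<Longrightarrow> f y = h y"
  shows "frechet_derivative f (at x) = frechet_derivative h (at x)"
proof -
  have "(f has_derivative F) (at x) \<longleftrightarrow> (h has_derivative F) (at x)" for F
    using has_derivative_transform_within_open[of f F x UNIV S h]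
          has_derivative_transform_within_open[of h F x UNIV S f] assms by auto
  then show ?thesis by (simp add: frechet_derivative_def)
qed

lemma dirder_const [simp]: "dirder (\<lambda>y. k) x u = 0"
  by (rule dirder_eq) simp

lemma differentiable_transform_open:
  assumes "open U" "x \<in> U" "\<And>y. y \<in> U \<Longrightarrow> f y = h y" "f differentiable (at x)"
  shows "h differentiable (at x)"
  using assms has_derivative_transform_within_open[of f _ x UNIV U h]
  unfolding differentiable_def by blast

lemma smooth_on_differentiable:
  assumes "smooth_on S f" "open S" "x \<in> S"
  shows "f differentiable (at x)"
proof -
  have "Ck_on (Suc 0) S f" using assms(1) by (auto simp: smooth_on_def)
  then show ?thesis using assms(2,3) by (simp add: differentiable_on_eq_differentiable_at)
qed

lemma smooth_on_dirder:
  assumes "smooth_on S f"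
  shows "smooth_on S (\<lambda>x. frechet_derivative f (at x) v)"
  unfolding smooth_on_def
proof
  fix n
  have "Ck_on (Suc n) S f" using assms by (simp add: smooth_on_def del: Ck_on.simps)
  then show "Ck_on n S (\<lambda>x. frechet_derivative f (at x) v)" by simp
qed

lemma smooth_on_continuous_on: "smooth_on S f \<Longrightarrow> continuous_on S f"
  by (metis Ck_on.simps(1) smooth_on_def)

lemma DERIV_along_line:
  fixes f :: "'a::real_normed_vector \<Rightarrow> real"
  assumes "f differentiable (at (x + s *\<^sub>R u))"
  shows "((\<lambda>r. f (x + r *\<^sub>R u)) has_real_derivative frechet_derivative f (at (x + s *\<^sub>R u)) u) (at s)"
proof -
  let ?L = "frechet_derivative f (at (x + s *\<^sub>R u))"
  have d: "(f has_derivative ?L) (at (x + s *\<^sub>R u))"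
    using assms by (simp add: frechet_derivative_works)
  have "((\<lambda>r. x + r *\<^sub>R u) has_derivative (\<lambda>h. h *\<^sub>R u)) (at s)"
    by (auto intro!: derivative_eq_intros)
  from has_derivative_compose[OF this d]
  have "((\<lambda>r. f (x + r *\<^sub>R u)) has_derivative (\<lambda>h. ?L (h *\<^sub>R u))) (at s)" .
  moreover have "?L (h *\<^sub>R u) = ?L u * h" for h
    using linear_frechet_derivative[OF assms] by (simp add: linear_cmul mult.commute)
  ultimately show ?thesis
    by (simp add: has_field_derivative_def)
qed

text \<open>Two applications of the mean value theorem to the second difference of \<open>f\<close> over a
  parallelogram with sides \<open>h u\<close> and \<open>h v\<close>.\<close>

lemma second_difference_mvt:
  fixes f :: "'a::euclidean_space \<Rightarrow> real"
  assumes f: "smooth_on S f" and S: "open S" and h: "0 < h"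
    and par: "\<And>s t. 0 \<le> s \<Longrightarrow> s \<le> h \<Longrightarrow> 0 \<le> t \<Longrightarrow> t \<le> h \<Longrightarrow> x + s *\<^sub>R u + t *\<^sub>R v \<in> S"
  obtains s t where "0 < s" "s < h" "0 < t" "t < h"
    "f (x + h *\<^sub>R u + h *\<^sub>R v) - f (x + h *\<^sub>R u) - f (x + h *\<^sub>R v) + f x
       = h * h * frechet_derivative (\<lambda>y. frechet_derivative f (at y) u) (at (x + s *\<^sub>R u + t *\<^sub>R v)) v"
proof -
  let ?Du = "\<lambda>y. frechet_derivative f (at y) u"
  define F where "F = (\<lambda>s. f (x + h *\<^sub>R v + s *\<^sub>R u) - f (x + s *\<^sub>R u))"
  have "\<exists>s. 0 < s \<and> s < h \<and> F h - F 0 = (h - 0) * (?Du (x + h *\<^sub>R v + s *\<^sub>R u) - ?Du (x + s *\<^sub>R u))"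
  proof (rule MVT2[OF h])
    fix s :: real assume s: "0 \<le> s" "s \<le> h"
    have "x + h *\<^sub>R v + s *\<^sub>R u \<in> S" "x + s *\<^sub>R u \<in> S"
      using par[OF s, of h] par[OF s, of 0] h by (simp_all add: algebra_simps)
    then show "(F has_real_derivative ?Du (x + h *\<^sub>R v + s *\<^sub>R u) - ?Du (x + s *\<^sub>R u)) (at s)"
      unfolding F_def
      by (intro DERIV_diff DERIV_along_line smooth_on_differentiable[OF f S])
  qed
  then obtain s where s: "0 < s" "s < h"
    and Fs: "F h - F 0 = h * (?Du (x + h *\<^sub>R v + s *\<^sub>R u) - ?Du (x + s *\<^sub>R u))" by auto
  define K where "K = (\<lambda>t. ?Du (x + s *\<^sub>R u + t *\<^sub>R v))"
  have "\<exists>t. 0 < t \<and> t < h \<and>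
      K h - K 0 = (h - 0) * frechet_derivative ?Du (at (x + s *\<^sub>R u + t *\<^sub>R v)) v"
  proof (rule MVT2[OF h])
    fix t :: real assume t: "0 \<le> t" "t \<le> h"
    have "x + s *\<^sub>R u + t *\<^sub>R v \<in> S" using par[of s t] s t by simp
    then show "(K has_real_derivative frechet_derivative ?Du (at (x + s *\<^sub>R u + t *\<^sub>R v)) v) (at t)"
      unfolding K_def
      by (intro DERIV_along_line smooth_on_differentiable[OF smooth_on_dirder[OF f] S])
  qed
  then obtain t where t: "0 < t" "t < h"
    and Kt: "K h - K 0 = h * frechet_derivative ?Du (at (x + s *\<^sub>R u + t *\<^sub>R v)) v" by auto
  have "F h - F 0 = h * (K h - K 0)"
    unfolding Fs K_def by (simp add: algebra_simps)
  then have "f (x + h *\<^sub>R u + h *\<^sub>R v) - f (x + h *\<^sub>R u) - f (x + h *\<^sub>R v) + f x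
      = h * h * frechet_derivative ?Du (at (x + s *\<^sub>R u + t *\<^sub>R v)) v"
    unfolding Kt F_def by (simp add: algebra_simps)
  with s t that show ?thesis by blast
qed

text \<open>Divided by \<open>h\<^sup>2\<close>, the second difference tends to either mixed derivative, and it is symmetric in
  \<open>u\<close> and \<open>v\<close>.\<close>

lemma symmetric_second_derivative_real:
  fixes f :: "'a::euclidean_space \<Rightarrow> real"
  assumes f: "smooth_on S f" and S: "open S" and x: "x \<in> S"
  shows "frechet_derivative (\<lambda>y. frechet_derivative f (at y) u) (at x) v
       = frechet_derivative (\<lambda>y. frechet_derivative f (at y) v) (at x) u" (is "?P x = ?Q x")
proof (rule ccontr)
  assume ne: "?P x \<noteq> ?Q x"
  define e where "e = \<bar>?P x - ?Q x\<bar> / 2"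
  have e: "e > 0" using ne by (simp add: e_def)
  have "continuous_on S ?P" "continuous_on S ?Q"
    by (intro smooth_on_continuous_on smooth_on_dirder f)+
  then have "continuous (at x) ?P" "continuous (at x) ?Q"
    using S x by (simp_all add: continuous_on_eq_continuous_at)
  then obtain d1 d2 where d1: "d1 > 0" "\<And>y. dist y x < d1 \<Longrightarrow> dist (?P y) (?P x) < e"
    and d2: "d2 > 0" "\<And>y. dist y x < d2 \<Longrightarrow> dist (?Q y) (?Q x) < e"
    using e unfolding continuous_at_eps_delta by metis
  obtain d3 where d3: "d3 > 0" "ball x d3 \<subseteq> S" using S x openE by blast
  define d where "d = min d1 (min d2 d3)"
  have d: "d > 0" "d \<le> d1" "d \<le> d2" "d \<le> d3" using d1 d2 d3 by (auto simp: d_def)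
  define h where "h = d / (2 * (norm u + norm v + 1))"
  have np: "norm u + norm v + 1 > 0" by (smt (verit) norm_ge_zero)
  have h: "h > 0" using d np by (simp add: h_def)
  have near: "dist (x + s *\<^sub>R u + t *\<^sub>R v) x < d" if "0 \<le> s" "s \<le> h" "0 \<le> t" "t \<le> h" for s t
  proof -
    have "dist (x + s *\<^sub>R u + t *\<^sub>R v) x = norm (s *\<^sub>R u + t *\<^sub>R v)" by (simp add: dist_norm algebra_simps)
    also have "\<dots> \<le> s * norm u + t * norm v" using norm_triangle_ineq[of "s *\<^sub>R u" "t *\<^sub>R v"] that by simp
    also have "\<dots> \<le> h * norm u + h * norm v" using that by (intro add_mono mult_right_mono) auto
    also have "\<dots> \<le> h * (norm u + norm v + 1)" using h by (simp add: algebra_simps)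
    also have "\<dots> = d / 2" using np by (simp add: h_def field_simps)
    finally show ?thesis using d by simp
  qed
  have par: "x + s *\<^sub>R u + t *\<^sub>R v \<in> S" if "0 \<le> s" "s \<le> h" "0 \<le> t" "t \<le> h" for s t
    using near[OF that] d d3 by (auto simp: dist_commute)
  have par': "x + s *\<^sub>R v + t *\<^sub>R u \<in> S" if "0 \<le> s" "s \<le> h" "0 \<le> t" "t \<le> h" for s t
    using par[of t s] that by (simp add: algebra_simps)
  obtain s t where st: "0 < s" "s < h" "0 < t" "t < h"
    and 1: "f (x + h *\<^sub>R u + h *\<^sub>R v) - f (x + h *\<^sub>R u) - f (x + h *\<^sub>R v) + f x
       = h * h * ?P (x + s *\<^sub>R u + t *\<^sub>R v)"
    by (rule second_difference_mvt[OF f S h par])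
  obtain s' t' where st': "0 < s'" "s' < h" "0 < t'" "t' < h"
    and 2: "f (x + h *\<^sub>R v + h *\<^sub>R u) - f (x + h *\<^sub>R v) - f (x + h *\<^sub>R u) + f x
       = h * h * ?Q (x + s' *\<^sub>R v + t' *\<^sub>R u)"
    by (rule second_difference_mvt[OF f S h par'])
  have sw: "x + h *\<^sub>R v + h *\<^sub>R u = x + h *\<^sub>R u + h *\<^sub>R v" by simp
  have "h * h * ?P (x + s *\<^sub>R u + t *\<^sub>R v) = h * h * ?Q (x + s' *\<^sub>R v + t' *\<^sub>R u)"
    using 1 2 unfolding sw by linarith
  then have "?P (x + s *\<^sub>R u + t *\<^sub>R v) = ?Q (x + s' *\<^sub>R v + t' *\<^sub>R u)" using h by simp
  moreover have "dist (?P (x + s *\<^sub>R u + t *\<^sub>R v)) (?P x) < e"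
    using d1(2) near[of s t] d st by force
  moreover have "dist (?Q (x + s' *\<^sub>R v + t' *\<^sub>R u)) (?Q x) < e"
    using d2(2) near[of t' s'] d st' by (force simp: algebra_simps)
  ultimately have "\<bar>?P x - ?Q x\<bar> < 2 * e" unfolding dist_real_def by linarith
  then show False by (simp add: e_def)
qed

lemma frechet_derivative_inner:
  assumes "f differentiable (at x)"
  shows "frechet_derivative (\<lambda>y. f y \<bullet> b) (at x) u = frechet_derivative f (at x) u \<bullet> b"
proof -
  have "(f has_derivative frechet_derivative f (at x)) (at x)"
    using assms by (simp add: frechet_derivative_works)
  then have "((\<lambda>y. f y \<bullet> b) has_derivative (\<lambda>h. frechet_derivative f (at x) h \<bullet> b)) (at x)"
    by (rule has_derivative_inner_left)
  then show ?thesis by (metis frechet_derivative_at)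
qed

lemma Ck_on_cong_open:
  assumes "open S" "\<And>x. x \<in> S \<Longrightarrow> f x = h x" "Ck_on n S f"
  shows "Ck_on n S h"
  using assms(2,3)
proof (induction n arbitrary: f h)
  case 0
  then show ?case using continuous_on_cong[of S S f h] by simp
next
  case (Suc n)
  have "h differentiable (at x)" if "x \<in> S" for x
  proof (rule differentiable_transform_open[OF assms(1) that])
    show "f y = h y" if "y \<in> S" for y using Suc.prems(1) that .
    show "f differentiable (at x)"
      using Suc.prems(2) that assms(1) by (simp add: differentiable_on_eq_differentiable_at)
  qed
  then have "h differentiable_on S" using assms(1) by (simp add: differentiable_on_eq_differentiable_at)
  moreover have "Ck_on n S (\<lambda>x. frechet_derivative h (at x) v)" for v
  proof (rule Suc.IH)
    show "Ck_on n S (\<lambda>x. frechet_derivative f (at x) v)" using Suc.prems(2) by simp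
    show "frechet_derivative f (at x) v = frechet_derivative h (at x) v" if "x \<in> S" for x
      using frechet_derivative_cong_open[OF assms(1) that Suc.prems(1)] by simp
  qed
  ultimately show ?case by simp
qed

lemma Ck_on_inner:
  assumes "open S" "Ck_on n S f"
  shows "Ck_on n S (\<lambda>x. f x \<bullet> b)"
  using assms(2)
proof (induction n arbitrary: f)
  case 0
  then show ?case by (auto intro: continuous_intros)
next
  case (Suc n)
  have d: "f differentiable_on S" and k: "\<And>v. Ck_on n S (\<lambda>x. frechet_derivative f (at x) v)"
    using Suc.prems by auto
  have "Ck_on n S (\<lambda>x. frechet_derivative (\<lambda>y. f y \<bullet> b) (at x) v)" for v
  proof -
    have eq: "frechet_derivative (\<lambda>y. f y \<bullet> b) (at x) v = frechet_derivative f (at x) v \<bullet> b" if "x \<in> S" for x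
      using frechet_derivative_inner d that assms(1) by (metis differentiable_on_eq_differentiable_at)
    show ?thesis by (rule Ck_on_cong_open[OF assms(1) _ Suc.IH[OF k]]) (simp add: eq)
  qed
  moreover have "(\<lambda>x. f x \<bullet> b) differentiable_on S"
    using d unfolding differentiable_on_def differentiable_def
    by (blast intro: has_derivative_inner_left)
  ultimately show ?case by simp
qed

text \<open>Schwarz's theorem, from the real case applied to the components.\<close>

lemma symmetric_second_derivative:
  fixes f :: "'a::euclidean_space \<Rightarrow> 'b::euclidean_space"
  assumes f: "smooth_on S f" and S: "open S" and x: "x \<in> S"
  shows "frechet_derivative (\<lambda>y. frechet_derivative f (at y) u) (at x) v
       = frechet_derivative (\<lambda>y. frechet_derivative f (at y) v) (at x) u"
proof (rule euclidean_eqI)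
  fix b :: 'b
  have fb: "smooth_on S (\<lambda>y. f y \<bullet> b)"
    using f Ck_on_inner[OF S, of _ f b] by (simp add: smooth_on_def)
  have *: "frechet_derivative (\<lambda>y. frechet_derivative f (at y) u) (at x) v \<bullet> b
      = frechet_derivative (\<lambda>y. frechet_derivative (\<lambda>z. f z \<bullet> b) (at y) u) (at x) v" for u v
  proof -
    have "frechet_derivative (\<lambda>y. frechet_derivative f (at y) u) (at x) v \<bullet> b
        = frechet_derivative (\<lambda>y. frechet_derivative f (at y) u \<bullet> b) (at x) v"
      by (rule frechet_derivative_inner[symmetric])
         (rule smooth_on_differentiable[OF smooth_on_dirder[OF f] S x])
    also have "\<dots> = frechet_derivative (\<lambda>y. frechet_derivative (\<lambda>z. f z \<bullet> b) (at y) u) (at x) v"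
    proof -
      have e: "frechet_derivative f (at y) u \<bullet> b = frechet_derivative (\<lambda>z. f z \<bullet> b) (at y) u" if "y \<in> S" for y
        using frechet_derivative_inner[OF smooth_on_differentiable[OF f S that]] by simp
      show ?thesis using frechet_derivative_cong_open[OF S x e] by simp
    qed
    finally show ?thesis .
  qed
  show "frechet_derivative (\<lambda>y. frechet_derivative f (at y) u) (at x) v \<bullet> b
      = frechet_derivative (\<lambda>y. frechet_derivative f (at y) v) (at x) u \<bullet> b"
    unfolding * by (rule symmetric_second_derivative_real[OF fb S x])
qed

section \<open>Multilinear functions on lists of vectors\<close>

definition multilin :: "'w::real_vector tensor_form \<Rightarrow> bool" where
  "multilin T \<longleftrightarrow> (\<forall>vs l. l < length vs \<longrightarrow> linear (\<lambda>v. T (vs[l := v])))"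

lemma multilinD: "multilin T \<Longrightarrow> l < length vs \<Longrightarrow> linear (\<lambda>v. T (vs[l := v]))"
  by (simp add: multilin_def)

lemma alt_forms_multilin:
  assumes "T \<in> alt_forms p" shows "multilin T"
  unfolding multilin_def
proof (intro allI impI)
  fix vs :: "(real^7) list" and l assume l: "l < length vs"
  show "linear (\<lambda>v. T (vs[l := v]))"
  proof (cases "length vs = p")
    case True
    then show ?thesis using assms l by (auto simp: alt_forms_def)
  next
    case False
    then have "T (vs[l := v]) = 0" for v using assms by (simp add: alt_forms_def)
    then show ?thesis by (simp add: linear_iff)
  qed
qed

lemma multilin_expand:
  assumes "multilin T" "l < length vs"
  shows "T (vs[l := v]) = (\<Sum>b\<in>Basis. (v \<bullet> b) *\<^sub>R T (vs[l := b]))"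
proof -
  have "T (vs[l := \<Sum>b\<in>Basis. (v \<bullet> b) *\<^sub>R b]) = (\<Sum>b\<in>Basis. (v \<bullet> b) *\<^sub>R T (vs[l := b]))"
    by (simp add: linear_sum[OF multilinD[OF assms]] linear_cmul[OF multilinD[OF assms]])
  then show ?thesis by (simp add: euclidean_representation)
qed

text \<open>Product rule for a multilinear function whose slot \<open>l\<close> also varies.\<close>

lemma has_derivative_slot:
  fixes T :: "real^7 \<Rightarrow> 'w::real_normed_vector tensor_form"
  assumes U: "open U" "x \<in> U" and T: "\<And>y. y \<in> U \<Longrightarrow> multilin (T y)"
    and dT: "\<And>ws. (\<lambda>y. T y ws) differentiable (at x)"
    and z: "(z has_derivative z') (at x)" and l: "l < length vs"
  shows "((\<lambda>y. T y (vs[l := z y])) has_derivative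
     (\<lambda>h. dirder (\<lambda>y. T y (vs[l := z x])) x h + T x (vs[l := z' h]))) (at x)"
proof -
  have 0: "((\<lambda>y. T y ws) has_derivative dirder (\<lambda>y. T y ws) x) (at x)" for ws
    by (rule has_derivative_dirder[OF dT])
  have 1: "((\<lambda>y. \<Sum>b\<in>Basis. (z y \<bullet> b) *\<^sub>R T y (vs[l := b])) has_derivative
      (\<lambda>h. \<Sum>b\<in>Basis. (z x \<bullet> b) *\<^sub>R dirder (\<lambda>y. T y (vs[l := b])) x h + (z' h \<bullet> b) *\<^sub>R T x (vs[l := b]))) (at x)"
    by (intro has_derivative_sum has_derivative_scaleR has_derivative_inner_left z 0)
  have 2: "((\<lambda>y. \<Sum>b\<in>Basis. (z x \<bullet> b) *\<^sub>R T y (vs[l := b])) has_derivative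
      (\<lambda>h. \<Sum>b\<in>Basis. (z x \<bullet> b) *\<^sub>R dirder (\<lambda>y. T y (vs[l := b])) x h)) (at x)"
    by (intro has_derivative_sum has_derivative_scaleR_right 0)
  have 3: "((\<lambda>y. T y (vs[l := z x])) has_derivative
      (\<lambda>h. \<Sum>b\<in>Basis. (z x \<bullet> b) *\<^sub>R dirder (\<lambda>y. T y (vs[l := b])) x h)) (at x)"
    by (rule has_derivative_transform_within_open[OF 2 U]) (simp add: multilin_expand[OF T l, symmetric])
  have "((\<lambda>y. T y (vs[l := z y])) has_derivative
      (\<lambda>h. \<Sum>b\<in>Basis. (z x \<bullet> b) *\<^sub>R dirder (\<lambda>y. T y (vs[l := b])) x h + (z' h \<bullet> b) *\<^sub>R T x (vs[l := b]))) (at x)"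
    by (rule has_derivative_transform_within_open[OF 1 U]) (simp add: multilin_expand[OF T l, symmetric])
  moreover have "(\<Sum>b\<in>Basis. (z x \<bullet> b) *\<^sub>R dirder (\<lambda>y. T y (vs[l := b])) x h + (z' h \<bullet> b) *\<^sub>R T x (vs[l := b]))
      = dirder (\<lambda>y. T y (vs[l := z x])) x h + T x (vs[l := z' h])" for h
    using multilin_expand[OF T[OF U(2)] l, of "z' h"] dirder_eq[OF 3, of h] by (simp add: sum.distrib)
  ultimately show ?thesis by simp
qed

lemma multilin_dirder:
  fixes T :: "real^7 \<Rightarrow> 'w::real_normed_vector tensor_form"
  assumes U: "open U" "x \<in> U" and T: "\<And>y. y \<in> U \<Longrightarrow> multilin (T y)"
    and dT: "\<And>ws. (\<lambda>y. T y ws) differentiable (at x)"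
  shows "multilin (\<lambda>ws. dirder (\<lambda>y. T y ws) x h)"
  unfolding multilin_def
proof (intro allI impI)
  fix vs :: "(real^7) list" and l assume l: "l < length vs"
  have d: "((\<lambda>y. T y ws) has_derivative dirder (\<lambda>y. T y ws) x) (at x)" for ws
    by (rule has_derivative_dirder[OF dT])
  show "linear (\<lambda>v. dirder (\<lambda>y. T y (vs[l := v])) x h)"
  proof (rule linearI)
    fix v w :: "real^7" and r :: real
    have "((\<lambda>y. T y (vs[l := v + w])) has_derivative
        (\<lambda>h. dirder (\<lambda>y. T y (vs[l := v])) x h + dirder (\<lambda>y. T y (vs[l := w])) x h)) (at x)"
      by (rule has_derivative_transform_within_open[OF has_derivative_add[OF d d] U])
         (simp add: linear_add[OF multilinD[OF T l]])
    then show "dirder (\<lambda>y. T y (vs[l := v + w])) x h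
        = dirder (\<lambda>y. T y (vs[l := v])) x h + dirder (\<lambda>y. T y (vs[l := w])) x h"
      by (rule dirder_eq)
    have "((\<lambda>y. T y (vs[l := r *\<^sub>R v])) has_derivative
        (\<lambda>h. r *\<^sub>R dirder (\<lambda>y. T y (vs[l := v])) x h)) (at x)"
      by (rule has_derivative_transform_within_open[OF has_derivative_scaleR_right[OF d] U])
         (simp add: linear_cmul[OF multilinD[OF T l]])
    then show "dirder (\<lambda>y. T y (vs[l := r *\<^sub>R v])) x h = r *\<^sub>R dirder (\<lambda>y. T y (vs[l := v])) x h"
      by (rule dirder_eq)
  qed
qed

section \<open>Infinitesimal actions on tensors\<close>

declare transpose_matrix_vector [simp del]

lemma matrix_add_rdistrib': "(A + B) ** C = A ** C + B ** (C :: real^'p^'n)" for A B :: "real^'n^'m"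
  by (simp add: matrix_matrix_mult_def vec_eq_iff sum.distrib distrib_right)

lemma matrix_diff_rdistrib': "(A - B) ** C = A ** C - B ** (C :: real^'p^'n)" for A B :: "real^'n^'m"
  by (simp add: matrix_matrix_mult_def vec_eq_iff sum_subtractf left_diff_distrib)

lemma matrix_diff_ldistrib': "C ** (A - B) = C ** A - C ** (B :: real^'p^'n)" for C :: "real^'n^'m"
  by (simp add: matrix_matrix_mult_def vec_eq_iff sum_subtractf right_diff_distrib)

lemma matrix_uminus_left: "(- A) ** B = - (A ** B)" for A :: "real^'n^'m" and B :: "real^'p^'n"
  by (simp add: matrix_matrix_mult_def vec_eq_iff sum_negf)

lemma matrix_uminus_right: "A ** (- B) = - (A ** B)" for A :: "real^'n^'m" and B :: "real^'p^'n"
  by (simp add: matrix_matrix_mult_def vec_eq_iff sum_negf)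

lemma matrix_vector_uminus_left: "(- A) *v v = - (A *v v)" for A :: "real^'n^'m"
  by (simp add: matrix_vector_mult_def vec_eq_iff sum_negf)

lemma matrix_vector_uminus_right: "A *v (- v) = - (A *v v)" for A :: "real^'n^'m"
  by (simp add: matrix_vector_mult_def vec_eq_iff sum_negf)

lemma transpose_add: "transpose (A + B) = transpose A + transpose B"
  by (simp add: transpose_def vec_eq_iff)

lemma transpose_diff: "transpose (A - B) = transpose A - transpose (B :: real^'n^'m)"
  by (simp add: transpose_def vec_eq_iff)

lemma transpose_uminus: "transpose (- A) = - transpose (A :: real^'n^'m)"
  by (simp add: transpose_def vec_eq_iff)

lemma transpose_scaleR: "transpose (r *\<^sub>R A) = r *\<^sub>R transpose (A :: real^'n^'m)"
  by (simp add: transpose_def vec_eq_iff)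

lemma bounded_bilinear_matrix_mult:
  "bounded_bilinear ((**) :: real^'n^'m \<Rightarrow> real^'p^'n \<Rightarrow> real^'p^'m)"
  unfolding bilinear_conv_bounded_bilinear[symmetric] bilinear_def
  by (auto intro!: linearI simp: matrix_add_ldistrib matrix_add_rdistrib' scalar_matrix_assoc matrix_scalar_ac)

lemma bounded_bilinear_matrix_vector_mult:
  "bounded_bilinear ((*v) :: real^'n^'m \<Rightarrow> real^'n \<Rightarrow> real^'m)"
  unfolding bilinear_conv_bounded_bilinear[symmetric] bilinear_def
  by (auto intro!: linearI simp: matrix_vector_right_distrib matrix_vector_mult_add_rdistrib
      scaleR_matrix_vector_assoc[symmetric] matrix_vector_mult_scaleR)

lemma bounded_linear_transpose: "bounded_linear (transpose :: real^'n^'m \<Rightarrow> real^'m^'n)"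
  by (rule linear_conv_bounded_linear[THEN iffD1], rule linearI) (simp_all add: transpose_add transpose_scaleR)

lemma inner_matrix_transpose: "v \<bullet> (transpose A *v w) = (A *v v) \<bullet> w" for A :: "real^'n^'m"
  by (metis dot_lmul_matrix transpose_matrix_vector inner_commute)

text \<open>An infinitesimal action of the general linear Lie algebra on the fibre of a bundle associated to the tangent
  bundle.\<close>

locale lie_action =
  fixes act :: "real^7^7 \<Rightarrow> 'w::euclidean_space \<Rightarrow> 'w"
  assumes bounded_bilinear_act: "bounded_bilinear act"
    and act_bracket: "act (M ** N - N ** M) S = act M (act N S) - act N (act M S)"

lemma lie_action_triv: "lie_action act_triv"
proof (rule lie_action.intro)
  show "bounded_bilinear act_triv"
    unfolding bilinear_conv_bounded_bilinear[symmetric] bilinear_def by (simp add: act_triv_def linear_iff)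
qed (simp add: act_triv_def)

lemma lie_action_cot: "lie_action act_cot"
proof (rule lie_action.intro)
  show "bounded_bilinear act_cot"
    unfolding bilinear_conv_bounded_bilinear[symmetric] bilinear_def act_cot_def
    by (auto intro!: linearI simp: matrix_vector_right_distrib matrix_vector_mult_add_rdistrib transpose_add
      transpose_scaleR scaleR_matrix_vector_assoc[symmetric] matrix_vector_mult_scaleR)
qed (simp add: act_cot_def transpose_diff matrix_transpose_mul matrix_vector_mult_diff_rdistrib
        matrix_vector_uminus_right matrix_vector_mul_assoc)

lemma lie_action_End: "lie_action act_End"
proof (rule lie_action.intro)
  show "bounded_bilinear act_End"
    unfolding bilinear_conv_bounded_bilinear[symmetric] bilinear_def act_End_def
    by (auto intro!: linearI simp: matrix_add_ldistrib matrix_add_rdistrib' scalar_matrix_assoc[symmetric]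
        matrix_scalar_ac scaleR_diff_right)
qed (simp add: act_End_def matrix_diff_rdistrib' matrix_diff_ldistrib' matrix_mul_assoc)

lemma lie_action_bil: "lie_action act_bil"
proof (rule lie_action.intro)
  show "bounded_bilinear act_bil"
    unfolding bilinear_conv_bounded_bilinear[symmetric] bilinear_def act_bil_def
    by (auto intro!: linearI simp: matrix_add_ldistrib matrix_add_rdistrib' scalar_matrix_assoc[symmetric]
        matrix_scalar_ac scaleR_diff_right transpose_add transpose_scaleR)
qed (simp add: act_bil_def matrix_diff_rdistrib' matrix_diff_ldistrib' matrix_mul_assoc transpose_diff
        matrix_transpose_mul matrix_uminus_left matrix_uminus_right)

interpretation cot: lie_action act_cot by (rule lie_action_cot)
interpretation bilin: lie_action act_bil by (rule lie_action_bil)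

text \<open>The induced action on fibre-valued tensors: in the fibre as given, in the arguments contragrediently.\<close>

definition tact :: "(real^7^7 \<Rightarrow> 'w \<Rightarrow> 'w) \<Rightarrow> real^7^7 \<Rightarrow> 'w::real_vector tensor_form \<Rightarrow> 'w tensor_form" where
  "tact act M T vs = act M (T vs) - (\<Sum>l<length vs. T (vs[l := M *v (vs ! l)]))"

lemma double_slot_swap:
  fixes T :: "'w::real_vector tensor_form"
  shows "(\<Sum>l<length vs. \<Sum>m<length vs. T (vs[l := M *v (vs ! l), m := N *v (vs[l := M *v (vs ! l)] ! m)]))
       - (\<Sum>l<length vs. \<Sum>m<length vs. T (vs[l := N *v (vs ! l), m := M *v (vs[l := N *v (vs ! l)] ! m)]))
     = (\<Sum>l<length vs. T (vs[l := N *v (M *v (vs ! l))])) - (\<Sum>l<length vs. T (vs[l := M *v (N *v (vs ! l))]))"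
proof -
  let ?n = "length vs"
  define off where "off = (\<lambda>M N. \<Sum>l<?n. \<Sum>m<?n. if m = l then 0 else T (vs[l := M *v (vs ! l), m := N *v (vs ! m)]))"
  have split: "(\<Sum>l<?n. \<Sum>m<?n. T (vs[l := M *v (vs ! l), m := N *v (vs[l := M *v (vs ! l)] ! m)]))
      = (\<Sum>l<?n. T (vs[l := N *v (M *v (vs ! l))])) + off M N" for M N
  proof -
    have "(\<Sum>m<?n. T (vs[l := M *v (vs ! l), m := N *v (vs[l := M *v (vs ! l)] ! m)]))
        = (\<Sum>m<?n. (if m = l then T (vs[l := N *v (M *v (vs ! l))]) else 0)
             + (if m = l then 0 else T (vs[l := M *v (vs ! l), m := N *v (vs ! m)])))" for l
      by (rule sum.cong) (auto simp: nth_list_update)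
    then show ?thesis unfolding off_def by (simp add: sum.distrib)
  qed
  have "off N M = off M N"
  proof -
    have "off N M = (\<Sum>m<?n. \<Sum>l<?n. if m = l then 0 else T (vs[l := N *v (vs ! l), m := M *v (vs ! m)]))"
      unfolding off_def by (rule sum.swap)
    also have "\<dots> = off M N" unfolding off_def
      by (intro sum.cong) (auto intro: list_update_swap arg_cong[where f = T])
    finally show ?thesis .
  qed
  then show ?thesis unfolding split by simp
qed

context lie_action
begin

lemmas act_add_left = bounded_bilinear.add_left[OF bounded_bilinear_act]
  and act_add_right = bounded_bilinear.add_right[OF bounded_bilinear_act]
  and act_diff_left = bounded_bilinear.diff_left[OF bounded_bilinear_act]
  and act_diff_right = bounded_bilinear.diff_right[OF bounded_bilinear_act]
  and act_scaleR_left = bounded_bilinear.scaleR_left[OF bounded_bilinear_act]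
  and act_scaleR_right = bounded_bilinear.scaleR_right[OF bounded_bilinear_act]
  and act_zero_right = bounded_bilinear.zero_right[OF bounded_bilinear_act]
  and act_sum_right = bounded_bilinear.sum_right[OF bounded_bilinear_act]

lemma tact_add_right: "tact act M (\<lambda>ws. S ws + T ws) vs = tact act M S vs + tact act M T vs"
  by (simp add: tact_def act_add_right sum.distrib)

lemma tact_diff_left:
  assumes "multilin T"
  shows "tact act (M - N) T vs = tact act M T vs - tact act N T vs"
proof -
  have "(\<Sum>l<length vs. T (vs[l := (M - N) *v (vs ! l)]))
      = (\<Sum>l<length vs. T (vs[l := M *v (vs ! l)]) - T (vs[l := N *v (vs ! l)]))"
    using assms by (intro sum.cong) (auto simp: matrix_vector_mult_diff_rdistrib linear_diff[OF multilinD])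
  then show ?thesis by (simp add: tact_def act_diff_left sum_subtractf)
qed

lemma tact_add_left:
  assumes "multilin T"
  shows "tact act (M + N) T vs = tact act M T vs + tact act N T vs"
proof -
  have "(\<Sum>l<length vs. T (vs[l := (M + N) *v (vs ! l)]))
      = (\<Sum>l<length vs. T (vs[l := M *v (vs ! l)]) + T (vs[l := N *v (vs ! l)]))"
    using assms by (intro sum.cong) (auto simp: matrix_vector_mult_add_rdistrib linear_add[OF multilinD])
  then show ?thesis by (simp add: tact_def act_add_left sum.distrib)
qed

text \<open>Tensors form a Lie algebra representation: the terms in which two different slots are hit
  cancel in the commutator.\<close>

lemma tact_bracket:
  assumes T: "multilin T"
  shows "tact act M (tact act N T) vs - tact act N (tact act M T) vs = tact act (M ** N - N ** M) T vs"
proof -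
  let ?n = "length vs"
  have 1: "tact act M (tact act N T) vs = act M (act N (T vs))
      - (\<Sum>l<?n. act M (T (vs[l := N *v (vs ! l)]))) - (\<Sum>l<?n. act N (T (vs[l := M *v (vs ! l)])))
      + (\<Sum>l<?n. \<Sum>m<?n. T (vs[l := M *v (vs ! l), m := N *v (vs[l := M *v (vs ! l)] ! m)]))" for M N
    by (simp add: tact_def act_diff_right act_sum_right sum_subtractf)
  have "(\<Sum>l<?n. T (vs[l := (M ** N - N ** M) *v (vs ! l)]))
      = (\<Sum>l<?n. T (vs[l := M *v (N *v (vs ! l))]) - T (vs[l := N *v (M *v (vs ! l))]))"
    using T by (intro sum.cong)
      (auto simp: matrix_vector_mult_diff_rdistrib linear_diff[OF multilinD] matrix_vector_mul_assoc)
  then have 2: "tact act (M ** N - N ** M) T vs = act M (act N (T vs)) - act N (act M (T vs))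
      - ((\<Sum>l<?n. T (vs[l := M *v (N *v (vs ! l))])) - (\<Sum>l<?n. T (vs[l := N *v (M *v (vs ! l))])))"
    by (simp add: tact_def act_bracket sum_subtractf)
  show ?thesis
    unfolding 1 2 using double_slot_swap[of T vs M N] by (simp add: algebra_simps)
qed

lemma has_derivative_tact:
  assumes U: "open U" "x \<in> U" and T: "\<And>y. y \<in> U \<Longrightarrow> multilin (T y)"
    and dT: "\<And>ws. (\<lambda>y. T y ws) differentiable (at x)"
    and M: "(M has_derivative M') (at x)"
  shows "((\<lambda>y. tact act (M y) (T y) vs) has_derivative
     (\<lambda>h. tact act (M' h) (T x) vs + tact act (M x) (\<lambda>ws. dirder (\<lambda>y. T y ws) x h) vs)) (at x)"
proof -
  have Mv: "((\<lambda>y. M y *v w) has_derivative (\<lambda>h. M' h *v w)) (at x)" for w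
    by (rule bounded_linear.has_derivative[OF bounded_bilinear.bounded_linear_left
          [OF bounded_bilinear_matrix_vector_mult] M])
  have "((\<lambda>y. act (M y) (T y vs) - (\<Sum>l<length vs. T y (vs[l := M y *v (vs ! l)]))) has_derivative
     (\<lambda>h. (act (M x) (dirder (\<lambda>y. T y vs) x h) + act (M' h) (T x vs))
        - (\<Sum>l<length vs. dirder (\<lambda>y. T y (vs[l := M x *v (vs ! l)])) x h + T x (vs[l := M' h *v (vs ! l)])))) (at x)"
    by (intro has_derivative_diff has_derivative_sum
        bounded_bilinear.FDERIV[OF bounded_bilinear_act M has_derivative_dirder[OF dT]]
        has_derivative_slot[OF U T dT Mv]) auto
  then show ?thesis
    by (simp add: tact_def sum.distrib algebra_simps)
qed

end

section \<open>Covariant derivatives in a chart\<close>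

lemma cov_tact:
  "cov act \<Gamma> \<omega> c x u vs = dirder (\<lambda>y. \<omega> c y vs) x u + tact act (\<Gamma> c x u) (\<omega> c x) vs"
  by (simp add: cov_def tact_def)

text \<open>For a multilinear field, smoothness on fixed lists of vectors is smoothness of its components.\<close>

definition smooth_field :: "'a chart \<Rightarrow> (real^7) set \<Rightarrow> ('a, 'w::real_normed_vector) field \<Rightarrow> bool" where
  "smooth_field c U \<omega> \<longleftrightarrow> (\<forall>vs. smooth_on U (\<lambda>y. \<omega> c y vs)) \<and> (\<forall>y\<in>U. multilin (\<omega> c y))"

text \<open>\<open>(\<nabla>\<^sup>2\<omega>)(v, u)\<close>, where \<open>v\<close> is the outer direction. The last summand lets the connection act on the slot
  of the inner direction \<open>u\<close>, which makes the expression tensorial.\<close>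

definition cov2 :: "(real^7^7 \<Rightarrow> 'w \<Rightarrow> 'w) \<Rightarrow> 'a conn \<Rightarrow> ('a, 'w::real_normed_vector) field \<Rightarrow>
    'a chart \<Rightarrow> real^7 \<Rightarrow> real^7 \<Rightarrow> real^7 \<Rightarrow> 'w tensor_form" where
  "cov2 act \<Gamma> \<omega> c x v u vs = dirder (\<lambda>y. cov act \<Gamma> \<omega> c y u vs) x v
     + tact act (\<Gamma> c x v) (cov act \<Gamma> \<omega> c x u) vs - cov act \<Gamma> \<omega> c x (\<Gamma> c x v *v u) vs"

text \<open>The computation takes place in the coordinates of a chart \<open>c\<close>, on an open set \<open>U\<close>. The symmetry
  \<open>\<Gamma>(u) v = \<Gamma>(v) u\<close> says that the connection has no torsion.\<close>

locale torsion_free_chart =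
  fixes c :: "'a chart" and U :: "(real^7) set" and \<Gamma> :: "'a conn"
  assumes open_U: "open U"
    and smooth_conn: "smooth_on U (\<lambda>y. \<Gamma> c y u)"
    and linear_conn: "y \<in> U \<Longrightarrow> linear (\<Gamma> c y)"
    and conn_sym: "y \<in> U \<Longrightarrow> \<Gamma> c y u *v v = \<Gamma> c y v *v u"
begin

abbreviation R :: "real^7 \<Rightarrow> real^7 \<Rightarrow> real^7 \<Rightarrow> real^7^7" where
  "R x u v \<equiv> curv \<Gamma> c x u v"

lemma conn_has_derivative:
  assumes "x \<in> U" shows "((\<lambda>y. \<Gamma> c y u) has_derivative dirder (\<lambda>y. \<Gamma> c y u) x) (at x)"
  by (rule has_derivative_dirder[OF smooth_on_differentiable[OF smooth_conn open_U assms]])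

lemma smooth_field_differentiable:
  "smooth_field c U \<omega> \<Longrightarrow> x \<in> U \<Longrightarrow> (\<lambda>y. \<omega> c y ws) differentiable (at x)"
  using open_U smooth_on_differentiable unfolding smooth_field_def by blast

lemma cov_has_derivative:
  assumes act: "lie_action act" and \<omega>: "smooth_field c U \<omega>" and x: "x \<in> U"
  shows "((\<lambda>y. cov act \<Gamma> \<omega> c y u vs) has_derivative
     (\<lambda>h. dirder (\<lambda>y. dirder (\<lambda>z. \<omega> c z vs) y u) x h
        + (tact act (dirder (\<lambda>y. \<Gamma> c y u) x h) (\<omega> c x) vs
           + tact act (\<Gamma> c x u) (\<lambda>ws. dirder (\<lambda>y. \<omega> c y ws) x h) vs))) (at x)"
  unfolding cov_tact
proof (intro has_derivative_add)
  show "((\<lambda>y. dirder (\<lambda>z. \<omega> c z vs) y u) has_derivative dirder (\<lambda>y. dirder (\<lambda>z. \<omega> c z vs) y u) x) (at x)"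
    using \<omega> by (intro has_derivative_dirder smooth_on_differentiable[OF _ open_U x] smooth_on_dirder)
      (simp add: smooth_field_def)
  show "((\<lambda>y. tact act (\<Gamma> c y u) (\<omega> c y) vs) has_derivative
     (\<lambda>h. tact act (dirder (\<lambda>y. \<Gamma> c y u) x h) (\<omega> c x) vs
         + tact act (\<Gamma> c x u) (\<lambda>ws. dirder (\<lambda>y. \<omega> c y ws) x h) vs)) (at x)"
    using \<omega> by (intro lie_action.has_derivative_tact[OF act open_U x] conn_has_derivative[OF x]
        smooth_field_differentiable[OF \<omega> x]) (simp add: smooth_field_def)
qed

text \<open>The Ricci identity. The second partial derivatives cancel by Schwarz, the first-order terms
  pairwise, and what is left is the action of \<open>d\<Gamma> + [\<Gamma>, \<Gamma>]\<close>.\<close>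

lemma ricci_identity:
  fixes \<omega> :: "('a, 'w::euclidean_space) field"
  assumes act: "lie_action act" and \<omega>: "smooth_field c U \<omega>" and x: "x \<in> U"
  shows "cov2 act \<Gamma> \<omega> c x v u vs - cov2 act \<Gamma> \<omega> c x u v vs = tact act (R x v u) (\<omega> c x) vs"
proof -
  interpret lie_action act by (rule act)
  have m: "multilin (\<omega> c x)" using \<omega> x by (simp add: smooth_field_def)
  let ?D = "\<lambda>u ws. dirder (\<lambda>y. \<omega> c y ws) x u"
  have e: "cov2 act \<Gamma> \<omega> c x v u vs = dirder (\<lambda>y. dirder (\<lambda>z. \<omega> c z vs) y u) x v
        + (tact act (dirder (\<lambda>y. \<Gamma> c y u) x v) (\<omega> c x) vs + tact act (\<Gamma> c x u) (?D v) vs)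
        + (tact act (\<Gamma> c x v) (?D u) vs + tact act (\<Gamma> c x v) (tact act (\<Gamma> c x u) (\<omega> c x)) vs)
        - cov act \<Gamma> \<omega> c x (\<Gamma> c x v *v u) vs" for u v
  proof -
    have "cov act \<Gamma> \<omega> c x u = (\<lambda>ws. ?D u ws + tact act (\<Gamma> c x u) (\<omega> c x) ws)"
      by (rule ext) (rule cov_tact)
    then have "tact act (\<Gamma> c x v) (cov act \<Gamma> \<omega> c x u) vs
        = tact act (\<Gamma> c x v) (?D u) vs + tact act (\<Gamma> c x v) (tact act (\<Gamma> c x u) (\<omega> c x)) vs"
      by (simp add: tact_add_right)
    then show ?thesis unfolding cov2_def dirder_eq[OF cov_has_derivative[OF act \<omega> x]] by simp
  qed
  have s: "dirder (\<lambda>y. dirder (\<lambda>z. \<omega> c z vs) y u) x v = dirder (\<lambda>y. dirder (\<lambda>z. \<omega> c z vs) y v) x u"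
    using symmetric_second_derivative[OF _ open_U x] \<omega> unfolding smooth_field_def by blast
  have "tact act (R x v u) (\<omega> c x) vs = tact act (dirder (\<lambda>y. \<Gamma> c y u) x v) (\<omega> c x) vs
      - tact act (dirder (\<lambda>y. \<Gamma> c y v) x u) (\<omega> c x) vs
      + (tact act (\<Gamma> c x v) (tact act (\<Gamma> c x u) (\<omega> c x)) vs - tact act (\<Gamma> c x u) (tact act (\<Gamma> c x v) (\<omega> c x)) vs)"
    unfolding curv_def tact_bracket[OF m] by (simp add: tact_diff_left[OF m] tact_add_left[OF m])
  then show ?thesis unfolding e s conn_sym[OF x, of v u] by (simp add: algebra_simps)
qed

text \<open>Both second covariant derivatives in the Ricci identity vanish.\<close>

lemma parallel_curvature:
  fixes \<omega> :: "('a, 'w::euclidean_space) field"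
  assumes act: "lie_action act" and \<omega>: "smooth_field c U \<omega>" and x: "x \<in> U"
    and par: "\<And>y u vs. y \<in> U \<Longrightarrow> cov act \<Gamma> \<omega> c y u vs = 0"
  shows "tact act (R x u v) (\<omega> c x) vs = 0"
proof -
  interpret lie_action act by (rule act)
  have "dirder (\<lambda>y. cov act \<Gamma> \<omega> c y w vs) x z = 0" for w z
    using frechet_derivative_cong_open[OF open_U x, of "\<lambda>y. cov act \<Gamma> \<omega> c y w vs" "\<lambda>y. 0"] par by simp
  then have "cov2 act \<Gamma> \<omega> c x w z vs = 0" for w z
    by (simp add: cov2_def par[OF x] tact_def act_zero_right)
  then show ?thesis using ricci_identity[OF act \<omega> x, of u v vs] by simp
qed

lemma curv_antisym: "R x v u = - R x u v"
  by (simp add: curv_def)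

lemma dirder_conn_apply:
  assumes "x \<in> U" shows "dirder (\<lambda>y. \<Gamma> c y v) x u *v w = dirder (\<lambda>y. \<Gamma> c y v *v w) x u"
  by (rule dirder_eq[symmetric], rule bounded_linear.has_derivative[OF bounded_bilinear.bounded_linear_left
        [OF bounded_bilinear_matrix_vector_mult] conn_has_derivative[OF assms]])

text \<open>The symmetry \<open>\<Gamma>(u) v = \<Gamma>(v) u\<close> makes the derivative terms and the products of connection matrices cancel in
  pairs in the cyclic sum.\<close>

lemma bianchi:
  assumes x: "x \<in> U"
  shows "R x u v *v w + R x v w *v u + R x w u *v v = 0"
proof -
  have d: "dirder (\<lambda>y. \<Gamma> c y v *v w) x u = dirder (\<lambda>y. \<Gamma> c y w *v v) x u" for u v w
    using frechet_derivative_cong_open[OF open_U x, of "\<lambda>y. \<Gamma> c y v *v w" "\<lambda>y. \<Gamma> c y w *v v"] conn_sym by simp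
  have e: "R x u v *v w = dirder (\<lambda>y. \<Gamma> c y v *v w) x u - dirder (\<lambda>y. \<Gamma> c y u *v w) x v
     + \<Gamma> c x u *v (\<Gamma> c x v *v w) - \<Gamma> c x v *v (\<Gamma> c x u *v w)" for u v w
    by (simp add: curv_def matrix_vector_mult_diff_rdistrib matrix_vector_mult_add_rdistrib
        dirder_conn_apply[OF x] matrix_vector_mul_assoc)
  show ?thesis
    unfolding e d[of w v u] d[of w u v] d[of v u w] conn_sym[OF x, of w v] conn_sym[OF x, of w u]
        conn_sym[OF x, of v u] by simp
qed

end

text \<open>Positivity of the metric is present as the existence of orthonormal bases at each point.\<close>

locale levi_civita_chart = torsion_free_chart c U \<Gamma>
  for c :: "'a chart" and U and \<Gamma> +
  fixes g :: "'a chart \<Rightarrow> real^7 \<Rightarrow> real^7^7"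
  assumes smooth_metric: "smooth_on U (g c)"
    and metric_sym: "y \<in> U \<Longrightarrow> bil (g c y) v w = bil (g c y) w v"
    and metric_frame: "y \<in> U \<Longrightarrow> \<exists>e :: 7 \<Rightarrow> real^7. \<forall>i j. bil (g c y) (e i) (e j) = (if i = j then 1 else 0)"
    and metric_parallel: "y \<in> U \<Longrightarrow> dirder (g c) y u + act_bil (\<Gamma> c y u) (g c y) = 0"
begin

lemma bil_linear:
  "bil B (v + w) z = bil B v z + bil B w z" "bil B z (v + w) = bil B z v + bil B z w"
  "bil B (r *\<^sub>R v) z = r * bil B v z" "bil B z (r *\<^sub>R v) = r * bil B z v"
  "bil B (v - w) z = bil B v z - bil B w z" "bil B z (v - w) = bil B z v - bil B z w"
  "bil B (- v) z = - bil B v z" "bil B z (- v) = - bil B z v"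
  "bil B 0 z = 0" "bil B z 0 = 0"
  by (simp_all add: bil_def inner_add_left inner_add_right matrix_vector_right_distrib matrix_vector_mult_scaleR
      inner_diff_left inner_diff_right matrix_vector_mult_diff_distrib matrix_vector_uminus_right)

text \<open>The metric is a parallel field of bilinear forms, so the curvature endomorphisms are skew.\<close>

lemma curv_skew:
  assumes x: "x \<in> U"
  shows "bil (g c x) (R x u v *v w) z = - bil (g c x) w (R x u v *v z)"
proof -
  define \<gamma> :: "('a, real^7^7) field" where "\<gamma> = (\<lambda>c y vs. if vs = [] then g c y else 0)"
  have sm: "smooth_field c U \<gamma>"
  proof -
    have "smooth_on U (\<lambda>y. \<gamma> c y vs)" for vs
    proof (cases "vs = []")
      case True
      then show ?thesis using smooth_metric by (simp add: \<gamma>_def)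
    next
      case False
      have "Ck_on n U (\<lambda>y. 0 :: real^7^7)" for n by (induction n) auto
      with False show ?thesis by (simp add: \<gamma>_def smooth_on_def)
    qed
    moreover have "multilin (\<gamma> c y)" for y
      unfolding multilin_def \<gamma>_def by (auto simp: linear_iff)
    ultimately show ?thesis by (simp add: smooth_field_def)
  qed
  have par: "cov act_bil \<Gamma> \<gamma> c y u vs = 0" if "y \<in> U" for y u vs
    using metric_parallel[OF that, of u]
    by (cases "vs = []") (auto simp: cov_def \<gamma>_def bilin.act_zero_right)
  have "tact act_bil (R x u v) (\<gamma> c x) [] = 0"
    by (rule parallel_curvature[OF bilin.lie_action_axioms sm x par])
  then have "act_bil (R x u v) (g c x) = 0" by (simp add: tact_def \<gamma>_def)
  then have "transpose (R x u v) ** g c x = - (g c x ** R x u v)"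
    unfolding act_bil_def by (metis add.inverse_inverse eq_iff_diff_eq_0)
  then have "w \<bullet> ((transpose (R x u v) ** g c x) *v z) = w \<bullet> (- (g c x ** R x u v) *v z)" by simp
  then show ?thesis
    by (simp add: bil_def matrix_vector_mul_assoc[symmetric] matrix_vector_uminus_left inner_matrix_transpose)
qed

text \<open>The pair symmetry is a linear consequence of the two skew symmetries and four instances of the Bianchi
  identity.\<close>

lemma curv_pair_sym:
  assumes x: "x \<in> U"
  shows "bil (g c x) (R x u v *v w) z = bil (g c x) (R x w z *v u) v"
proof -
  define K where "K = (\<lambda>u v w z. bil (g c x) (R x u v *v w) z)"
  have a: "K v u w z = - K u v w z" for u v w z
    unfolding K_def curv_antisym[of x v u] by (simp add: matrix_vector_uminus_left bil_linear)
  have s: "K u v z w = - K u v w z" for u v w z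
    unfolding K_def using curv_skew[OF x, of u v z w] metric_sym[OF x, of z "R x u v *v w"] by simp
  have b: "K u v w z + K v w u z + K w u v z = 0" for u v w z
    unfolding K_def bil_linear(1)[symmetric] bianchi[OF x] by (simp add: bil_linear)
  have 1: "K u v w z + K v w u z + K w u v z = 0" by (rule b)
  have 2: "- K v w u z + K w z v u + K z v w u = 0" using b[of v w z u] s[of v w u z] by simp
  have 3: "- K w z v u + K z u w v + K w u v z = 0"
    using b[of w z u v] s[of w z v u] a[of w u z v] s[of w u v z] by simp
  have 4: "- K z u w v - K u v w z + K z v w u = 0"
    using b[of z u v w] s[of z u w v] s[of u v w z] a[of z v u w] s[of z v w u] by simp
  have "K u v w z = - K w z v u" using 1 2 3 4 by linarith
  then have "K u v w z = K w z u v" using s[of w z v u] by simp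
  then show ?thesis by (simp only: K_def)
qed

end

section \<open>Metric contractions\<close>

definition onb :: "real^7^7 \<Rightarrow> (7 \<Rightarrow> real^7) \<Rightarrow> bool" where
  "onb G e \<longleftrightarrow> (\<forall>i j. bil G (e i) (e j) = (if i = j then 1 else 0))"

lemma matrix_inv_both:
  fixes A :: "real^'n^'n"
  assumes "invertible A"
  shows "A ** matrix_inv A = mat 1" "matrix_inv A ** A = mat 1"
  using someI_ex[of "\<lambda>B. A ** B = mat 1 \<and> B ** A = mat 1"] assms
  by (simp_all add: invertible_def matrix_inv_def)

lemma matrix_inv_unique:
  fixes A B :: "real^'n^'n"
  assumes "A ** B = mat 1"
  shows "matrix_inv B = A"
proof -
  have BA: "B ** A = mat 1" using assms matrix_left_right_inverse by blast
  then have "invertible B" using assms invertible_def by blast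
  then have "B ** matrix_inv B = mat 1" by (rule matrix_inv_both(1))
  then have "A ** (B ** matrix_inv B) = A" by simp
  then show ?thesis using assms by (simp add: matrix_mul_assoc)
qed

lemma frame_inverse_metric:
  assumes "onb G e"
  shows "(\<chi> a b. \<Sum>j\<in>UNIV. e j $ a * e j $ b) ** G = mat 1"
proof -
  define E :: "real^7^7" where "E = (\<chi> a j. e j $ a)"
  have "(transpose E ** G) ** E = mat 1"
  proof -
    have "((transpose E ** G) ** E) $ i $ j = bil G (e i) (e j)" for i j
    proof -
      have "((transpose E ** G) ** E) $ i $ j = (transpose E ** (G ** E)) $ i $ j" by (simp add: matrix_mul_assoc)
      also have "\<dots> = (\<Sum>k\<in>UNIV. e i $ k * (\<Sum>l\<in>UNIV. G $ k $ l * e j $ l))"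
        by (simp add: matrix_matrix_mult_def transpose_def E_def)
      finally show ?thesis by (simp add: bil_def inner_vec_def matrix_vector_mult_def)
    qed
    then show ?thesis using assms by (simp add: vec_eq_iff mat_def onb_def)
  qed
  then have "E ** (transpose E ** G) = mat 1" using matrix_left_right_inverse by blast
  moreover have "E ** transpose E = (\<chi> a b. \<Sum>j\<in>UNIV. e j $ a * e j $ b)"
    by (simp add: matrix_matrix_mult_def transpose_def E_def)
  ultimately show ?thesis by (simp add: matrix_mul_assoc)
qed

lemma frame_matrix_inv:
  assumes "onb G e"
  shows "matrix_inv G $ a $ b = (\<Sum>j\<in>UNIV. e j $ a * e j $ b)"
  by (simp add: matrix_inv_unique[OF frame_inverse_metric[OF assms]])

lemma frame_expand:
  assumes "onb G e"
  shows "v = (\<Sum>j\<in>UNIV. bil G (e j) v *\<^sub>R e j)"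
proof -
  have "v = ((\<chi> a b. \<Sum>j\<in>UNIV. e j $ a * e j $ b) ** G) *v v"
    by (simp add: frame_inverse_metric[OF assms])
  also have "\<dots> = (\<chi> a b. \<Sum>j\<in>UNIV. e j $ a * e j $ b) *v (G *v v)"
    by (simp add: matrix_vector_mul_assoc)
  also have "\<dots> = (\<Sum>j\<in>UNIV. bil G (e j) v *\<^sub>R e j)"
  proof (subst vec_eq_iff, rule allI)
    fix a
    have "((\<chi> a b. \<Sum>j\<in>UNIV. e j $ a * e j $ b) *v (G *v v)) $ a
        = (\<Sum>b\<in>UNIV. \<Sum>j\<in>UNIV. e j $ a * e j $ b * (G *v v) $ b)"
      by (simp add: matrix_vector_mult_def sum_distrib_right)
    also have "\<dots> = (\<Sum>j\<in>UNIV. \<Sum>b\<in>UNIV. e j $ a * e j $ b * (G *v v) $ b)"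
      by (rule sum.swap)
    finally show "((\<chi> a b. \<Sum>j\<in>UNIV. e j $ a * e j $ b) *v (G *v v)) $ a = (\<Sum>j\<in>UNIV. bil G (e j) v *\<^sub>R e j) $ a"
      by (simp add: bil_def inner_vec_def sum_distrib_left sum_distrib_right mult.assoc mult.left_commute mult.commute)
  qed
  finally show ?thesis .
qed

lemma axis_expand: "v = (\<Sum>a\<in>UNIV. (v $ a) *\<^sub>R axis a (1::real))" for v :: "real^'n"
  by (simp add: vec_eq_iff axis_def if_distrib cong: if_cong)

lemma bilinear_axis_expand:
  fixes B :: "real^'n \<Rightarrow> real^'n \<Rightarrow> 'w::real_vector"
  assumes B: "bilinear B"
  shows "B u v = (\<Sum>a\<in>UNIV. \<Sum>b\<in>UNIV. (u $ a * v $ b) *\<^sub>R B (axis a 1) (axis b 1))"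
proof -
  have l: "linear (\<lambda>u. B u v)" "linear (B u)" for u v using B by (simp_all add: bilinear_def)
  have "B u v = (\<Sum>a\<in>UNIV. (u $ a) *\<^sub>R B (axis a 1) v)"
    using axis_expand[of u] linear_sum[OF l(1)] linear_cmul[OF l(1)]
    by (metis (mono_tags, lifting) sum.cong)
  also have "\<dots> = (\<Sum>a\<in>UNIV. (u $ a) *\<^sub>R (\<Sum>b\<in>UNIV. (v $ b) *\<^sub>R B (axis a 1) (axis b 1)))"
    using axis_expand[of v] linear_sum[OF l(2)] linear_cmul[OF l(2)]
    by (metis (mono_tags, lifting) sum.cong)
  finally show ?thesis by (simp add: scaleR_right.sum)
qed

text \<open>Orthonormal frames are chosen point by point and need not depend continuously on the point, but the inverse
  metric is smooth. Expressed through it, contractions are independent of the frame and can be differentiated.\<close>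

lemma contraction_inverse_metric:
  fixes B :: "real^7 \<Rightarrow> real^7 \<Rightarrow> 'w::real_vector"
  assumes e: "onb G e" and B: "bilinear B"
  shows "(\<Sum>j\<in>UNIV. B (e j) (e j)) = (\<Sum>a\<in>UNIV. \<Sum>b\<in>UNIV. (matrix_inv G $ a $ b) *\<^sub>R B (axis a 1) (axis b 1))"
proof -
  have "(\<Sum>j\<in>UNIV. B (e j) (e j))
      = (\<Sum>j\<in>UNIV. \<Sum>a\<in>UNIV. \<Sum>b\<in>UNIV. (e j $ a * e j $ b) *\<^sub>R B (axis a 1) (axis b 1))"
    by (intro sum.cong refl bilinear_axis_expand B)
  also have "\<dots> = (\<Sum>a\<in>UNIV. \<Sum>j\<in>UNIV. \<Sum>b\<in>UNIV. (e j $ a * e j $ b) *\<^sub>R B (axis a 1) (axis b 1))"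
    by (rule sum.swap)
  also have "\<dots> = (\<Sum>a\<in>UNIV. \<Sum>b\<in>UNIV. \<Sum>j\<in>UNIV. (e j $ a * e j $ b) *\<^sub>R B (axis a 1) (axis b 1))"
    by (intro sum.cong refl sum.swap)
  finally show ?thesis by (simp add: frame_matrix_inv[OF e] scaleR_left.sum)
qed

lemma contraction_frame_indep:
  assumes "onb G e" "onb G f" "bilinear B"
  shows "(\<Sum>j\<in>UNIV. B (e j) (e j)) = (\<Sum>j\<in>UNIV. B (f j) (f j))"
  unfolding contraction_inverse_metric[OF assms(1,3)] contraction_inverse_metric[OF assms(2,3)] ..

lemma sum_lists_Suc:
  fixes f :: "'b::finite list \<Rightarrow> 'w::comm_monoid_add"
  shows "(\<Sum>I | length I = Suc p. f I) = (\<Sum>i\<in>UNIV. \<Sum>I | length I = p. f (i # I))"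
proof -
  have "{I :: 'b list. length I = Suc p} = (\<lambda>(i, I). i # I) ` (UNIV \<times> {I. length I = p})"
    by (auto simp: image_iff length_Suc_conv)
  moreover have "inj_on (\<lambda>(i, I). i # I) (UNIV \<times> {I :: 'b list. length I = p})"
    by (auto simp: inj_on_def)
  ultimately have "(\<Sum>I | length I = Suc p. f I) = (\<Sum>(i, I)\<in>UNIV \<times> {I. length I = p}. f (i # I))"
    by (simp add: sum.reindex case_prod_unfold)
  then show ?thesis by (simp add: sum.cartesian_product)
qed

lemma sum_lists_0 [simp]: "(\<Sum>I | length I = 0. f I) = f []"
  by simp

definition bimultilin :: "((real^7) list \<Rightarrow> (real^7) list \<Rightarrow> 'w::real_vector) \<Rightarrow> bool" where
  "bimultilin F \<longleftrightarrow> (\<forall>us. multilin (F us)) \<and> (\<forall>vs. multilin (\<lambda>us. F us vs))"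

lemma multilin_Cons: "multilin T \<Longrightarrow> multilin (\<lambda>ws. T (u # ws))"
  unfolding multilin_def
proof (intro allI impI)
  fix vs :: "(real^7) list" and l
  assume "\<forall>vs l. l < length vs \<longrightarrow> linear (\<lambda>v. T (vs[l := v]))" "l < length vs"
  then have "linear (\<lambda>v. T ((u # vs)[Suc l := v]))" by (metis Suc_less_eq length_Cons)
  then show "linear (\<lambda>v. T (u # vs[l := v]))" by simp
qed

lemma multilin_hd: "multilin T \<Longrightarrow> linear (\<lambda>u. T (u # ws))"
  using multilinD[of T 0 "0 # ws"] by simp

lemma bimultilin_Cons: "bimultilin F \<Longrightarrow> bimultilin (\<lambda>us vs. F (u # us) (v # vs))"
  unfolding bimultilin_def by (auto intro: multilin_Cons multilin_Cons[of "\<lambda>us. F us _"])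

lemma bimultilin_bilinear: "bimultilin F \<Longrightarrow> bilinear (\<lambda>u v. F (u # us) (v # vs))"
  unfolding bimultilin_def bilinear_def using multilin_hd[of "F _"] multilin_hd[of "\<lambda>us. F us _"] by blast

lemma bilinear_sum: "finite S \<Longrightarrow> (\<And>i. i \<in> S \<Longrightarrow> bilinear (B i)) \<Longrightarrow> bilinear (\<lambda>u v. \<Sum>i\<in>S. B i u v)"
  unfolding bilinear_def by (auto intro: linear_compose_sum)

text \<open>The frame is changed in one index at a time.\<close>

lemma list_contraction_frame_indep:
  assumes e: "onb G e" and f: "onb G f" and F: "bimultilin F"
  shows "(\<Sum>I | length I = p. F (map e I) (map e I)) = (\<Sum>I | length I = p. F (map f I) (map f I))"
  using F
proof (induction p arbitrary: F)
  case 0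
  then show ?case by simp
next
  case (Suc p)
  have fin: "finite {I :: 7 list. length I = p}" using finite_lists_length_eq[of "UNIV :: 7 set" p] by simp
  have "(\<Sum>I | length I = Suc p. F (map e I) (map e I))
      = (\<Sum>i\<in>UNIV. \<Sum>I | length I = p. F (e i # map e I) (e i # map e I))"
    by (simp add: sum_lists_Suc)
  also have "\<dots> = (\<Sum>i\<in>UNIV. \<Sum>I | length I = p. F (f i # map e I) (f i # map e I))"
    by (rule contraction_frame_indep[OF e f, of "\<lambda>u v. \<Sum>I | length I = p. F (u # map e I) (v # map e I)"])
       (intro bilinear_sum fin bimultilin_bilinear Suc.prems)
  also have "\<dots> = (\<Sum>i\<in>UNIV. \<Sum>I | length I = p. F (f i # map f I) (f i # map f I))"
    by (intro sum.cong refl Suc.IH bimultilin_Cons Suc.prems)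
  finally show ?case by (simp add: sum_lists_Suc)
qed

lemma differentiable_det:
  fixes A :: "'a::real_normed_vector \<Rightarrow> real^'n^'n"
  assumes "\<And>i j. (\<lambda>y. A y $ i $ j) differentiable (at x)"
  shows "(\<lambda>y. det (A y)) differentiable (at x)"
proof -
  have "(\<lambda>y. \<Prod>i\<in>UNIV. A y $ i $ p i) differentiable (at x)" for p
  proof -
    have "((\<lambda>y. A y $ i $ p i) has_derivative frechet_derivative (\<lambda>y. A y $ i $ p i) (at x)) (at x)" for i
      using assms frechet_derivative_works by blast
    from has_derivative_prod[of UNIV "\<lambda>i y. A y $ i $ p i" "\<lambda>i. frechet_derivative (\<lambda>y. A y $ i $ p i) (at x)", OF this] show ?thesis unfolding differentiable_def by blast
  qed
  then show ?thesis unfolding det_def by (auto intro!: differentiable_sum differentiable_mult)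
qed

lemma differentiable_nth:
  assumes "f differentiable (at x)" shows "(\<lambda>y. f y $ i) differentiable (at x)"
  using assms bounded_linear.has_derivative[OF bounded_linear_vec_nth] unfolding differentiable_def by blast

lemma differentiable_vec_lambda:
  fixes f :: "'a::real_normed_vector \<Rightarrow> 'b::euclidean_space^'n"
  assumes "\<And>i. (\<lambda>y. f y $ i) differentiable (at x)" shows "f differentiable (at x)"
proof -
  have a: "(f has_derivative (\<lambda>h. \<chi> i. frechet_derivative (\<lambda>y. f y $ i) (at x) h)) (at x)"
  proof (subst has_derivative_componentwise_within, rule ballI)
    fix b :: "'b^'n" assume "b \<in> Basis"
    then obtain i u where b: "b = axis i u" by (auto simp: Basis_vec_def)
    have "((\<lambda>y. f y $ i) has_derivative frechet_derivative (\<lambda>y. f y $ i) (at x)) (at x)"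
      using assms frechet_derivative_works by blast
    from has_derivative_inner_left[OF this, of u]
    show "((\<lambda>y. f y \<bullet> b) has_derivative (\<lambda>h. (\<chi> i. frechet_derivative (\<lambda>y. f y $ i) (at x) h) \<bullet> b)) (at x)"
      by (simp add: b inner_axis)
  qed
  then show ?thesis unfolding differentiable_def by blast
qed

text \<open>Cramer's rule makes the inverse differentiable, and differentiating \<open>A A\<^sup>-\<^sup>1 = 1\<close> gives the formula.\<close>

lemma has_derivative_matrix_inv:
  fixes A :: "'a::real_normed_vector \<Rightarrow> real^'n^'n"
  assumes U: "open U" "x \<in> U" and A: "(A has_derivative A') (at x)" and inv: "\<And>y. y \<in> U \<Longrightarrow> invertible (A y)"
  shows "((\<lambda>y. matrix_inv (A y)) has_derivative (\<lambda>h. - (matrix_inv (A x) ** A' h ** matrix_inv (A x)))) (at x)"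
proof -
  have Ad: "A differentiable (at x)" using A differentiable_def by blast
  have dx: "det (A y) \<noteq> 0" if "y \<in> U" for y using inv[OF that] by (simp add: invertible_det_nz)
  have cramer: "matrix_inv (A y) $ k $ l
      = det (\<chi> i j. if j = k then axis l 1 $ i else A y $ i $ j) / det (A y)" if "y \<in> U" for y k l
  proof -
    have "A y *v (matrix_inv (A y) *v axis l 1) = axis l 1"
      using matrix_inv_both(1)[OF inv[OF that]] by (simp add: matrix_vector_mul_assoc)
    then have "matrix_inv (A y) *v axis l 1 = (\<chi> k. det (\<chi> i j. if j = k then axis l 1 $ i else A y $ i $ j) / det (A y))"
      using cramer[OF dx[OF that]] by blast
    then show ?thesis
      by (metis (no_types, lifting) column_def matrix_vector_mul_component matrix_vector_mult_basis vec_lambda_beta)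
  qed
  have "(\<lambda>y. matrix_inv (A y) $ k $ l) differentiable (at x)" for k l
  proof (rule differentiable_transform_open[OF U])
    show "det (\<chi> i j. if j = k then axis l 1 $ i else A y $ i $ j) / det (A y) = matrix_inv (A y) $ k $ l" if "y \<in> U" for y
      using cramer[OF that] by simp
    have "(\<lambda>y. if j = k then axis l 1 $ i else A y $ i $ j) differentiable (at x)" for i j
      by (cases "j = k") (simp_all add: differentiable_nth Ad)
    then show "(\<lambda>y. det (\<chi> i j. if j = k then axis l 1 $ i else A y $ i $ j) / det (A y)) differentiable (at x)"
      using dx[OF U(2)] by (intro differentiable_divide differentiable_det) (auto intro!: differentiable_nth Ad)
  qed
  then have "(\<lambda>y. matrix_inv (A y)) differentiable (at x)"
    by (intro differentiable_vec_lambda) auto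
  then obtain H' where H': "((\<lambda>y. matrix_inv (A y)) has_derivative H') (at x)" unfolding differentiable_def by blast
  have h1: "((\<lambda>y. A y ** matrix_inv (A y)) has_derivative (\<lambda>h. A x ** H' h + A' h ** matrix_inv (A x))) (at x)"
    by (rule bounded_bilinear.FDERIV[OF bounded_bilinear_matrix_mult A H'])
  have h2: "((\<lambda>y. A y ** matrix_inv (A y)) has_derivative (\<lambda>h. 0)) (at x)"
    by (rule has_derivative_transform_within_open[OF has_derivative_const[of "mat 1"] U])
       (simp add: matrix_inv_both(1) inv)
  have z: "A x ** H' h + A' h ** matrix_inv (A x) = 0" for h
    using fun_cong[OF has_derivative_unique[OF h1 h2], of h] by simp
  have "H' h = - (matrix_inv (A x) ** A' h ** matrix_inv (A x))" for h
  proof -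
    have "matrix_inv (A x) ** (A x ** H' h) + matrix_inv (A x) ** (A' h ** matrix_inv (A x)) = 0"
      using arg_cong[OF z[of h], of "\<lambda>X. matrix_inv (A x) ** X"]
      by (simp only: matrix_add_ldistrib times0_right)
    then show ?thesis
      using matrix_inv_both(2)[OF inv[OF U(2)]] by (simp add: matrix_mul_assoc eq_neg_iff_add_eq_0)
  qed
  then have "H' = (\<lambda>h. - (matrix_inv (A x) ** A' h ** matrix_inv (A x)))" by blast
  with H' show ?thesis by simp
qed

context levi_civita_chart
begin

abbreviation e :: "real^7 \<Rightarrow> 7 \<Rightarrow> real^7" where "e y \<equiv> onframe (g c y)"

lemma onb_e: "y \<in> U \<Longrightarrow> onb (g c y) (e y)"
  unfolding onb_def onframe_def using someI_ex[OF metric_frame[of y]] by simp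

lemma invertible_metric: "y \<in> U \<Longrightarrow> invertible (g c y)"
  using frame_inverse_metric[OF onb_e] matrix_left_right_inverse invertible_def by blast

text \<open>Metric contractions are parallel: differentiating one is contracting the covariant derivative.
  The derivative of the inverse metric supplies the two terms with the connection matrix.\<close>

lemma contraction_has_derivative:
  fixes B :: "real^7 \<Rightarrow> real^7 \<Rightarrow> real^7 \<Rightarrow> 'w::real_normed_vector"
  assumes x: "x \<in> U" and B: "\<And>y. y \<in> U \<Longrightarrow> bilinear (B y)"
    and B': "\<And>u v. ((\<lambda>y. B y u v) has_derivative B' u v) (at x)"
  shows "((\<lambda>y. \<Sum>j\<in>UNIV. B y (e y j) (e y j)) has_derivative
     (\<lambda>h. \<Sum>j\<in>UNIV. B' (e x j) (e x j) h - B x (\<Gamma> c x h *v e x j) (e x j) - B x (e x j) (\<Gamma> c x h *v e x j))) (at x)"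
proof -
  let ?H = "matrix_inv (g c x)"
  have gd: "(g c has_derivative dirder (g c) x) (at x)"
    by (rule has_derivative_dirder[OF smooth_on_differentiable[OF smooth_metric open_U x]])
  have Hd: "((\<lambda>y. matrix_inv (g c y)) has_derivative (\<lambda>h. - (?H ** dirder (g c) x h ** ?H))) (at x)"
    by (rule has_derivative_matrix_inv[OF open_U x gd invertible_metric])
  have H': "- (?H ** dirder (g c) x h ** ?H) = - (?H ** transpose (\<Gamma> c x h)) - \<Gamma> c x h ** ?H" for h
  proof -
    have "dirder (g c) x h = transpose (\<Gamma> c x h) ** g c x + g c x ** \<Gamma> c x h"
      using metric_parallel[OF x, of h] by (simp add: act_bil_def algebra_simps)
    moreover have "?H ** (transpose (\<Gamma> c x h) ** g c x + g c x ** \<Gamma> c x h) ** ?H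
        = ?H ** transpose (\<Gamma> c x h) ** (g c x ** ?H) + (?H ** g c x) ** \<Gamma> c x h ** ?H"
      by (simp add: matrix_add_ldistrib matrix_add_rdistrib' matrix_mul_assoc)
    ultimately show ?thesis
      by (simp add: matrix_inv_both(2)[OF invertible_metric[OF x]] matrix_inv_both(1)[OF invertible_metric[OF x]])
  qed
  have nthd: "((\<lambda>y. matrix_inv (g c y) $ a $ b) has_derivative
      (\<lambda>h. (- (?H ** transpose (\<Gamma> c x h)) - \<Gamma> c x h ** ?H) $ a $ b)) (at x)" for a b
    using Hd unfolding H' by (intro bounded_linear.has_derivative[OF bounded_linear_vec_nth])
  have "((\<lambda>y. \<Sum>a\<in>UNIV. \<Sum>b\<in>UNIV. (matrix_inv (g c y) $ a $ b) *\<^sub>R B y (axis a 1) (axis b 1)) has_derivative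
     (\<lambda>h. \<Sum>a\<in>UNIV. \<Sum>b\<in>UNIV. (?H $ a $ b) *\<^sub>R B' (axis a 1) (axis b 1) h
        + ((- (?H ** transpose (\<Gamma> c x h)) - \<Gamma> c x h ** ?H) $ a $ b) *\<^sub>R B x (axis a 1) (axis b 1))) (at x)"
    by (intro has_derivative_sum has_derivative_scaleR nthd B')
  then have 1: "((\<lambda>y. \<Sum>j\<in>UNIV. B y (e y j) (e y j)) has_derivative
     (\<lambda>h. \<Sum>a\<in>UNIV. \<Sum>b\<in>UNIV. (?H $ a $ b) *\<^sub>R B' (axis a 1) (axis b 1) h
        + ((- (?H ** transpose (\<Gamma> c x h)) - \<Gamma> c x h ** ?H) $ a $ b) *\<^sub>R B x (axis a 1) (axis b 1))) (at x)"
    by (rule has_derivative_transform_within_open[OF _ open_U x])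
       (simp add: contraction_inverse_metric[OF onb_e B])
  have B'bil: "bilinear (\<lambda>u v. B' u v h)" for h
  proof -
    have l: "linear (B y u)" "linear (\<lambda>u. B y u v)" if "y \<in> U" for y u v
      using B[OF that] by (simp_all add: bilinear_def)
    note tr = has_derivative_transform_within_open[OF _ open_U x]
    have "B' (u + u') v = (\<lambda>h. B' u v h + B' u' v h)" for u u' v
      by (rule has_derivative_unique[OF B' tr[OF has_derivative_add[OF B' B']]]) (simp add: linear_add[OF l(2)])
    moreover have "B' u (v + v') = (\<lambda>h. B' u v h + B' u v' h)" for u v v'
      by (rule has_derivative_unique[OF B' tr[OF has_derivative_add[OF B' B']]]) (simp add: linear_add[OF l(1)])
    moreover have "B' (r *\<^sub>R u) v = (\<lambda>h. r *\<^sub>R B' u v h)" for u r v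
      by (rule has_derivative_unique[OF B' tr[OF has_derivative_scaleR_right[OF B']]]) (simp add: linear_cmul[OF l(2)])
    moreover have "B' u (r *\<^sub>R v) = (\<lambda>h. r *\<^sub>R B' u v h)" for u r v
      by (rule has_derivative_unique[OF B' tr[OF has_derivative_scaleR_right[OF B']]]) (simp add: linear_cmul[OF l(1)])
    ultimately show ?thesis by (auto simp: bilinear_def linear_iff)
  qed
  have lB: "linear (B x u)" "linear (\<lambda>u. B x u v)" for u v using B[OF x] by (simp_all add: bilinear_def)
  have mexp: "M *v axis k 1 = (\<Sum>a\<in>UNIV. (M $ a $ k) *\<^sub>R axis a 1)" for M :: "real^7^7" and k
    using axis_expand[of "M *v axis k 1"] by (simp add: matrix_vector_mult_basis column_def)
  have bl1: "bilinear (\<lambda>u v. B x (M *v u) v)" for M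
    using B[OF x] unfolding bilinear_def
    by (auto simp: linear_iff matrix_vector_right_distrib matrix_vector_mult_scaleR)
  have bl2: "bilinear (\<lambda>u v. B x u (M *v v))" for M
    using B[OF x] unfolding bilinear_def
    by (auto simp: linear_iff matrix_vector_right_distrib matrix_vector_mult_scaleR)
  have t1: "(\<Sum>a\<in>UNIV. \<Sum>b\<in>UNIV. ((M ** ?H) $ a $ b) *\<^sub>R B x (axis a 1) (axis b 1))
      = (\<Sum>j\<in>UNIV. B x (M *v e x j) (e x j))" for M :: "real^7^7"
  proof -
    have "(\<Sum>a\<in>UNIV. \<Sum>b\<in>UNIV. ((M ** ?H) $ a $ b) *\<^sub>R B x (axis a 1) (axis b 1))
        = (\<Sum>b\<in>UNIV. \<Sum>a\<in>UNIV. \<Sum>k\<in>UNIV. (M $ a $ k * ?H $ k $ b) *\<^sub>R B x (axis a 1) (axis b 1))"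
      by (subst sum.swap) (simp add: matrix_matrix_mult_def scaleR_left.sum)
    also have "\<dots> = (\<Sum>b\<in>UNIV. \<Sum>k\<in>UNIV. \<Sum>a\<in>UNIV. (M $ a $ k * ?H $ k $ b) *\<^sub>R B x (axis a 1) (axis b 1))"
      by (intro sum.cong refl sum.swap)
    also have "\<dots> = (\<Sum>b\<in>UNIV. \<Sum>k\<in>UNIV. (?H $ k $ b) *\<^sub>R B x (M *v axis k 1) (axis b 1))"
      by (simp add: mexp linear_sum[OF lB(2)] linear_cmul[OF lB(2)] scaleR_right.sum mult.commute)
    also have "\<dots> = (\<Sum>k\<in>UNIV. \<Sum>b\<in>UNIV. (?H $ k $ b) *\<^sub>R B x (M *v axis k 1) (axis b 1))"
      by (rule sum.swap)
    finally show ?thesis by (simp add: contraction_inverse_metric[OF onb_e[OF x] bl1])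
  qed
  have t2: "(\<Sum>a\<in>UNIV. \<Sum>b\<in>UNIV. ((?H ** transpose M) $ a $ b) *\<^sub>R B x (axis a 1) (axis b 1))
      = (\<Sum>j\<in>UNIV. B x (e x j) (M *v e x j))" for M :: "real^7^7"
  proof -
    have "(\<Sum>a\<in>UNIV. \<Sum>b\<in>UNIV. ((?H ** transpose M) $ a $ b) *\<^sub>R B x (axis a 1) (axis b 1))
        = (\<Sum>a\<in>UNIV. \<Sum>b\<in>UNIV. \<Sum>k\<in>UNIV. (?H $ a $ k * M $ b $ k) *\<^sub>R B x (axis a 1) (axis b 1))"
      by (simp add: matrix_matrix_mult_def transpose_def scaleR_left.sum)
    also have "\<dots> = (\<Sum>a\<in>UNIV. \<Sum>k\<in>UNIV. \<Sum>b\<in>UNIV. (?H $ a $ k * M $ b $ k) *\<^sub>R B x (axis a 1) (axis b 1))"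
      by (intro sum.cong refl sum.swap)
    also have "\<dots> = (\<Sum>a\<in>UNIV. \<Sum>k\<in>UNIV. (?H $ a $ k) *\<^sub>R B x (axis a 1) (M *v axis k 1))"
      by (simp add: mexp linear_sum[OF lB(1)] linear_cmul[OF lB(1)] scaleR_right.sum mult.commute)
    finally show ?thesis by (simp add: contraction_inverse_metric[OF onb_e[OF x] bl2])
  qed
  have "(\<Sum>a\<in>UNIV. \<Sum>b\<in>UNIV. (?H $ a $ b) *\<^sub>R B' (axis a 1) (axis b 1) h
        + ((- (?H ** transpose (\<Gamma> c x h)) - \<Gamma> c x h ** ?H) $ a $ b) *\<^sub>R B x (axis a 1) (axis b 1))
      = (\<Sum>j\<in>UNIV. B' (e x j) (e x j) h - B x (\<Gamma> c x h *v e x j) (e x j) - B x (e x j) (\<Gamma> c x h *v e x j))" for h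
    by (simp add: sum.distrib sum_subtractf scaleR_diff_left sum_negf t1 t2
        contraction_inverse_metric[OF onb_e[OF x] B'bil, symmetric])
  then show ?thesis using 1 by simp
qed

lemma list_contraction_has_derivative:
  fixes F :: "real^7 \<Rightarrow> (real^7) list \<Rightarrow> (real^7) list \<Rightarrow> 'w::real_normed_vector"
  assumes x: "x \<in> U" and F: "\<And>y. y \<in> U \<Longrightarrow> bimultilin (F y)"
    and F': "\<And>us vs. ((\<lambda>y. F y us vs) has_derivative F' us vs) (at x)"
  shows "((\<lambda>y. \<Sum>I | length I = p. F y (map (e y) I) (map (e y) I)) has_derivative
     (\<lambda>h. \<Sum>I | length I = p. F' (map (e x) I) (map (e x) I) h
        - (\<Sum>l<p. F x ((map (e x) I)[l := \<Gamma> c x h *v (map (e x) I ! l)]) (map (e x) I))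
        - (\<Sum>l<p. F x (map (e x) I) ((map (e x) I)[l := \<Gamma> c x h *v (map (e x) I ! l)])))) (at x)"
  using F F'
proof (induction p arbitrary: F F')
  case 0
  then show ?case by simp
next
  case (Suc p)
  have fin: "finite {I :: 7 list. length I = p}" using finite_lists_length_eq[of "UNIV :: 7 set" p] by simp
  define B where "B = (\<lambda>y u v. \<Sum>I | length I = p. F y (u # map (e y) I) (v # map (e y) I))"
  define B' where "B' = (\<lambda>u v h. \<Sum>I | length I = p. F' (u # map (e x) I) (v # map (e x) I) h
        - (\<Sum>l<p. F x (u # (map (e x) I)[l := \<Gamma> c x h *v (map (e x) I ! l)]) (v # map (e x) I))
        - (\<Sum>l<p. F x (u # map (e x) I) (v # (map (e x) I)[l := \<Gamma> c x h *v (map (e x) I ! l)])))"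
  have dB: "((\<lambda>y. B y u v) has_derivative B' u v) (at x)" for u v
    unfolding B_def B'_def by (rule Suc.IH) (auto intro: bimultilin_Cons Suc.prems)
  have bB: "bilinear (B y)" if "y \<in> U" for y
    unfolding B_def by (intro bilinear_sum fin bimultilin_bilinear Suc.prems(1) that)
  have fe: "(\<Sum>I | length I = Suc p. F y (map (e y) I) (map (e y) I)) = (\<Sum>j\<in>UNIV. B y (e y j) (e y j))" for y
    by (simp add: sum_lists_Suc B_def)
  show ?case
    unfolding fe
  proof (rule has_derivative_eq_rhs, rule contraction_has_derivative[where B = B and B' = B', OF x bB dB], assumption, rule ext)
    fix h
    show "(\<Sum>j\<in>UNIV. B' (e x j) (e x j) h - B x (\<Gamma> c x h *v e x j) (e x j) - B x (e x j) (\<Gamma> c x h *v e x j))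
      = (\<Sum>I | length I = Suc p. F' (map (e x) I) (map (e x) I) h
        - (\<Sum>l<Suc p. F x ((map (e x) I)[l := \<Gamma> c x h *v (map (e x) I ! l)]) (map (e x) I))
        - (\<Sum>l<Suc p. F x (map (e x) I) ((map (e x) I)[l := \<Gamma> c x h *v (map (e x) I ! l)])))"
      unfolding sum_lists_Suc B_def B'_def sum_subtractf[symmetric]
      by (intro sum.cong refl) (simp add: sum.lessThan_Suc_shift del: sum.lessThan_Suc)
  qed
qed

end

section \<open>Alternating forms\<close>

lemma alt_forms_len: "T \<in> alt_forms p \<Longrightarrow> length vs \<noteq> p \<Longrightarrow> T vs = 0"
  by (simp add: alt_forms_def)

lemma alt_forms_eq0:
  "T \<in> alt_forms p \<Longrightarrow> i < length vs \<Longrightarrow> j < length vs \<Longrightarrow> i \<noteq> j \<Longrightarrow> vs ! i = vs ! j \<Longrightarrow> T vs = 0"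
  by (cases "length vs = p") (auto simp: alt_forms_def)

lemma alt_forms_update_swap:
  assumes T: "T \<in> alt_forms p" and ij: "i < length vs" "j < length vs" "i \<noteq> j"
  shows "T (vs[i := a, j := b]) = - T (vs[i := b, j := a])"
proof -
  have m: "multilin T" using T by (rule alt_forms_multilin)
  define f where "f = (\<lambda>u w. T (vs[i := u, j := w]))"
  have l2: "linear (f u)" for u
    unfolding f_def using multilinD[OF m, of j "vs[i := u]"] ij by simp
  have l1: "linear (\<lambda>u. f u w)" for w
    unfolding f_def using multilinD[OF m, of i "vs[j := w]"] ij by (simp add: list_update_swap[of i j])
  have z: "f u u = 0" for u
    unfolding f_def using ij by (intro alt_forms_eq0[OF T, of i _ j]) (auto simp: nth_list_update)
  have "f (a + b) (a + b) = f a a + f a b + (f b a + f b b)"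
    by (simp only: linear_add[OF l1] linear_add[OF l2] ac_simps)
  then have "f a b + f b a = 0" by (simp add: z)
  then have "f a b = - f b a" by (simp add: eq_neg_iff_add_eq_0)
  then show ?thesis by (simp add: f_def)
qed

lemma alt_forms_move:
  assumes T: "T \<in> alt_forms p"
  shows "T (xs @ a # ys) = (-1) ^ length xs *\<^sub>R T (a # xs @ ys)"
proof (induction xs arbitrary: ys rule: rev_induct)
  case Nil
  then show ?case by simp
next
  case (snoc x xs)
  let ?n = "length xs"
  have "T (xs @ x # a # ys) = - T (xs @ a # x # ys)"
    using alt_forms_update_swap[OF T, of ?n "xs @ x # a # ys" "Suc ?n" x a]
    by (simp add: list_update_append nth_append)
  also have "\<dots> = - ((-1) ^ ?n *\<^sub>R T (a # xs @ x # ys))" using snoc.IH[of "x # ys"] by simp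
  finally show ?case by simp
qed

lemma alt_forms_update:
  assumes "T \<in> alt_forms p" "l < length vs"
  shows "T (vs[l := z]) = (-1) ^ l *\<^sub>R T (z # drop_nth l vs)"
  using alt_forms_move[OF assms(1), of "take l vs" z "drop (Suc l) vs"] assms(2)
  by (simp add: upd_conv_take_nth_drop drop_nth_def)

lemma length_drop_nth [simp]: "i < length vs \<Longrightarrow> length (drop_nth i vs) = length vs - 1"
  by (auto simp: drop_nth_def)

lemma nth_drop_nth:
  "i < length vs \<Longrightarrow> k < length vs - 1 \<Longrightarrow> drop_nth i vs ! k = (if k < i then vs ! k else vs ! Suc k)"
  by (auto simp: drop_nth_def nth_append min_def)

text \<open>The position of entry \<open>j \<noteq> i\<close> of a list from which entry \<open>i\<close> has been removed.\<close>

definition pos_after :: "nat \<Rightarrow> nat \<Rightarrow> nat" where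
  "pos_after i j = (if j < i then j else j - 1)"

lemma sum_pos_after:
  assumes "i < n"
  shows "(\<Sum>m<n - 1. h m) = (\<Sum>j\<in>{..<n} - {i}. h (pos_after i j))"
proof (rule sum.reindex_bij_witness[of _ "pos_after i" "\<lambda>m. if m < i then m else Suc m"])
qed (use assms in \<open>auto simp: pos_after_def\<close>)

lemma drop_nth_nth_pos_after:
  "i < length vs \<Longrightarrow> j < length vs \<Longrightarrow> i \<noteq> j \<Longrightarrow> drop_nth i vs ! pos_after i j = vs ! j"
  by (auto simp: nth_drop_nth pos_after_def)

lemma drop_nth_update_same: "i < length vs \<Longrightarrow> drop_nth i (vs[i := z]) = drop_nth i vs"
  by (simp add: drop_nth_def)

lemma drop_nth_update:
  assumes "i < length vs" "j < length vs" "i \<noteq> j"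
  shows "drop_nth i (vs[j := z]) = (drop_nth i vs)[pos_after i j := z]"
  using assms by (intro nth_equalityI) (auto simp: nth_drop_nth pos_after_def nth_list_update)

lemma drop_nth_commute:
  assumes "i < length vs" "j < length vs" "i \<noteq> j"
  shows "drop_nth (pos_after i j) (drop_nth i vs) = drop_nth (pos_after j i) (drop_nth j vs)"
  using assms by (intro nth_equalityI) (auto simp: nth_drop_nth pos_after_def)

lemma pos_after_less: "i < n \<Longrightarrow> j < n \<Longrightarrow> i \<noteq> j \<Longrightarrow> pos_after i j < n - 1"
  by (auto simp: pos_after_def)

lemma pos_after_sign:
  assumes "i \<noteq> j" shows "(-1::real) ^ i * (-1) ^ pos_after i j = - ((-1) ^ j * (-1) ^ pos_after j i)"
proof -
  have *: "(-1::real) ^ i * (-1) ^ (j - 1) = - ((-1) ^ j * (-1) ^ i)" if "i < j" for i j :: nat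
    using that by (cases j) (simp_all add: mult.commute)
  show ?thesis
    using assms *[of i j] *[of j i] by (cases "i < j") (auto simp: pos_after_def)
qed

text \<open>Symmetric terms drop out of an alternation: exchanging the two entries that they involve
  changes the sign of the permutation.\<close>

lemma alternation_symmetric:
  fixes T :: "'w::real_vector tensor_form"
  assumes T: "T \<in> alt_forms p" and b: "\<And>u v. b u v = b v u"
  shows "(\<Sum>i<length vs. (-1) ^ i *\<^sub>R
      (\<Sum>l<length vs - 1. T ((drop_nth i vs)[l := b (vs ! i) (drop_nth i vs ! l)]))) = 0"
proof -
  let ?n = "length vs"
  \<comment> \<open>The summand in which the entries \<open>i\<close> and \<open>j\<close> have been removed and merged into the first entry.\<close>
  define t where "t = (\<lambda>i j. ((-1) ^ i * (-1) ^ pos_after i j) *\<^sub>R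
      T (b (vs ! i) (vs ! j) # drop_nth (pos_after i j) (drop_nth i vs)))"
  have anti: "t i j = - t j i" if "i < ?n" "j < ?n" "i \<noteq> j" for i j
    unfolding t_def pos_after_sign[OF that(3)] drop_nth_commute[OF that] b[of "vs ! i" "vs ! j"] by simp
  define t' where "t' = (\<lambda>i j. if i = j then 0 else t i j)"
  have anti': "t' i j = - t' j i" if "i < ?n" "j < ?n" for i j
  proof (cases "i = j")
    case False
    then have "t' i j = t i j" "t' j i = t j i" by (simp_all add: t'_def)
    then show ?thesis using anti[OF that False] by (simp only:)
  qed (simp add: t'_def)
  have "(\<Sum>i<?n. (-1) ^ i *\<^sub>R (\<Sum>l<?n - 1. T ((drop_nth i vs)[l := b (vs ! i) (drop_nth i vs ! l)])))
      = (\<Sum>i<?n. \<Sum>j<?n. t' i j)"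
  proof (rule sum.cong[OF refl])
    fix i assume "i \<in> {..<?n}"
    then have i: "i < ?n" by simp
    have "(\<Sum>l<?n - 1. T ((drop_nth i vs)[l := b (vs ! i) (drop_nth i vs ! l)]))
        = (\<Sum>j\<in>{..<?n} - {i}. T ((drop_nth i vs)[pos_after i j := b (vs ! i) (drop_nth i vs ! pos_after i j)]))"
      by (rule sum_pos_after[OF i])
    also have "\<dots> = (\<Sum>j\<in>{..<?n} - {i}. (-1) ^ pos_after i j *\<^sub>R
        T (b (vs ! i) (vs ! j) # drop_nth (pos_after i j) (drop_nth i vs)))"
    proof (rule sum.cong[OF refl])
      fix j assume "j \<in> {..<?n} - {i}"
      then have j: "j < ?n" "i \<noteq> j" by auto
      have "pos_after i j < length (drop_nth i vs)" using pos_after_less[OF i j] i by simp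
      from alt_forms_update[OF T this]
      show "T ((drop_nth i vs)[pos_after i j := b (vs ! i) (drop_nth i vs ! pos_after i j)])
        = (-1) ^ pos_after i j *\<^sub>R T (b (vs ! i) (vs ! j) # drop_nth (pos_after i j) (drop_nth i vs))"
        by (simp add: drop_nth_nth_pos_after[OF i j])
    qed
    finally have "(-1) ^ i *\<^sub>R (\<Sum>l<?n - 1. T ((drop_nth i vs)[l := b (vs ! i) (drop_nth i vs ! l)]))
        = (\<Sum>j\<in>{..<?n} - {i}. t' i j)"
      by (simp add: scaleR_sum_right t_def t'_def)
    also have "\<dots> = (\<Sum>j<?n. t' i j)"
      by (rule sum.mono_neutral_left) (auto simp: t'_def)
    finally show "(-1) ^ i *\<^sub>R (\<Sum>l<?n - 1. T ((drop_nth i vs)[l := b (vs ! i) (drop_nth i vs ! l)]))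
        = (\<Sum>j<?n. t' i j)" .
  qed
  moreover have "(\<Sum>i<?n. \<Sum>j<?n. t' i j) = - (\<Sum>i<?n. \<Sum>j<?n. t' i j)"
  proof -
    have "(\<Sum>i<?n. \<Sum>j<?n. t' i j) = (\<Sum>j<?n. \<Sum>i<?n. t' i j)" by (rule sum.swap)
    also have "\<dots> = (\<Sum>j<?n. \<Sum>i<?n. - t' j i)"
      by (intro sum.cong refl anti') simp_all
    finally show ?thesis by (simp add: sum_negf)
  qed
  moreover have "S = 0" if "S = - S" for S :: 'w
    using eq_neg_iff_add_eq_0[THEN iffD1, OF that] scaleR_2[of S] by simp
  ultimately show ?thesis by simp
qed

lemma alt_formsI:
  assumes "\<And>vs. length vs \<noteq> p \<Longrightarrow> T vs = 0" "multilin T"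
    and "\<And>vs i j. length vs = p \<Longrightarrow> i < p \<Longrightarrow> j < p \<Longrightarrow> i \<noteq> j \<Longrightarrow> vs ! i = vs ! j \<Longrightarrow> T vs = 0"
  shows "T \<in> alt_forms p"
  using assms unfolding alt_forms_def multilin_def by auto

lemma alt_forms_sum:
  assumes "\<And>i. i \<in> S \<Longrightarrow> T i \<in> alt_forms p"
  shows "(\<lambda>vs. \<Sum>i\<in>S. T i vs) \<in> alt_forms p"
proof (rule alt_formsI)
  show "(\<Sum>i\<in>S. T i vs) = 0" if "length vs \<noteq> p" for vs
    using that by (intro sum.neutral ballI alt_forms_len[OF assms])
  show "multilin (\<lambda>vs. \<Sum>i\<in>S. T i vs)"
    unfolding multilin_def using multilinD[OF alt_forms_multilin[OF assms]]
    by (auto intro!: linear_compose_sum)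
  show "(\<Sum>i\<in>S. T i vs) = 0" if "length vs = p" "i < p" "j < p" "i \<noteq> j" "vs ! i = vs ! j" for vs i j
    using that by (intro sum.neutral ballI alt_forms_eq0[OF assms, where i = i and j = j]) auto
qed

lemma alt_forms_compose_linear:
  assumes T: "T \<in> alt_forms p" and f: "linear f"
  shows "(\<lambda>vs. f (T vs)) \<in> alt_forms p"
proof (rule alt_formsI)
  show "f (T vs) = 0" if "length vs \<noteq> p" for vs using alt_forms_len[OF T that] linear_0[OF f] by simp
  show "multilin (\<lambda>vs. f (T vs))"
    unfolding multilin_def
    by (auto intro!: linear_compose[OF _ f, unfolded o_def] multilinD[OF alt_forms_multilin[OF T]])
  show "f (T vs) = 0" if "length vs = p" "i < p" "j < p" "i \<noteq> j" "vs ! i = vs ! j" for vs i j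
    using alt_forms_eq0[OF T, of i vs j] that linear_0[OF f] by simp
qed

lemma alt_forms_add:
  assumes "S \<in> alt_forms p" "T \<in> alt_forms p"
  shows "(\<lambda>vs. S vs + T vs) \<in> alt_forms p"
  using alt_forms_sum[of UNIV "\<lambda>b. if b then S else T" p] assms by (simp add: UNIV_bool add.commute)

lemma alt_forms_diff:
  assumes "S \<in> alt_forms p" "T \<in> alt_forms p"
  shows "(\<lambda>vs. S vs - T vs) \<in> alt_forms p"
  using alt_forms_add[OF assms(1) alt_forms_compose_linear[OF assms(2), of uminus]] by (simp add: linear_uminus)

lemma alt_forms_slots:
  assumes T: "T \<in> alt_forms p"
  shows "(\<lambda>vs. \<Sum>l<length vs. T (vs[l := M *v (vs ! l)])) \<in> alt_forms p"
proof (rule alt_formsI)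
  have m: "multilin T" using T by (rule alt_forms_multilin)
  show "(\<Sum>l<length vs. T (vs[l := M *v (vs ! l)])) = 0" if "length vs \<noteq> p" for vs
    using that by (simp add: alt_forms_len[OF T])
  show "multilin (\<lambda>vs. \<Sum>l<length vs. T (vs[l := M *v (vs ! l)]))"
    unfolding multilin_def length_list_update
  proof (intro allI impI linear_compose_sum ballI)
    fix vs :: "(real^7) list" and k l assume k: "k < length vs" and "l \<in> {..<length vs}"
    then have l: "l < length vs" by simp
    show "linear (\<lambda>v. T (vs[k := v, l := M *v (vs[k := v] ! l)]))"
    proof (cases "l = k")
      case True
      have "linear (\<lambda>v. T (vs[k := M *v v]))"
        using linear_compose[OF matrix_vector_mul_linear[of M] multilinD[OF m k]] by (simp add: o_def)
      then show ?thesis using True k by simp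
    next
      case False
      then show ?thesis
        using multilinD[OF m, of k "vs[l := M *v (vs ! l)]"] k by (simp add: list_update_swap[of k l])
    qed
  qed
  show "(\<Sum>l<length vs. T (vs[l := M *v (vs ! l)])) = 0"
    if h: "length vs = p" "i < p" "j < p" "i \<noteq> j" "vs ! i = vs ! j" for vs i j
  proof -
    have z: "T (vs[l := M *v (vs ! l)]) = 0" if "l \<noteq> i" "l \<noteq> j" for l
      using h that by (intro alt_forms_eq0[OF T, of i _ j]) auto
    have "(\<Sum>l<length vs. T (vs[l := M *v (vs ! l)])) = (\<Sum>l\<in>{i, j}. T (vs[l := M *v (vs ! l)]))"
      using h z by (intro sum.mono_neutral_right) auto
    also have "\<dots> = T (vs[i := M *v (vs ! i)]) + T (vs[j := M *v (vs ! j)])" using h by simp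
    also have "\<dots> = T (vs[i := M *v (vs ! i), j := vs ! j]) + T (vs[i := vs ! i, j := M *v (vs ! j)])"
      using list_update_id[of "vs[i := M *v (vs ! i)]" j] list_update_id[of vs i] h by simp
    also have "\<dots> = 0"
      using alt_forms_update_swap[OF T, of i vs j "M *v (vs ! i)" "vs ! j"] h by simp
    finally show ?thesis .
  qed
qed

lemma (in lie_action) tact_alt:
  assumes T: "T \<in> alt_forms p" shows "tact act M T \<in> alt_forms p"
proof -
  have "linear (act M)" using bounded_bilinear_act by (simp add: bounded_bilinear.bounded_linear_right bounded_linear.linear)
  from alt_forms_diff[OF alt_forms_compose_linear[OF T this] alt_forms_slots[OF T, of M]]
  show ?thesis unfolding tact_def[abs_def] .
qed

lemma dirder_alt:
  fixes T :: "real^7 \<Rightarrow> 'w::real_normed_vector tensor_form"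
  assumes U: "open U" "x \<in> U" and T: "\<And>y. y \<in> U \<Longrightarrow> T y \<in> alt_forms p"
    and dT: "\<And>ws. (\<lambda>y. T y ws) differentiable (at x)"
  shows "(\<lambda>ws. dirder (\<lambda>y. T y ws) x h) \<in> alt_forms p"
proof (rule alt_formsI)
  have z: "dirder (\<lambda>y. T y ws) x h = 0" if "\<And>y. y \<in> U \<Longrightarrow> T y ws = 0" for ws
    using frechet_derivative_cong_open[OF U, of "\<lambda>y. T y ws" "\<lambda>y. 0"] that by simp
  show "dirder (\<lambda>y. T y ws) x h = 0" if "length ws \<noteq> p" for ws
    using that by (intro z alt_forms_len[OF T])
  show "multilin (\<lambda>ws. dirder (\<lambda>y. T y ws) x h)"
    by (rule multilin_dirder[OF U alt_forms_multilin[OF T] dT])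
  show "dirder (\<lambda>y. T y vs) x h = 0" if "length vs = p" "i < p" "j < p" "i \<noteq> j" "vs ! i = vs ! j" for vs i j
    using that by (intro z alt_forms_eq0[OF T, of _ i _ j]) auto
qed

section \<open>The exterior covariant derivative of a torsion-free connection\<close>

context torsion_free_chart
begin

lemma cov_alt:
  assumes act: "lie_action act" and x: "x \<in> U" and \<omega>: "\<And>y. y \<in> U \<Longrightarrow> \<omega> c y \<in> alt_forms p"
    and d: "\<And>ws. (\<lambda>y. \<omega> c y ws) differentiable (at x)"
  shows "cov act \<Gamma> \<omega> c x u \<in> alt_forms p"
  using alt_forms_add[OF dirder_alt[where T = "\<omega> c", OF open_U x \<omega> d] lie_action.tact_alt[OF act \<omega>[OF x]]]
  unfolding cov_tact[abs_def] by simp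

text \<open>Cartan's formula differs from the alternated covariant derivative by the action of the connection on the form
  slots. This action is symmetric in the direction and the slot because the connection has no torsion.\<close>

lemma ext_cov_alternation:
  assumes x: "x \<in> U" and \<omega>: "\<omega> c x \<in> alt_forms p"
  shows "ext_cov act \<Gamma> \<omega> c x vs
    = (\<Sum>i<length vs. (-1) ^ i *\<^sub>R cov act \<Gamma> \<omega> c x (vs ! i) (drop_nth i vs))"
proof -
  have "(\<Sum>i<length vs. (-1) ^ i *\<^sub>R cov act \<Gamma> \<omega> c x (vs ! i) (drop_nth i vs))
    = ext_cov act \<Gamma> \<omega> c x vs - (\<Sum>i<length vs. (-1) ^ i *\<^sub>R
      (\<Sum>l<length vs - 1. \<omega> c x ((drop_nth i vs)[l := \<Gamma> c x (vs ! i) *v (drop_nth i vs ! l)])))"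
    unfolding ext_cov_def cov_def sum_subtractf[symmetric]
    by (intro sum.cong refl) (simp add: scaleR_diff_right)
  also have "(\<Sum>i<length vs. (-1) ^ i *\<^sub>R
      (\<Sum>l<length vs - 1. \<omega> c x ((drop_nth i vs)[l := \<Gamma> c x (vs ! i) *v (drop_nth i vs ! l)]))) = 0"
    by (rule alternation_symmetric[OF \<omega>, of "\<lambda>u v. \<Gamma> c x u *v v"]) (rule conn_sym[OF x])
  finally show ?thesis by simp
qed

lemma cov_linear_direction:
  assumes act: "lie_action act" and x: "x \<in> U" and \<omega>: "multilin (\<omega> c x)" "(\<lambda>y. \<omega> c y vs) differentiable (at x)"
  shows "linear (\<lambda>u. cov act \<Gamma> \<omega> c x u vs)"
proof -
  interpret lie_action act by (rule act)
  have l: "linear (\<Gamma> c x)" by (rule linear_conn[OF x])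
  have d: "linear (dirder (\<lambda>y. \<omega> c y vs) x)" by (rule linear_frechet_derivative[OF \<omega>(2)])
  have s: "tact act (r *\<^sub>R M) (\<omega> c x) vs = r *\<^sub>R tact act M (\<omega> c x) vs" for r M
  proof -
    have "(\<Sum>l<length vs. \<omega> c x (vs[l := (r *\<^sub>R M) *v (vs ! l)])) = (\<Sum>l<length vs. r *\<^sub>R \<omega> c x (vs[l := M *v (vs ! l)]))"
      by (intro sum.cong refl)
        (auto simp: scaleR_matrix_vector_assoc[symmetric] linear_cmul[OF multilinD[OF \<omega>(1)]])
    then show ?thesis by (simp add: tact_def act_scaleR_left scaleR_diff_right scaleR_sum_right)
  qed
  show ?thesis
    unfolding cov_tact
    by (rule linearI)
      (simp_all add: linear_add[OF d] linear_cmul[OF d] linear_add[OF l] linear_cmul[OF l]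
        tact_add_left[OF \<omega>(1)] s scaleR_add_right)
qed

text \<open>In the covariant derivative of the alternation, the connection acting on the slot that has been moved to the
  front is the correction term of \<open>cov2\<close>.\<close>

lemma cov_ext_cov:
  fixes \<omega> :: "('a, 'w::euclidean_space) field"
  assumes act: "lie_action act" and \<omega>: "smooth_field c U \<omega>" and x: "x \<in> U"
    and alt: "\<And>y. y \<in> U \<Longrightarrow> \<omega> c y \<in> alt_forms p"
  shows "cov act \<Gamma> (ext_cov act \<Gamma> \<omega>) c x u vs
    = (\<Sum>i<length vs. (-1) ^ i *\<^sub>R cov2 act \<Gamma> \<omega> c x u (vs ! i) (drop_nth i vs))"
proof -
  interpret lie_action act by (rule act)
  let ?n = "length vs" and ?M = "\<Gamma> c x u" and ?C = "cov act \<Gamma> \<omega> c x"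
  have ext: "ext_cov act \<Gamma> \<omega> c y ws = (\<Sum>i<length ws. (-1) ^ i *\<^sub>R cov act \<Gamma> \<omega> c y (ws ! i) (drop_nth i ws))"
    if "y \<in> U" for y ws by (rule ext_cov_alternation[where \<omega> = \<omega>, OF that alt[OF that]])
  have cd: "((\<lambda>y. cov act \<Gamma> \<omega> c y v ws) has_derivative dirder (\<lambda>y. cov act \<Gamma> \<omega> c y v ws) x) (at x)" for v ws
    using cov_has_derivative[OF act \<omega> x] by (intro has_derivative_dirder) (auto simp: differentiable_def)
  have 1: "dirder (\<lambda>y. ext_cov act \<Gamma> \<omega> c y vs) x u
      = (\<Sum>i<?n. (-1) ^ i *\<^sub>R dirder (\<lambda>y. cov act \<Gamma> \<omega> c y (vs ! i) (drop_nth i vs)) x u)"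
  proof (rule dirder_eq, rule has_derivative_transform_within_open[OF _ open_U x])
    show "((\<lambda>y. \<Sum>i<?n. (-1) ^ i *\<^sub>R cov act \<Gamma> \<omega> c y (vs ! i) (drop_nth i vs)) has_derivative
        (\<lambda>h. \<Sum>i<?n. (-1) ^ i *\<^sub>R dirder (\<lambda>y. cov act \<Gamma> \<omega> c y (vs ! i) (drop_nth i vs)) x h)) (at x)"
      by (intro has_derivative_sum has_derivative_scaleR_right cd)
  qed (simp add: ext)
  have 2: "act ?M (ext_cov act \<Gamma> \<omega> c x vs) = (\<Sum>i<?n. (-1) ^ i *\<^sub>R act ?M (?C (vs ! i) (drop_nth i vs)))"
    by (simp add: ext[OF x] act_sum_right act_scaleR_right)
  have 3: "(\<Sum>l<?n. ext_cov act \<Gamma> \<omega> c x (vs[l := ?M *v (vs ! l)]))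
      = (\<Sum>i<?n. (-1) ^ i *\<^sub>R (?C (?M *v (vs ! i)) (drop_nth i vs)
          + (\<Sum>m<?n - 1. ?C (vs ! i) ((drop_nth i vs)[m := ?M *v (drop_nth i vs ! m)]))))"
  proof -
    have "(\<Sum>l<?n. ext_cov act \<Gamma> \<omega> c x (vs[l := ?M *v (vs ! l)]))
        = (\<Sum>i<?n. \<Sum>l<?n. (-1) ^ i *\<^sub>R ?C (vs[l := ?M *v (vs ! l)] ! i) (drop_nth i (vs[l := ?M *v (vs ! l)])))"
      by (subst sum.swap) (simp add: ext[OF x])
    also have "\<dots> = (\<Sum>i<?n. (-1) ^ i *\<^sub>R (?C (?M *v (vs ! i)) (drop_nth i vs)
          + (\<Sum>m<?n - 1. ?C (vs ! i) ((drop_nth i vs)[m := ?M *v (drop_nth i vs ! m)]))))"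
    proof (rule sum.cong[OF refl])
      fix i assume "i \<in> {..<?n}"
      then have i: "i < ?n" by simp
      have "(\<Sum>l<?n. ?C (vs[l := ?M *v (vs ! l)] ! i) (drop_nth i (vs[l := ?M *v (vs ! l)])))
          = ?C (?M *v (vs ! i)) (drop_nth i vs)
            + (\<Sum>l\<in>{..<?n} - {i}. ?C (vs[l := ?M *v (vs ! l)] ! i) (drop_nth i (vs[l := ?M *v (vs ! l)])))"
        using i by (subst sum.remove[of _ i]) (simp_all add: drop_nth_update_same)
      also have "(\<Sum>l\<in>{..<?n} - {i}. ?C (vs[l := ?M *v (vs ! l)] ! i) (drop_nth i (vs[l := ?M *v (vs ! l)])))
          = (\<Sum>l\<in>{..<?n} - {i}. ?C (vs ! i)
              ((drop_nth i vs)[pos_after i l := ?M *v (drop_nth i vs ! pos_after i l)]))"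
        using i by (intro sum.cong refl) (auto simp: drop_nth_update drop_nth_nth_pos_after)
      also have "\<dots> = (\<Sum>m<?n - 1. ?C (vs ! i) ((drop_nth i vs)[m := ?M *v (drop_nth i vs ! m)]))"
        by (rule sum_pos_after[OF i, symmetric])
      finally show "(\<Sum>l<?n. (-1) ^ i *\<^sub>R ?C (vs[l := ?M *v (vs ! l)] ! i) (drop_nth i (vs[l := ?M *v (vs ! l)])))
          = (-1) ^ i *\<^sub>R (?C (?M *v (vs ! i)) (drop_nth i vs)
              + (\<Sum>m<?n - 1. ?C (vs ! i) ((drop_nth i vs)[m := ?M *v (drop_nth i vs ! m)])))"
        by (simp only: scaleR_sum_right[symmetric])
    qed
    finally show ?thesis .
  qed
  have "cov act \<Gamma> (ext_cov act \<Gamma> \<omega>) c x u vs = dirder (\<lambda>y. ext_cov act \<Gamma> \<omega> c y vs) x u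
      + act ?M (ext_cov act \<Gamma> \<omega> c x vs) - (\<Sum>l<?n. ext_cov act \<Gamma> \<omega> c x (vs[l := ?M *v (vs ! l)]))"
    by (simp add: cov_def)
  also have "\<dots> = (\<Sum>i<?n. (-1) ^ i *\<^sub>R cov2 act \<Gamma> \<omega> c x u (vs ! i) (drop_nth i vs))"
    unfolding 1 2 3 sum.distrib[symmetric] sum_subtractf[symmetric]
    by (intro sum.cong refl) (simp add: cov2_def tact_def algebra_simps)
  finally show ?thesis .
qed

end

section \<open>The codifferential of the skew part\<close>

text \<open>The contribution of \<open>S = \<nabla>\<^sub>u a\<close> to \<open>\<ell> a\<close>. The factor \<open>1/4\<close> is the product of the weight \<open>1/2\<close> of \<open>\<ell>\<close> and the
  \<open>1/2\<close> in the skew part.\<close>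

definition codiff_term :: "real^7^7 \<Rightarrow> real^7 \<Rightarrow> real^7^7 \<Rightarrow> real^7" where
  "codiff_term G u S = - (1/4) *\<^sub>R (transpose S *v (G *v u) - G *v (S *v u))"

lemma mv_scaleR: "(r *\<^sub>R A) *v v = r *\<^sub>R (A *v v)" for A :: "real^'n^'m"
  by (simp add: scaleR_matrix_vector_assoc)

lemmas mat_vec_simps = matrix_vector_right_distrib matrix_vector_mult_add_rdistrib
  matrix_vector_mult_diff_distrib matrix_vector_mult_diff_rdistrib matrix_vector_uminus_left
  matrix_vector_uminus_right matrix_vector_mult_scaleR mv_scaleR

lemma codiff_term_bilinear: "bilinear (codiff_term G)"
  unfolding bilinear_def linear_iff codiff_term_def
  by (simp add: mat_vec_simps transpose_add transpose_scaleR algebra_simps)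

lemma codiff_term_linear: "linear (codiff_term G u)"
  using codiff_term_bilinear by (simp add: bilinear_def)

lemma linear_skew: "linear (\<lambda>X :: real^7^7. (1/2) *\<^sub>R (X - transpose X))"
  by (rule linearI) (simp_all add: transpose_add transpose_scaleR algebra_simps)

lemma sum_matrix_mult_right: "(\<Sum>l\<in>S. A ** f l) = A ** (\<Sum>l\<in>S. f l)" for A :: "real^7^7" and f :: "'b \<Rightarrow> real^7^7"
  by (rule bounded_bilinear.sum_right[OF bounded_bilinear_matrix_mult, symmetric])

context levi_civita_chart
begin

lemma transpose_metric:
  assumes "x \<in> U" shows "transpose (g c x) = g c x"
proof -
  have "g c x $ a $ b = bil (g c x) (axis a 1) (axis b 1)" for a b
    by (simp add: bil_def matrix_vector_mult_basis column_def inner_commute[of "axis a 1"] inner_axis)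
  then show ?thesis using metric_sym[OF assms] by (simp add: vec_eq_iff transpose_def)
qed

lemma dirder_metric:
  assumes "x \<in> U"
  shows "dirder (g c) x u = transpose (\<Gamma> c x u) ** g c x + g c x ** \<Gamma> c x u"
  using metric_parallel[OF assms, of u] by (simp add: act_bil_def algebra_simps)

lemma metric_has_derivative: "x \<in> U \<Longrightarrow> (g c has_derivative dirder (g c) x) (at x)"
  by (rule has_derivative_dirder[OF smooth_on_differentiable[OF smooth_metric open_U]])

lemma skew_part_matrix:
  "skew_part g a c y vs = (1/2) *\<^sub>R (g c y ** a c y vs - transpose (g c y ** a c y vs))"
proof -
  have "bil (g c y) (axis i 1) (a c y vs *v axis j 1) = (g c y ** a c y vs) $ i $ j" for i j
    unfolding bil_def matrix_vector_mul_assoc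
    by (simp add: matrix_vector_mult_basis column_def inner_commute[of "axis i 1"] inner_axis)
  then show ?thesis by (simp add: skew_part_def vec_eq_iff transpose_def)
qed

text \<open>Lowering an index with the parallel metric commutes with covariant differentiation.\<close>

lemma cov_skew_part:
  assumes x: "x \<in> U" and d: "(\<lambda>y. a c y vs) differentiable (at x)"
  shows "cov act_bil \<Gamma> (skew_part g a) c x u vs
    = (1/2) *\<^sub>R (g c x ** cov act_End \<Gamma> a c x u vs - transpose (g c x ** cov act_End \<Gamma> a c x u vs))"
proof -
  define Q :: "real^7^7 \<Rightarrow> real^7^7" where "Q = (\<lambda>X. (1/2) *\<^sub>R (X - transpose X))"
  have Q: "linear Q" unfolding Q_def by (rule linear_skew)
  let ?G = "g c x" and ?S = "a c x vs" and ?M = "\<Gamma> c x u" and ?D = "dirder (\<lambda>y. a c y vs) x u"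
  have sk: "skew_part g a c y ws = Q (g c y ** a c y ws)" for y ws
    by (simp add: Q_def skew_part_matrix)
  have bQ: "bounded_linear Q" using Q by (simp add: linear_conv_bounded_linear)
  have dGS: "((\<lambda>y. g c y ** a c y vs) has_derivative
      (\<lambda>h. ?G ** dirder (\<lambda>y. a c y vs) x h + dirder (g c) x h ** ?S)) (at x)"
    by (rule bounded_bilinear.FDERIV[OF bounded_bilinear_matrix_mult metric_has_derivative[OF x]
          has_derivative_dirder[OF d]])
  have 1: "dirder (\<lambda>y. skew_part g a c y vs) x u = Q (?G ** ?D + dirder (g c) x u ** ?S)"
  proof -
    have "((\<lambda>y. Q (g c y ** a c y vs)) has_derivative
        (\<lambda>h. Q (?G ** dirder (\<lambda>y. a c y vs) x h + dirder (g c) x h ** ?S))) (at x)"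
      by (rule bounded_linear.has_derivative[OF bQ dGS])
    from dirder_eq[OF this] show ?thesis unfolding sk .
  qed
  have 2: "act_bil ?M (Q X) = Q (act_bil ?M X)" for X
    by (simp add: Q_def act_bil_def matrix_diff_ldistrib' matrix_diff_rdistrib' transpose_diff transpose_uminus
        matrix_transpose_mul matrix_scalar_ac scalar_matrix_assoc[symmetric] algebra_simps)
  have "cov act_bil \<Gamma> (skew_part g a) c x u vs
      = Q (?G ** ?D + dirder (g c) x u ** ?S) + Q (act_bil ?M (?G ** ?S))
        - Q (?G ** (\<Sum>l<length vs. a c x (vs[l := ?M *v (vs ! l)])))"
    unfolding cov_def 1 unfolding sk 2 by (simp add: linear_sum[OF Q, symmetric] sum_matrix_mult_right)
  also have "\<dots> = Q (?G ** ?D + dirder (g c) x u ** ?S + act_bil ?M (?G ** ?S)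
        - ?G ** (\<Sum>l<length vs. a c x (vs[l := ?M *v (vs ! l)])))"
    by (simp add: linear_add[OF Q] linear_diff[OF Q])
  also have "?G ** ?D + dirder (g c) x u ** ?S + act_bil ?M (?G ** ?S)
        - ?G ** (\<Sum>l<length vs. a c x (vs[l := ?M *v (vs ! l)])) = ?G ** cov act_End \<Gamma> a c x u vs"
    unfolding dirder_metric[OF x] cov_def act_bil_def act_End_def
    by (simp add: matrix_add_ldistrib matrix_add_rdistrib' matrix_diff_ldistrib' matrix_mul_assoc)
  finally show ?thesis by (simp add: Q_def)
qed

lemma ell_eq:
  assumes x: "x \<in> U" and d: "(\<lambda>y. a c y vs) differentiable (at x)"
  shows "ell g \<Gamma> a c x vs = (\<Sum>j\<in>UNIV. codiff_term (g c x) (e x j) (cov act_End \<Gamma> a c x (e x j) vs))"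
proof (subst vec_eq_iff, rule allI)
  fix i
  let ?G = "g c x"
  have b: "bil X v (axis i 1) = (transpose X *v v) $ i" for X v
    using inner_matrix_transpose[of v "transpose X" "axis i 1"] by (simp add: bil_def inner_axis)
  have "bil (cov act_bil \<Gamma> (skew_part g a) c x (e x j) vs) (e x j) (axis i 1)
      = - 2 * (codiff_term ?G (e x j) (cov act_End \<Gamma> a c x (e x j) vs)) $ i" for j
    unfolding cov_skew_part[where a = a, OF x d] b codiff_term_def
    by (simp add: transpose_scaleR transpose_diff mat_vec_simps matrix_transpose_mul transpose_metric[OF x]
        matrix_vector_mul_assoc[symmetric] field_simps)
  then show "ell g \<Gamma> a c x vs $ i
      = (\<Sum>j\<in>UNIV. codiff_term ?G (e x j) (cov act_End \<Gamma> a c x (e x j) vs)) $ i"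
    by (simp add: ell_def sum_distrib_left)
qed

lemma cov_differentiable:
  assumes "lie_action act" "smooth_field c U \<omega>" "x \<in> U"
  shows "(\<lambda>y. cov act \<Gamma> \<omega> c y u vs) differentiable (at x)"
  using cov_has_derivative[OF assms] by (auto simp: differentiable_def)

lemma ext_cov_differentiable:
  assumes a: "smooth_field c U a" and x: "x \<in> U" and alt: "\<And>y. y \<in> U \<Longrightarrow> a c y \<in> alt_forms p"
    and act: "lie_action act"
  shows "(\<lambda>y. ext_cov act \<Gamma> a c y ws) differentiable (at x)"
proof (rule differentiable_transform_open[OF open_U x])
  show "(\<Sum>i<length ws. (-1) ^ i *\<^sub>R cov act \<Gamma> a c y (ws ! i) (drop_nth i ws)) = ext_cov act \<Gamma> a c y ws"
    if "y \<in> U" for y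
    by (rule ext_cov_alternation[where \<omega> = a, OF that alt[OF that], symmetric])
  show "(\<lambda>y. \<Sum>i<length ws. (-1) ^ i *\<^sub>R cov act \<Gamma> a c y (ws ! i) (drop_nth i ws)) differentiable (at x)"
    by (intro differentiable_sum ballI differentiable_scaleR differentiable_const
        cov_differentiable[OF act a x]) auto
qed

lemma ell_alt:
  assumes x: "x \<in> U" and alt: "\<And>y. y \<in> U \<Longrightarrow> a c y \<in> alt_forms p"
    and d: "\<And>ws. (\<lambda>y. a c y ws) differentiable (at x)"
  shows "ell g \<Gamma> a c x \<in> alt_forms p"
proof -
  have "(\<lambda>vs. \<Sum>j\<in>UNIV. codiff_term (g c x) (e x j) (cov act_End \<Gamma> a c x (e x j) vs)) \<in> alt_forms p"
    by (intro alt_forms_sum alt_forms_compose_linear[OF _ codiff_term_linear]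
        cov_alt[where \<omega> = a, OF lie_action_End x alt d])
  then show ?thesis by (simp add: ell_eq[where a = a, OF x d, symmetric])
qed

text \<open>The codifferential of the skew part is built from parallel tensors and one contraction, so
  it can be differentiated under the sum.\<close>

lemma
  assumes a: "smooth_field c U a" and x: "x \<in> U"
  shows ell_differentiable: "(\<lambda>y. ell g \<Gamma> a c y vs) differentiable (at x)"
    and cov_ell: "cov act_cot \<Gamma> (ell g \<Gamma> a) c x v vs
    = (\<Sum>j\<in>UNIV. codiff_term (g c x) (e x j) (cov2 act_End \<Gamma> a c x v (e x j) vs))"
proof -
  let ?C = "cov act_End \<Gamma> a c" and ?M = "\<Gamma> c x v" and ?G = "g c x"
  have da: "(\<lambda>z. a c z ws) differentiable (at y)" if "y \<in> U" for y ws
    by (rule smooth_field_differentiable[OF a that])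
  have ma: "multilin (a c y)" if "y \<in> U" for y using a that by (simp add: smooth_field_def)
  define B where "B = (\<lambda>y u w. codiff_term (g c y) u (?C y w vs))"
  define B' where "B' = (\<lambda>u w h. - (1/4) *\<^sub>R
     ((transpose (?C x w vs) *v (dirder (g c) x h *v u) + transpose (dirder (\<lambda>y. ?C y w vs) x h) *v (?G *v u))
      - (?G *v (dirder (\<lambda>y. ?C y w vs) x h *v u) + dirder (g c) x h *v (?C x w vs *v u))))"
  have bB: "bilinear (B y)" if "y \<in> U" for y
    using codiff_term_bilinear[of "g c y"] cov_linear_direction[where \<omega> = a, OF lie_action_End that ma[OF that] da[OF that]]
    unfolding B_def bilinear_def by (auto simp: linear_iff)
  have dB: "((\<lambda>y. B y u w) has_derivative B' u w) (at x)" for u w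
  proof -
    have C': "((\<lambda>y. ?C y w vs) has_derivative dirder (\<lambda>y. ?C y w vs) x) (at x)"
      by (rule has_derivative_dirder[OF cov_differentiable[OF lie_action_End a x]])
    have mv: "((\<lambda>y. X y *v z y) has_derivative (\<lambda>h. X x *v z' h + X' h *v z x)) (at x)"
      if "(X has_derivative X') (at x)" "(z has_derivative z') (at x)"
      for X :: "real^7 \<Rightarrow> real^7^7" and X' z z'
      by (rule bounded_bilinear.FDERIV[OF bounded_bilinear_matrix_vector_mult that])
    have mc: "((\<lambda>y. X y *v z) has_derivative (\<lambda>h. X' h *v z)) (at x)"
      if "(X has_derivative X') (at x)" for X :: "real^7 \<Rightarrow> real^7^7" and X' z
      using mv[OF that has_derivative_const[of z]] by simp
    show ?thesis
      unfolding B_def B'_def codiff_term_def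
      by (intro has_derivative_scaleR_right has_derivative_diff mv mc C' metric_has_derivative[OF x]
          bounded_linear.has_derivative[OF bounded_linear_transpose C'])
  qed
  have key: "B' u w v + act_cot ?M (B x u w) - B x (?M *v u) w
      = codiff_term ?G u (dirder (\<lambda>y. ?C y w vs) x v + act_End ?M (?C x w vs))" for u w
    unfolding B_def B'_def codiff_term_def dirder_metric[OF x] act_cot_def act_End_def
    by (simp add: mat_vec_simps transpose_add transpose_diff matrix_transpose_mul
        matrix_vector_mul_assoc[symmetric] algebra_simps)
  have ell: "ell g \<Gamma> a c y ws = (\<Sum>j\<in>UNIV. codiff_term (g c y) (e y j) (?C y (e y j) ws))" if "y \<in> U" for y ws
    by (rule ell_eq[where a = a, OF that da[OF that]])
  have "((\<lambda>y. \<Sum>j\<in>UNIV. B y (e y j) (e y j)) has_derivative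
     (\<lambda>h. \<Sum>j\<in>UNIV. B' (e x j) (e x j) h - B x (\<Gamma> c x h *v e x j) (e x j) - B x (e x j) (\<Gamma> c x h *v e x j))) (at x)"
    by (rule contraction_has_derivative[where B = B and B' = B', OF x bB dB])
  then have dell: "((\<lambda>y. ell g \<Gamma> a c y vs) has_derivative
     (\<lambda>h. \<Sum>j\<in>UNIV. B' (e x j) (e x j) h - B x (\<Gamma> c x h *v e x j) (e x j) - B x (e x j) (\<Gamma> c x h *v e x j))) (at x)"
    by (rule has_derivative_transform_within_open[OF _ open_U x]) (simp add: ell B_def)
  then show "(\<lambda>y. ell g \<Gamma> a c y vs) differentiable (at x)" unfolding differentiable_def by blast
  from dirder_eq[OF dell]
  have 1: "dirder (\<lambda>y. ell g \<Gamma> a c y vs) x v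
     = (\<Sum>j\<in>UNIV. B' (e x j) (e x j) v - B x (?M *v e x j) (e x j) - B x (e x j) (?M *v e x j))" .
  have 2: "act_cot ?M (ell g \<Gamma> a c x vs) = (\<Sum>j\<in>UNIV. act_cot ?M (B x (e x j) (e x j)))"
    by (simp add: ell[OF x] B_def cot.act_sum_right)
  have 3: "(\<Sum>l<length vs. ell g \<Gamma> a c x (vs[l := ?M *v (vs ! l)]))
     = (\<Sum>j\<in>UNIV. codiff_term ?G (e x j) (\<Sum>l<length vs. ?C x (e x j) (vs[l := ?M *v (vs ! l)])))"
    unfolding ell[OF x] by (subst sum.swap) (simp add: linear_sum[OF codiff_term_linear])
  have "cov act_cot \<Gamma> (ell g \<Gamma> a) c x v vs = (\<Sum>j\<in>UNIV.
      (B' (e x j) (e x j) v + act_cot ?M (B x (e x j) (e x j)) - B x (?M *v e x j) (e x j))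
      - B x (e x j) (?M *v e x j)
      - codiff_term ?G (e x j) (\<Sum>l<length vs. ?C x (e x j) (vs[l := ?M *v (vs ! l)])))"
    unfolding cov_def 1 2 3 sum.distrib[symmetric] sum_subtractf[symmetric]
    by (intro sum.cong refl) (simp add: algebra_simps)
  also have "\<dots> = (\<Sum>j\<in>UNIV. codiff_term ?G (e x j) (cov2 act_End \<Gamma> a c x v (e x j) vs))"
    unfolding key
    unfolding B_def cov2_def tact_def
    by (intro sum.cong refl)
      (simp add: linear_diff[OF codiff_term_linear] linear_add[OF codiff_term_linear])
  finally show "cov act_cot \<Gamma> (ell g \<Gamma> a) c x v vs
    = (\<Sum>j\<in>UNIV. codiff_term (g c x) (e x j) (cov2 act_End \<Gamma> a c x v (e x j) vs))" .
qed

text \<open>Both compositions are alternated contractions of \<open>\<nabla>\<^sup>2a\<close>, with the two directions in opposite order, so the Ricci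
  identity applies to their difference.\<close>

lemma ell_ext_cov_commutator:
  assumes a: "smooth_field c U a" and x: "x \<in> U" and alt: "\<And>y. y \<in> U \<Longrightarrow> a c y \<in> alt_forms p"
  shows "ext_cov act_cot \<Gamma> (ell g \<Gamma> a) c x vs - ell g \<Gamma> (ext_cov act_End \<Gamma> a) c x vs
    = (\<Sum>i<length vs. (-1) ^ i *\<^sub>R (\<Sum>j\<in>UNIV. codiff_term (g c x) (e x j)
        (tact act_End (R x (vs ! i) (e x j)) (a c x) (drop_nth i vs))))"
proof -
  have da: "(\<lambda>z. a c z ws) differentiable (at y)" if "y \<in> U" for y ws
    by (rule smooth_field_differentiable[OF a that])
  have ell_alt: "ell g \<Gamma> a c x \<in> alt_forms p" by (rule ell_alt[where a = a, OF x alt da[OF x]])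
  have dext: "(\<lambda>y. ext_cov act_End \<Gamma> a c y ws) differentiable (at x)" for ws
    by (rule ext_cov_differentiable[where a = a, OF a x alt lie_action_End])
  have 1: "ext_cov act_cot \<Gamma> (ell g \<Gamma> a) c x vs = (\<Sum>i<length vs. (-1) ^ i *\<^sub>R
      (\<Sum>j\<in>UNIV. codiff_term (g c x) (e x j) (cov2 act_End \<Gamma> a c x (vs ! i) (e x j) (drop_nth i vs))))"
    unfolding ext_cov_alternation[where \<omega> = "ell g \<Gamma> a", OF x ell_alt] cov_ell[OF a x] ..
  have ce: "cov act_End \<Gamma> (ext_cov act_End \<Gamma> a) c x u vs
      = (\<Sum>i<length vs. (-1) ^ i *\<^sub>R cov2 act_End \<Gamma> a c x u (vs ! i) (drop_nth i vs))" for u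
    by (rule cov_ext_cov[where \<omega> = a, OF lie_action_End a x alt])
  have "ell g \<Gamma> (ext_cov act_End \<Gamma> a) c x vs = (\<Sum>j\<in>UNIV. codiff_term (g c x) (e x j)
      (\<Sum>i<length vs. (-1) ^ i *\<^sub>R cov2 act_End \<Gamma> a c x (e x j) (vs ! i) (drop_nth i vs)))"
    unfolding ell_eq[where a = "ext_cov act_End \<Gamma> a", OF x dext] ce ..
  also have "\<dots> = (\<Sum>i<length vs. \<Sum>j\<in>UNIV. codiff_term (g c x) (e x j)
      ((-1) ^ i *\<^sub>R cov2 act_End \<Gamma> a c x (e x j) (vs ! i) (drop_nth i vs)))"
    by (subst sum.swap) (simp add: linear_sum[OF codiff_term_linear])
  finally have 2: "ell g \<Gamma> (ext_cov act_End \<Gamma> a) c x vs = (\<Sum>i<length vs. (-1) ^ i *\<^sub>R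
      (\<Sum>j\<in>UNIV. codiff_term (g c x) (e x j) (cov2 act_End \<Gamma> a c x (e x j) (vs ! i) (drop_nth i vs))))"
    by (simp add: linear_cmul[OF codiff_term_linear] scaleR_sum_right)
  show ?thesis
    unfolding 1 2 sum_subtractf[symmetric] scaleR_diff_right[symmetric] linear_diff[OF codiff_term_linear, symmetric]
      ricci_identity[OF lie_action_End a x] ..
qed

section \<open>Curvature contractions\<close>

lemma trace_frame:
  assumes x: "x \<in> U"
  shows "trace A = (\<Sum>k\<in>UNIV. bil (g c x) (A *v e x k) (e x k))"
proof -
  let ?H = "\<chi> a b. \<Sum>j\<in>UNIV. e x j $ a * e x j $ b"
  have Hg: "(\<Sum>k\<in>UNIV. e x k $ b * (g c x *v e x k) $ a) = (?H ** g c x) $ b $ a" for a b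
  proof -
    have sy: "g c x $ a $ l = g c x $ l $ a" for l
      using arg_cong[OF transpose_metric[OF x], of "\<lambda>X. X $ l $ a"] by (simp add: transpose_def)
    have "(\<Sum>k\<in>UNIV. e x k $ b * (g c x *v e x k) $ a)
        = (\<Sum>k\<in>UNIV. \<Sum>l\<in>UNIV. e x k $ b * e x k $ l * g c x $ l $ a)"
      by (simp add: matrix_vector_mult_def sum_distrib_left sy mult.assoc mult.commute[of "g c x $ _ $ _"])
    also have "\<dots> = (\<Sum>l\<in>UNIV. \<Sum>k\<in>UNIV. e x k $ b * e x k $ l * g c x $ l $ a)" by (rule sum.swap)
    finally show ?thesis by (simp add: matrix_matrix_mult_def sum_distrib_right)
  qed
  have "(\<Sum>k\<in>UNIV. bil (g c x) (A *v e x k) (e x k))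
      = (\<Sum>k\<in>UNIV. \<Sum>a\<in>UNIV. (\<Sum>b\<in>UNIV. A $ a $ b * e x k $ b) * (g c x *v e x k) $ a)"
    by (simp add: bil_def inner_vec_def matrix_vector_mult_def[of A])
  also have "\<dots> = (\<Sum>k\<in>UNIV. \<Sum>a\<in>UNIV. \<Sum>b\<in>UNIV. A $ a $ b * e x k $ b * (g c x *v e x k) $ a)"
    by (simp add: sum_distrib_right)
  also have "\<dots> = (\<Sum>a\<in>UNIV. \<Sum>b\<in>UNIV. A $ a $ b * (\<Sum>k\<in>UNIV. e x k $ b * (g c x *v e x k) $ a))"
    unfolding sum_distrib_left
    by (subst sum.swap, rule sum.cong[OF refl], subst sum.swap) (simp add: mult.assoc)
  finally show ?thesis
    unfolding Hg frame_inverse_metric[OF onb_e[OF x]]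
    by (simp add: mat_def trace_def if_distrib cong: if_cong)
qed

text \<open>The endomorphism part of the curvature term is the coupling. Two of its four summands are traces of the
  curvature over its own frame index and vanish; the pair symmetry and the first Bianchi identity combine the
  other two.\<close>

lemma codiff_curvature_End:
  assumes x: "x \<in> U" and ric: "\<And>v. (\<Sum>j\<in>UNIV. R x v (e x j) *v e x j) = 0"
  shows "(\<Sum>j\<in>UNIV. codiff_term (g c x) (e x j) (act_End (R x v (e x j)) S)) \<bullet> Z
    = - (1/4) * trace (R x Z v ** S)"
proof -
  let ?b = "bil (g c x)" and ?R = "\<lambda>j. R x v (e x j)"
  define K where "K = (\<lambda>u v w z. ?b (R x u v *v w) z)"
  have sym: "?b u w = ?b w u" for u w by (rule metric_sym[OF x])
  have exp: "w = (\<Sum>k\<in>UNIV. ?b (e x k) w *\<^sub>R e x k)" for w by (rule frame_expand[OF onb_e[OF x]])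
  have lb1: "linear (\<lambda>u. ?b u w)" and lb2: "linear (?b w)" for w
    by (simp_all add: linear_iff bil_linear)
  have ct: "codiff_term (g c x) u T \<bullet> Z = - (1/4) * (?b (T *v Z) u - ?b Z (T *v u))" for u T
  proof -
    have "(transpose T *v (g c x *v u)) \<bullet> Z = ?b (T *v Z) u"
      using inner_matrix_transpose[of Z T "g c x *v u"] by (simp add: bil_def inner_commute)
    moreover have "(g c x *v (T *v u)) \<bullet> Z = ?b Z (T *v u)" by (simp add: bil_def inner_commute)
    ultimately show ?thesis by (simp add: codiff_term_def inner_diff_left)
  qed
  \<comment> \<open>The two traces of the curvature.\<close>
  have T1: "(\<Sum>j\<in>UNIV. ?b (?R j *v (S *v Z)) (e x j)) = 0"
  proof -
    have "(\<Sum>j\<in>UNIV. ?b (?R j *v (S *v Z)) (e x j)) = - ?b (S *v Z) (\<Sum>j\<in>UNIV. ?R j *v e x j)"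
      unfolding curv_skew[OF x] linear_sum[OF lb2] by (simp add: sum_negf)
    then show ?thesis by (simp add: ric bil_linear)
  qed
  have T4: "(\<Sum>j\<in>UNIV. ?b Z (S *v (?R j *v e x j))) = 0"
  proof -
    have "(\<Sum>j\<in>UNIV. ?b Z (S *v (?R j *v e x j))) = ?b Z (S *v (\<Sum>j\<in>UNIV. ?R j *v e x j))"
      by (simp add: linear_sum[OF lb2] linear_sum[OF matrix_vector_mul_linear])
    then show ?thesis by (simp add: ric bil_linear)
  qed
  \<comment> \<open>The two summands that survive, expanded in the frame.\<close>
  have T2: "?b (S *v (?R j *v Z)) (e x j) = (\<Sum>k\<in>UNIV. K v (e x j) Z (e x k) * ?b (S *v e x k) (e x j))" for j
  proof -
    have "?b (S *v (?R j *v Z)) (e x j) = ?b (S *v (\<Sum>k\<in>UNIV. ?b (e x k) (?R j *v Z) *\<^sub>R e x k)) (e x j)"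
      using exp[of "?R j *v Z"] by simp
    then show ?thesis
      by (simp add: linear_sum[OF matrix_vector_mul_linear] linear_sum[OF lb1] matrix_vector_mult_scaleR
          bil_linear K_def sym[of "e x _" "?R j *v Z"])
  qed
  have T3: "?b Z (?R j *v (S *v e x j)) = - (\<Sum>k\<in>UNIV. K v (e x j) Z (e x k) * ?b (S *v e x j) (e x k))" for j
  proof -
    have "?b Z (?R j *v (S *v e x j)) = - ?b (?R j *v Z) (S *v e x j)" using curv_skew[OF x] by simp
    also have "?b (?R j *v Z) (S *v e x j) = ?b (\<Sum>k\<in>UNIV. ?b (e x k) (?R j *v Z) *\<^sub>R e x k) (S *v e x j)"
      using exp[of "?R j *v Z"] by simp
    finally show ?thesis
      by (simp add: linear_sum[OF lb1] bil_linear K_def sym[of "e x _" "?R j *v Z"] sym[of "e x _" "S *v e x j"])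
  qed
  have K: "K v (e x j) Z (e x k) - K v (e x k) Z (e x j) = - K Z v (e x j) (e x k)" for j k
  proof -
    have p: "K v (e x j) Z (e x k) = K Z (e x k) v (e x j)" "K v (e x k) Z (e x j) = K Z (e x j) v (e x k)"
      unfolding K_def by (rule curv_pair_sym[OF x])+
    have q: "K Z (e x j) v (e x k) = - K Z (e x j) (e x k) v"
      unfolding K_def using curv_skew[OF x, of Z "e x j" v "e x k"] sym[of v "R x Z (e x j) *v e x k"] by simp
    have a: "K Z v (e x j) (e x k) = K (e x j) (e x k) Z v" "K Z (e x k) v (e x j) = K v (e x j) Z (e x k)"
      unfolding K_def by (rule curv_pair_sym[OF x])+
    have s1: "K v (e x j) Z (e x k) = - K v (e x j) (e x k) Z"
      unfolding K_def using curv_skew[OF x, of v "e x j" Z "e x k"] sym[of Z "R x v (e x j) *v e x k"] by simp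
    have s2: "K Z v (e x j) (e x k) + K v (e x j) Z (e x k) + K (e x j) Z v (e x k) = 0"
      unfolding K_def bil_linear(1)[symmetric] bianchi[OF x] by (simp add: bil_linear)
    have s3: "K (e x j) Z v (e x k) = - K Z (e x j) v (e x k)"
      unfolding K_def curv_antisym[of x Z "e x j"] by (simp add: matrix_vector_uminus_left bil_linear)
    show ?thesis using s2 s3 p by linarith
  qed
  have tr: "trace (R x Z v ** S) = (\<Sum>k\<in>UNIV. \<Sum>j\<in>UNIV. K Z v (e x j) (e x k) * ?b (S *v e x k) (e x j))"
  proof -
    have "?b ((R x Z v ** S) *v e x k) (e x k) = (\<Sum>j\<in>UNIV. K Z v (e x j) (e x k) * ?b (S *v e x k) (e x j))" for k
    proof -
      have "?b ((R x Z v ** S) *v e x k) (e x k)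
          = ?b (R x Z v *v (\<Sum>j\<in>UNIV. ?b (e x j) (S *v e x k) *\<^sub>R e x j)) (e x k)"
        using exp[of "S *v e x k"] by (simp add: matrix_vector_mul_assoc[symmetric])
      then show ?thesis
        by (simp add: linear_sum[OF matrix_vector_mul_linear] linear_sum[OF lb1] matrix_vector_mult_scaleR
            bil_linear K_def sym[of "e x _" "S *v e x k"] mult.commute)
    qed
    then show ?thesis by (simp add: trace_frame[OF x])
  qed
  have arith: "- (1/4) * (0 - A - - B + 0) = (1/4) * (A - B)" for A B :: real by (simp add: diff_divide_distrib)
  have "(\<Sum>j\<in>UNIV. codiff_term (g c x) (e x j) (act_End (?R j) S)) \<bullet> Z
      = (\<Sum>j\<in>UNIV. - (1/4) * (?b (?R j *v (S *v Z)) (e x j) - ?b (S *v (?R j *v Z)) (e x j)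
          - ?b Z (?R j *v (S *v e x j)) + ?b Z (S *v (?R j *v e x j))))"
    by (simp add: inner_sum_left ct act_End_def mat_vec_simps bil_linear matrix_vector_mul_assoc[symmetric] algebra_simps)
  also have "\<dots> = - (1/4) * ((\<Sum>j\<in>UNIV. ?b (?R j *v (S *v Z)) (e x j)) - (\<Sum>j\<in>UNIV. ?b (S *v (?R j *v Z)) (e x j))
          - (\<Sum>j\<in>UNIV. ?b Z (?R j *v (S *v e x j))) + (\<Sum>j\<in>UNIV. ?b Z (S *v (?R j *v e x j))))"
    by (simp only: sum_distrib_left[symmetric] sum.distrib sum_subtractf)
  also have "\<dots> = (1/4) * ((\<Sum>j\<in>UNIV. \<Sum>k\<in>UNIV. K v (e x j) Z (e x k) * ?b (S *v e x k) (e x j))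
          - (\<Sum>j\<in>UNIV. \<Sum>k\<in>UNIV. K v (e x j) Z (e x k) * ?b (S *v e x j) (e x k)))"
    unfolding T1 T4 T2 T3 sum_negf by (rule arith)
  also have "(\<Sum>j\<in>UNIV. \<Sum>k\<in>UNIV. K v (e x j) Z (e x k) * ?b (S *v e x k) (e x j))
      = (\<Sum>k\<in>UNIV. \<Sum>j\<in>UNIV. K v (e x j) Z (e x k) * ?b (S *v e x k) (e x j))" by (rule sum.swap)
  also have "(1/4) * ((\<Sum>k\<in>UNIV. \<Sum>j\<in>UNIV. K v (e x j) Z (e x k) * ?b (S *v e x k) (e x j))
          - (\<Sum>j\<in>UNIV. \<Sum>k\<in>UNIV. K v (e x j) Z (e x k) * ?b (S *v e x j) (e x k)))
      = (1/4) * (\<Sum>k\<in>UNIV. \<Sum>j\<in>UNIV. (K v (e x j) Z (e x k) - K v (e x k) Z (e x j)) * ?b (S *v e x k) (e x j))"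
    by (simp only: sum_subtractf[symmetric] left_diff_distrib)
  finally show ?thesis unfolding K tr by (simp add: sum_negf)
qed

end

section \<open>The standard G2 form\<close>

lemma exhaust_7:
  fixes x :: 7
  shows "x = 1 \<or> x = 2 \<or> x = 3 \<or> x = 4 \<or> x = 5 \<or> x = 6 \<or> x = 7"
proof (induct x)
  case (of_int z)
  then have "z = 0 \<or> z = 1 \<or> z = 2 \<or> z = 3 \<or> z = 4 \<or> z = 5 \<or> z = 6" by fastforce
  then show ?case by auto
qed

lemma UNIV_7: "UNIV = {1, 2, 3, 4, 5, 6, 7::7}"
  using exhaust_7 by auto

lemma forall_7: "(\<forall>i::7. P i) \<longleftrightarrow> P 1 \<and> P 2 \<and> P 3 \<and> P 4 \<and> P 5 \<and> P 6 \<and> P 7"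
  by (metis exhaust_7)

lemma sum_7: "sum f (UNIV::7 set) = f 1 + f 2 + f 3 + f 4 + f 5 + f 6 + f 7"
  unfolding UNIV_7 by (simp add: ac_simps)

lemma axis_nth: "axis i x $ j = (if j = i then x else 0)"
  by (simp add: axis_def)

lemma e3_expand: "e3 i j k u v w =
    u $ i * (v $ j * w $ k - v $ k * w $ j) - u $ j * (v $ i * w $ k - v $ k * w $ i)
    + u $ k * (v $ i * w $ j - v $ j * w $ i)"
  by (simp add: e3_def det_3 algebra_simps)

lemmas phi0_expand = phi0_def[unfolded e3_expand]

lemma phi0_linear:
  "linear (\<lambda>u. phi0 u v w)" "linear (\<lambda>v. phi0 u v w)" "linear (\<lambda>w. phi0 u v w)"
  by (rule linearI; simp add: phi0_expand algebra_simps)+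

lemma phi0_alt: "phi0 u u w = 0" "phi0 u v v = 0" "phi0 v u w = - phi0 u v w" "phi0 u w v = - phi0 u v w"
  by (simp_all add: phi0_expand algebra_simps)

lemma phi0_axis:
  shows "phi0 x y (axis 1 1) = x$2*y$3 - x$3*y$2 + x$4*y$5 - x$5*y$4 + x$6*y$7 - x$7*y$6"
    "phi0 x y (axis 2 1) = x$3*y$1 - x$1*y$3 + x$4*y$6 - x$6*y$4 - x$5*y$7 + x$7*y$5"
    "phi0 x y (axis 3 1) = x$1*y$2 - x$2*y$1 - x$4*y$7 + x$7*y$4 - x$5*y$6 + x$6*y$5"
    "phi0 x y (axis 4 1) = x$5*y$1 - x$1*y$5 + x$6*y$2 - x$2*y$6 - x$7*y$3 + x$3*y$7"
    "phi0 x y (axis 5 1) = x$1*y$4 - x$4*y$1 + x$2*y$7 - x$7*y$2 - x$6*y$3 + x$3*y$6"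
    "phi0 x y (axis 6 1) = x$7*y$1 - x$1*y$7 + x$2*y$4 - x$4*y$2 - x$3*y$5 + x$5*y$3"
    "phi0 x y (axis 7 1) = x$1*y$6 - x$6*y$1 - x$2*y$5 + x$5*y$2 - x$3*y$4 + x$4*y$3"
  by (simp_all add: phi0_expand axis_nth algebra_simps)

text \<open>The cross product \<open>x \<times> y\<close> defined by \<open>\<phi>\<close> satisfies
  \<open>\<langle>x \<times> y, x \<times> w\<rangle> = |x|\<^sup>2 \<langle>y, w\<rangle> - \<langle>x, y\<rangle> \<langle>x, w\<rangle>\<close>.\<close>

lemma phi0_cross:
  "(\<Sum>m\<in>UNIV. phi0 x y (axis m 1) * phi0 x w (axis m 1)) = (x \<bullet> x) * (y \<bullet> w) - (x \<bullet> y) * (x \<bullet> w)"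
proof -
  show ?thesis
    unfolding sum_7 phi0_axis inner_vec_def inner_real_def by algebra
qed

lemma phi0_cross_polarised:
  "(\<Sum>m\<in>UNIV. phi0 x y (axis m 1) * phi0 z w (axis m 1)) + (\<Sum>m\<in>UNIV. phi0 z y (axis m 1) * phi0 x w (axis m 1))
    = 2 * (x \<bullet> z) * (y \<bullet> w) - (x \<bullet> y) * (z \<bullet> w) - (z \<bullet> y) * (x \<bullet> w)"
proof -
  let ?S = "\<lambda>x z. \<Sum>m\<in>UNIV. phi0 x y (axis m 1) * phi0 z w (axis m 1)"
  have "?S (x + z) (x + z) = ?S x x + ?S z z + (?S x z + ?S z x)"
    by (simp add: linear_add[OF phi0_linear(1)] algebra_simps sum.distrib)
  then have "?S x z + ?S z x = ?S (x + z) (x + z) - ?S x x - ?S z z" by linarith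
  then show ?thesis
    unfolding phi0_cross by (simp add: inner_add_left inner_add_right inner_commute[of z x] algebra_simps)
qed

text \<open>The derivative of \<open>phi0 (exp(tA) x, exp(tA) y, exp(tA) z)\<close> at \<open>t = 0\<close>.\<close>

definition der0 :: "real^7^7 \<Rightarrow> real^7 \<Rightarrow> real^7 \<Rightarrow> real^7 \<Rightarrow> real" where
  "der0 A x y z = phi0 (A *v x) y z + phi0 x (A *v y) z + phi0 x y (A *v z)"

text \<open>For skew \<open>A\<close> this is the contraction of \<open>A\<close>, as a two-form, with \<open>phi0\<close>; it vanishes exactly on the Lie
  algebra of G2.\<close>

definition tor :: "real^7^7 \<Rightarrow> 7 \<Rightarrow> real" where
  "tor A k = (\<Sum>j\<in>UNIV. phi0 (A *v axis j 1) (axis j 1) (axis k 1))"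

lemma skew_entries:
  assumes "transpose A = - A"
  shows "A $ j $ i = - A $ i $ j" "A $ i $ i = (0::real)"
proof -
  have *: "A $ j $ i = - A $ i $ j" for i j
    using arg_cong[OF assms, of "\<lambda>X. X $ i $ j"] by (simp add: transpose_def)
  show "A $ j $ i = - A $ i $ j" by (rule *)
  show "A $ i $ i = 0" using *[of i i] by simp
qed

lemma tor_explicit:
  assumes "transpose A = - A"
  shows "tor A 1 = 2 * (A $ 2 $ 3 + A $ 4 $ 5 + A $ 6 $ 7)"
    "tor A 2 = 2 * (- A $ 1 $ 3 + A $ 4 $ 6 - A $ 5 $ 7)"
    "tor A 3 = 2 * (A $ 1 $ 2 - A $ 4 $ 7 - A $ 5 $ 6)"
    "tor A 4 = 2 * (- A $ 1 $ 5 - A $ 2 $ 6 + A $ 3 $ 7)"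
    "tor A 5 = 2 * (A $ 1 $ 4 + A $ 2 $ 7 + A $ 3 $ 6)"
    "tor A 6 = 2 * (- A $ 1 $ 7 + A $ 2 $ 4 - A $ 3 $ 5)"
    "tor A 7 = 2 * (A $ 1 $ 6 - A $ 2 $ 5 - A $ 3 $ 4)"
proof -
  note sk = skew_entries(1)[OF assms, of 2 1] skew_entries(1)[OF assms, of 3 1] skew_entries(1)[OF assms, of 4 1]
    skew_entries(1)[OF assms, of 5 1] skew_entries(1)[OF assms, of 6 1] skew_entries(1)[OF assms, of 7 1]
    skew_entries(1)[OF assms, of 3 2] skew_entries(1)[OF assms, of 4 2] skew_entries(1)[OF assms, of 5 2]
    skew_entries(1)[OF assms, of 6 2] skew_entries(1)[OF assms, of 7 2] skew_entries(1)[OF assms, of 4 3]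
    skew_entries(1)[OF assms, of 5 3] skew_entries(1)[OF assms, of 6 3] skew_entries(1)[OF assms, of 7 3]
    skew_entries(1)[OF assms, of 5 4] skew_entries(1)[OF assms, of 6 4] skew_entries(1)[OF assms, of 7 4]
    skew_entries(1)[OF assms, of 6 5] skew_entries(1)[OF assms, of 7 5] skew_entries(1)[OF assms, of 7 6]
  show "tor A 1 = 2 * (A $ 2 $ 3 + A $ 4 $ 5 + A $ 6 $ 7)"
    "tor A 2 = 2 * (- A $ 1 $ 3 + A $ 4 $ 6 - A $ 5 $ 7)"
    "tor A 3 = 2 * (A $ 1 $ 2 - A $ 4 $ 7 - A $ 5 $ 6)"
    "tor A 4 = 2 * (- A $ 1 $ 5 - A $ 2 $ 6 + A $ 3 $ 7)"
    "tor A 5 = 2 * (A $ 1 $ 4 + A $ 2 $ 7 + A $ 3 $ 6)"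
    "tor A 6 = 2 * (- A $ 1 $ 7 + A $ 2 $ 4 - A $ 3 $ 5)"
    "tor A 7 = 2 * (A $ 1 $ 6 - A $ 2 $ 5 - A $ 3 $ 4)"
    by (simp_all add: sk tor_def sum_7 phi0_axis axis_nth matrix_vector_mult_basis column_def)
qed

lemma der0_eq: "der0 A x y z = phi0 (A *v x) y z + phi0 x (A *v y) z - phi0 x (A *v z) y"
  by (simp add: der0_def phi0_alt(4)[of x y])

text \<open>On skew \<open>A\<close>, the form \<open>der0 A\<close> is a multiple of the contraction of the vector \<open>tor A\<close> with \<open>*phi0\<close>. The table
  contains its components for the pairs \<open>p < q\<close> of last arguments.\<close>

lemma der0_table:
  assumes "transpose A = - A"
  shows
    "2 * der0 A x (axis 1 1) (axis 2 1) = - x $ 4 * tor A 7 - x $ 5 * tor A 6 + x $ 6 * tor A 5 + x $ 7 * tor A 4"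
    "2 * der0 A x (axis 1 1) (axis 3 1) = - x $ 4 * tor A 6 + x $ 5 * tor A 7 + x $ 6 * tor A 4 - x $ 7 * tor A 5"
    "2 * der0 A x (axis 1 1) (axis 4 1) = x $ 2 * tor A 7 + x $ 3 * tor A 6 - x $ 6 * tor A 3 - x $ 7 * tor A 2"
    "2 * der0 A x (axis 1 1) (axis 5 1) = x $ 2 * tor A 6 - x $ 3 * tor A 7 - x $ 6 * tor A 2 + x $ 7 * tor A 3"
    "2 * der0 A x (axis 1 1) (axis 6 1) = - x $ 2 * tor A 5 - x $ 3 * tor A 4 + x $ 4 * tor A 3 + x $ 5 * tor A 2"
    "2 * der0 A x (axis 1 1) (axis 7 1) = - x $ 2 * tor A 4 + x $ 3 * tor A 5 + x $ 4 * tor A 2 - x $ 5 * tor A 3"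
    "2 * der0 A x (axis 2 1) (axis 3 1) = x $ 4 * tor A 5 - x $ 5 * tor A 4 + x $ 6 * tor A 7 - x $ 7 * tor A 6"
    "2 * der0 A x (axis 2 1) (axis 4 1) = - x $ 1 * tor A 7 - x $ 3 * tor A 5 + x $ 5 * tor A 3 + x $ 7 * tor A 1"
    "2 * der0 A x (axis 2 1) (axis 5 1) = - x $ 1 * tor A 6 + x $ 3 * tor A 4 - x $ 4 * tor A 3 + x $ 6 * tor A 1"
    "2 * der0 A x (axis 2 1) (axis 6 1) = x $ 1 * tor A 5 - x $ 3 * tor A 7 - x $ 5 * tor A 1 + x $ 7 * tor A 3"
    "2 * der0 A x (axis 2 1) (axis 7 1) = x $ 1 * tor A 4 + x $ 3 * tor A 6 - x $ 4 * tor A 1 - x $ 6 * tor A 3"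
    "2 * der0 A x (axis 3 1) (axis 4 1) = - x $ 1 * tor A 6 + x $ 2 * tor A 5 - x $ 5 * tor A 2 + x $ 6 * tor A 1"
    "2 * der0 A x (axis 3 1) (axis 5 1) = x $ 1 * tor A 7 - x $ 2 * tor A 4 + x $ 4 * tor A 2 - x $ 7 * tor A 1"
    "2 * der0 A x (axis 3 1) (axis 6 1) = x $ 1 * tor A 4 + x $ 2 * tor A 7 - x $ 4 * tor A 1 - x $ 7 * tor A 2"
    "2 * der0 A x (axis 3 1) (axis 7 1) = - x $ 1 * tor A 5 - x $ 2 * tor A 6 + x $ 5 * tor A 1 + x $ 6 * tor A 2"
    "2 * der0 A x (axis 4 1) (axis 5 1) = x $ 2 * tor A 3 - x $ 3 * tor A 2 + x $ 6 * tor A 7 - x $ 7 * tor A 6"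
    "2 * der0 A x (axis 4 1) (axis 6 1) = - x $ 1 * tor A 3 + x $ 3 * tor A 1 - x $ 5 * tor A 7 + x $ 7 * tor A 5"
    "2 * der0 A x (axis 4 1) (axis 7 1) = - x $ 1 * tor A 2 + x $ 2 * tor A 1 + x $ 5 * tor A 6 - x $ 6 * tor A 5"
    "2 * der0 A x (axis 5 1) (axis 6 1) = - x $ 1 * tor A 2 + x $ 2 * tor A 1 + x $ 4 * tor A 7 - x $ 7 * tor A 4"
    "2 * der0 A x (axis 5 1) (axis 7 1) = x $ 1 * tor A 3 - x $ 3 * tor A 1 - x $ 4 * tor A 6 + x $ 6 * tor A 4"
    "2 * der0 A x (axis 6 1) (axis 7 1) = x $ 2 * tor A 3 - x $ 3 * tor A 2 + x $ 4 * tor A 5 - x $ 5 * tor A 4"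
proof -
  note sk = skew_entries(2)[OF assms] skew_entries(1)[OF assms, of 2 1] skew_entries(1)[OF assms, of 3 1] skew_entries(1)[OF assms, of 4 1]
    skew_entries(1)[OF assms, of 5 1] skew_entries(1)[OF assms, of 6 1] skew_entries(1)[OF assms, of 7 1]
    skew_entries(1)[OF assms, of 3 2] skew_entries(1)[OF assms, of 4 2] skew_entries(1)[OF assms, of 5 2]
    skew_entries(1)[OF assms, of 6 2] skew_entries(1)[OF assms, of 7 2] skew_entries(1)[OF assms, of 4 3]
    skew_entries(1)[OF assms, of 5 3] skew_entries(1)[OF assms, of 6 3] skew_entries(1)[OF assms, of 7 3]
    skew_entries(1)[OF assms, of 5 4] skew_entries(1)[OF assms, of 6 4] skew_entries(1)[OF assms, of 7 4]
    skew_entries(1)[OF assms, of 6 5] skew_entries(1)[OF assms, of 7 5] skew_entries(1)[OF assms, of 7 6]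
  have Ax: "(A *v v) $ i = A $ i $ 1 * v $ 1 + A $ i $ 2 * v $ 2 + A $ i $ 3 * v $ 3 + A $ i $ 4 * v $ 4
      + A $ i $ 5 * v $ 5 + A $ i $ 6 * v $ 6 + A $ i $ 7 * v $ 7" for v i
    by (simp add: matrix_vector_mult_def sum_7)
  note simps = der0_eq phi0_axis axis_nth Ax tor_explicit[OF assms] sk
  show "2 * der0 A x (axis 1 1) (axis 2 1) = - x $ 4 * tor A 7 - x $ 5 * tor A 6 + x $ 6 * tor A 5 + x $ 7 * tor A 4"
    "2 * der0 A x (axis 1 1) (axis 3 1) = - x $ 4 * tor A 6 + x $ 5 * tor A 7 + x $ 6 * tor A 4 - x $ 7 * tor A 5"
    "2 * der0 A x (axis 1 1) (axis 4 1) = x $ 2 * tor A 7 + x $ 3 * tor A 6 - x $ 6 * tor A 3 - x $ 7 * tor A 2"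
    "2 * der0 A x (axis 1 1) (axis 5 1) = x $ 2 * tor A 6 - x $ 3 * tor A 7 - x $ 6 * tor A 2 + x $ 7 * tor A 3"
    "2 * der0 A x (axis 1 1) (axis 6 1) = - x $ 2 * tor A 5 - x $ 3 * tor A 4 + x $ 4 * tor A 3 + x $ 5 * tor A 2"
    "2 * der0 A x (axis 1 1) (axis 7 1) = - x $ 2 * tor A 4 + x $ 3 * tor A 5 + x $ 4 * tor A 2 - x $ 5 * tor A 3"
    "2 * der0 A x (axis 2 1) (axis 3 1) = x $ 4 * tor A 5 - x $ 5 * tor A 4 + x $ 6 * tor A 7 - x $ 7 * tor A 6"
    "2 * der0 A x (axis 2 1) (axis 4 1) = - x $ 1 * tor A 7 - x $ 3 * tor A 5 + x $ 5 * tor A 3 + x $ 7 * tor A 1"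
    "2 * der0 A x (axis 2 1) (axis 5 1) = - x $ 1 * tor A 6 + x $ 3 * tor A 4 - x $ 4 * tor A 3 + x $ 6 * tor A 1"
    "2 * der0 A x (axis 2 1) (axis 6 1) = x $ 1 * tor A 5 - x $ 3 * tor A 7 - x $ 5 * tor A 1 + x $ 7 * tor A 3"
    "2 * der0 A x (axis 2 1) (axis 7 1) = x $ 1 * tor A 4 + x $ 3 * tor A 6 - x $ 4 * tor A 1 - x $ 6 * tor A 3"
    "2 * der0 A x (axis 3 1) (axis 4 1) = - x $ 1 * tor A 6 + x $ 2 * tor A 5 - x $ 5 * tor A 2 + x $ 6 * tor A 1"
    "2 * der0 A x (axis 3 1) (axis 5 1) = x $ 1 * tor A 7 - x $ 2 * tor A 4 + x $ 4 * tor A 2 - x $ 7 * tor A 1"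
    "2 * der0 A x (axis 3 1) (axis 6 1) = x $ 1 * tor A 4 + x $ 2 * tor A 7 - x $ 4 * tor A 1 - x $ 7 * tor A 2"
    "2 * der0 A x (axis 3 1) (axis 7 1) = - x $ 1 * tor A 5 - x $ 2 * tor A 6 + x $ 5 * tor A 1 + x $ 6 * tor A 2"
    "2 * der0 A x (axis 4 1) (axis 5 1) = x $ 2 * tor A 3 - x $ 3 * tor A 2 + x $ 6 * tor A 7 - x $ 7 * tor A 6"
    "2 * der0 A x (axis 4 1) (axis 6 1) = - x $ 1 * tor A 3 + x $ 3 * tor A 1 - x $ 5 * tor A 7 + x $ 7 * tor A 5"
    "2 * der0 A x (axis 4 1) (axis 7 1) = - x $ 1 * tor A 2 + x $ 2 * tor A 1 + x $ 5 * tor A 6 - x $ 6 * tor A 5"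
    "2 * der0 A x (axis 5 1) (axis 6 1) = - x $ 1 * tor A 2 + x $ 2 * tor A 1 + x $ 4 * tor A 7 - x $ 7 * tor A 4"
    "2 * der0 A x (axis 5 1) (axis 7 1) = x $ 1 * tor A 3 - x $ 3 * tor A 1 - x $ 4 * tor A 6 + x $ 6 * tor A 4"
    "2 * der0 A x (axis 6 1) (axis 7 1) = x $ 2 * tor A 3 - x $ 3 * tor A 2 + x $ 4 * tor A 5 - x $ 5 * tor A 4"
    by (simp_all add: simps algebra_simps)
qed

lemma der0_linear: "linear (\<lambda>y. der0 A x y z)" "linear (\<lambda>z. der0 A x y z)"
  unfolding der0_def linear_iff
  by (simp_all add: linear_add[OF phi0_linear(1)] linear_add[OF phi0_linear(2)] linear_add[OF phi0_linear(3)]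
      linear_cmul[OF phi0_linear(1)] linear_cmul[OF phi0_linear(2)] linear_cmul[OF phi0_linear(3)]
      matrix_vector_right_distrib matrix_vector_mult_scaleR algebra_simps)

lemma der0_antisym: "der0 A x z y = - der0 A x y z" "der0 A x y y = 0"
  unfolding der0_def
  by (simp_all add: phi0_alt(4)[of _ y z] phi0_alt(4)[of _ "A *v y" z] phi0_alt(4)[of _ y "A *v z"]
      phi0_alt(4)[of _ y "A *v y"] phi0_alt(2))

text \<open>For a skew endomorphism the seven numbers \<open>tor A k\<close> are the components of its projection to the
  seven-dimensional complement of the Lie algebra of G2, so they determine how it moves \<open>\<phi>\<close>.\<close>

lemma der0_eq_0_iff:
  assumes A: "transpose A = - A"
  shows "(\<forall>x y z. der0 A x y z = 0) \<longleftrightarrow> (\<forall>k. tor A k = 0)"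
proof
  assume z: "\<forall>x y z. der0 A x y z = 0"
  show "\<forall>k. tor A k = 0"
    unfolding forall_7
    using der0_table(1)[OF A, of "axis 4 1"] der0_table(1)[OF A, of "axis 5 1"] der0_table(1)[OF A, of "axis 6 1"]
      der0_table(1)[OF A, of "axis 7 1"] der0_table(2)[OF A, of "axis 6 1"] der0_table(2)[OF A, of "axis 7 1"]
      der0_table(3)[OF A, of "axis 6 1"] der0_table(3)[OF A, of "axis 7 1"] der0_table(8)[OF A, of "axis 7 1"] z
      der0_table(9)[OF A, of "axis 1 1"] der0_table(9)[OF A, of "axis 3 1"] der0_table(8)[OF A, of "axis 5 1"]
      der0_table(9)[OF A, of "axis 6 1"] der0_table(9)[OF A, of "axis 7 1"]
    by (simp add: axis_nth)
next
  assume t: "\<forall>k. tor A k = 0"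
  have ax: "\<forall>b c. der0 A x (axis b 1) (axis c 1) = 0" for x
  proof -
    have s: "der0 A x z y = 0" if "der0 A x y z = 0" for y z
      using der0_antisym(1)[of A x z y] that by simp
    note tz = der0_table[OF A, of x, unfolded t[rule_format], simplified]
    show ?thesis
      unfolding forall_7 by (simp add: tz tz[THEN s] der0_antisym(2))
  qed
  show "\<forall>x y z. der0 A x y z = 0"
  proof (intro allI)
    fix x y z
    have "bilinear (der0 A x)" using der0_linear by (simp add: bilinear_def)
    from bilinear_axis_expand[OF this] show "der0 A x y z = 0" using ax by simp
  qed
qed

text \<open>The hypotheses are the components of \<open>d\<phi> = 0\<close> and \<open>d*\<phi> = 0\<close>. By \<open>der0_table\<close> they form a linear system for the
  49 numbers \<open>T i j = tor (A i) j\<close>. It splits into eight blocks: the diagonal entries, and for each point \<open>m\<close> of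
  the Fano plane the six entries \<open>T i j\<close> such that \<open>{i, j, m}\<close> is a line. The lines are the triples that occur
  in \<open>phi0\<close>.\<close>

lemma intrinsic_torsion_zero:
  assumes A: "\<And>u. transpose (A u) = - A u"
    and d: "\<And>a b c d. der0 (A a) (axis b 1) (axis c 1) (axis d 1) - der0 (A b) (axis a 1) (axis c 1) (axis d 1)
        + der0 (A c) (axis a 1) (axis b 1) (axis d 1) - der0 (A d) (axis a 1) (axis b 1) (axis c 1) = 0"
    and s: "\<And>p q. (\<Sum>j\<in>UNIV. der0 (A j) (axis j 1) (axis p 1) (axis q 1)) = 0"
  shows "der0 (A u) x y z = 0"
proof -
  define T where "T = (\<lambda>u k. tor (A u) k)"
  note tb = der0_table[OF A]
  have d2: "2 * der0 (A a) (axis b 1) (axis c 1) (axis d 1) - 2 * der0 (A b) (axis a 1) (axis c 1) (axis d 1)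
      + 2 * der0 (A c) (axis a 1) (axis b 1) (axis d 1) - 2 * der0 (A d) (axis a 1) (axis b 1) (axis c 1) = 0"
    for a b c d using d[of a b c d] by linarith
  have s2: "(\<Sum>j\<in>UNIV. 2 * der0 (A j) (axis j 1) (axis p 1) (axis q 1)) = 0" for p q
    by (simp only: sum_distrib_left[symmetric] s mult_zero_right)
  have d1234: "T 1 5 + T 2 6 - T 3 7 = 0" using d2[of 1 2 3 4] by (simp add: tb axis_nth T_def)
  have d1467: "T 1 5 - T 6 2 + T 7 3 = 0" using d2[of 1 4 6 7] by (simp add: tb axis_nth T_def)
  have d2457: "- T 2 6 + T 5 1 - T 7 3 = 0" using d2[of 2 4 5 7] by (simp add: tb axis_nth T_def)
  have d3456: "T 3 7 + T 5 1 + T 6 2 = 0" using d2[of 3 4 5 6] by (simp add: tb axis_nth T_def)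
  have s15: "T 2 6 - T 3 7 - T 6 2 + T 7 3 = 0" using s2[of 1 5] by (simp add: sum_7 tb axis_nth T_def)
  have s26: "T 1 5 - T 3 7 - T 5 1 + T 7 3 = 0" using s2[of 2 6] by (simp add: sum_7 tb axis_nth T_def)
  have s37: "- T 1 5 - T 2 6 + T 5 1 + T 6 2 = 0" using s2[of 3 7] by (simp add: sum_7 tb axis_nth T_def)
  have "T 1 5 = 0" "T 2 6 = 0" "T 3 7 = 0" "T 5 1 = 0" "T 6 2 = 0" "T 7 3 = 0"
    using d1234 d1467 d2457 d3456 s15 s26 s37 by linarith+
  have d1235: "- T 1 4 - T 2 7 - T 3 6 = 0" using d2[of 1 2 3 5] by (simp add: tb axis_nth T_def)
  have d1567: "- T 1 4 + T 6 3 + T 7 2 = 0" using d2[of 1 5 6 7] by (simp add: tb axis_nth T_def)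
  have d2456: "T 2 7 - T 4 1 - T 6 3 = 0" using d2[of 2 4 5 6] by (simp add: tb axis_nth T_def)
  have d3457: "- T 3 6 + T 4 1 + T 7 2 = 0" using d2[of 3 4 5 7] by (simp add: tb axis_nth T_def)
  have s14: "T 2 7 + T 3 6 - T 6 3 - T 7 2 = 0" using s2[of 1 4] by (simp add: sum_7 tb axis_nth T_def)
  have s27: "T 1 4 + T 3 6 - T 4 1 - T 6 3 = 0" using s2[of 2 7] by (simp add: sum_7 tb axis_nth T_def)
  have s36: "T 1 4 + T 2 7 - T 4 1 - T 7 2 = 0" using s2[of 3 6] by (simp add: sum_7 tb axis_nth T_def)
  have "T 1 4 = 0" "T 2 7 = 0" "T 3 6 = 0" "T 4 1 = 0" "T 6 3 = 0" "T 7 2 = 0"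
    using d1235 d1567 d2456 d3457 s14 s27 s36 by linarith+
  have d1236: "T 1 7 - T 2 4 + T 3 5 = 0" using d2[of 1 2 3 6] by (simp add: tb axis_nth T_def)
  have d1456: "T 1 7 + T 4 2 - T 5 3 = 0" using d2[of 1 4 5 6] by (simp add: tb axis_nth T_def)
  have d2567: "- T 2 4 - T 5 3 - T 7 1 = 0" using d2[of 2 5 6 7] by (simp add: tb axis_nth T_def)
  have d3467: "T 3 5 + T 4 2 - T 7 1 = 0" using d2[of 3 4 6 7] by (simp add: tb axis_nth T_def)
  have s17: "- T 2 4 + T 3 5 + T 4 2 - T 5 3 = 0" using s2[of 1 7] by (simp add: sum_7 tb axis_nth T_def)
  have s24: "- T 1 7 - T 3 5 + T 5 3 + T 7 1 = 0" using s2[of 2 4] by (simp add: sum_7 tb axis_nth T_def)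
  have s35: "T 1 7 - T 2 4 + T 4 2 - T 7 1 = 0" using s2[of 3 5] by (simp add: sum_7 tb axis_nth T_def)
  have "T 1 7 = 0" "T 2 4 = 0" "T 3 5 = 0" "T 4 2 = 0" "T 5 3 = 0" "T 7 1 = 0"
    using d1236 d1456 d2567 d3467 s17 s24 s35 by linarith+
  have d1237: "- T 1 6 + T 2 5 + T 3 4 = 0" using d2[of 1 2 3 7] by (simp add: tb axis_nth T_def)
  have d1457: "- T 1 6 - T 4 3 - T 5 2 = 0" using d2[of 1 4 5 7] by (simp add: tb axis_nth T_def)
  have d2467: "T 2 5 - T 4 3 + T 6 1 = 0" using d2[of 2 4 6 7] by (simp add: tb axis_nth T_def)
  have d3567: "- T 3 4 + T 5 2 - T 6 1 = 0" using d2[of 3 5 6 7] by (simp add: tb axis_nth T_def)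
  have s16: "- T 2 5 - T 3 4 + T 4 3 + T 5 2 = 0" using s2[of 1 6] by (simp add: sum_7 tb axis_nth T_def)
  have s25: "- T 1 6 + T 3 4 - T 4 3 + T 6 1 = 0" using s2[of 2 5] by (simp add: sum_7 tb axis_nth T_def)
  have s34: "- T 1 6 + T 2 5 - T 5 2 + T 6 1 = 0" using s2[of 3 4] by (simp add: sum_7 tb axis_nth T_def)
  have "T 1 6 = 0" "T 2 5 = 0" "T 3 4 = 0" "T 4 3 = 0" "T 5 2 = 0" "T 6 1 = 0"
    using d1237 d1457 d2467 d3567 s16 s25 s34 by linarith+
  have d1245: "T 1 3 - T 4 6 + T 5 7 = 0" using d2[of 1 2 4 5] by (simp add: tb axis_nth T_def)
  have d1267: "T 1 3 + T 6 4 - T 7 5 = 0" using d2[of 1 2 6 7] by (simp add: tb axis_nth T_def)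
  have d2347: "- T 3 1 - T 4 6 - T 7 5 = 0" using d2[of 2 3 4 7] by (simp add: tb axis_nth T_def)
  have d2356: "- T 3 1 + T 5 7 + T 6 4 = 0" using d2[of 2 3 5 6] by (simp add: tb axis_nth T_def)
  have s13: "- T 4 6 + T 5 7 + T 6 4 - T 7 5 = 0" using s2[of 1 3] by (simp add: sum_7 tb axis_nth T_def)
  have s46: "- T 1 3 + T 3 1 - T 5 7 + T 7 5 = 0" using s2[of 4 6] by (simp add: sum_7 tb axis_nth T_def)
  have s57: "T 1 3 - T 3 1 - T 4 6 + T 6 4 = 0" using s2[of 5 7] by (simp add: sum_7 tb axis_nth T_def)
  have "T 1 3 = 0" "T 3 1 = 0" "T 4 6 = 0" "T 5 7 = 0" "T 6 4 = 0" "T 7 5 = 0"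
    using d1245 d1267 d2347 d2356 s13 s46 s57 by linarith+
  have d1246: "T 2 3 + T 4 5 + T 6 7 = 0" using d2[of 1 2 4 6] by (simp add: tb axis_nth T_def)
  have d1257: "- T 2 3 + T 5 4 + T 7 6 = 0" using d2[of 1 2 5 7] by (simp add: tb axis_nth T_def)
  have d1347: "T 3 2 - T 4 5 + T 7 6 = 0" using d2[of 1 3 4 7] by (simp add: tb axis_nth T_def)
  have d1356: "T 3 2 + T 5 4 - T 6 7 = 0" using d2[of 1 3 5 6] by (simp add: tb axis_nth T_def)
  have s23: "T 4 5 - T 5 4 + T 6 7 - T 7 6 = 0" using s2[of 2 3] by (simp add: sum_7 tb axis_nth T_def)
  have s45: "T 2 3 - T 3 2 + T 6 7 - T 7 6 = 0" using s2[of 4 5] by (simp add: sum_7 tb axis_nth T_def)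
  have s67: "T 2 3 - T 3 2 + T 4 5 - T 5 4 = 0" using s2[of 6 7] by (simp add: sum_7 tb axis_nth T_def)
  have "T 2 3 = 0" "T 3 2 = 0" "T 4 5 = 0" "T 5 4 = 0" "T 6 7 = 0" "T 7 6 = 0"
    using d1246 d1257 d1347 d1356 s23 s45 s67 by linarith+
  have d1247: "T 1 1 + T 2 2 + T 4 4 + T 7 7 = 0" using d2[of 1 2 4 7] by (simp add: tb axis_nth T_def)
  have d1256: "T 1 1 + T 2 2 + T 5 5 + T 6 6 = 0" using d2[of 1 2 5 6] by (simp add: tb axis_nth T_def)
  have d1346: "T 1 1 + T 3 3 + T 4 4 + T 6 6 = 0" using d2[of 1 3 4 6] by (simp add: tb axis_nth T_def)
  have d1357: "- T 1 1 - T 3 3 - T 5 5 - T 7 7 = 0" using d2[of 1 3 5 7] by (simp add: tb axis_nth T_def)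
  have d2345: "- T 2 2 - T 3 3 - T 4 4 - T 5 5 = 0" using d2[of 2 3 4 5] by (simp add: tb axis_nth T_def)
  have d2367: "- T 2 2 - T 3 3 - T 6 6 - T 7 7 = 0" using d2[of 2 3 6 7] by (simp add: tb axis_nth T_def)
  have d4567: "- T 4 4 - T 5 5 - T 6 6 - T 7 7 = 0" using d2[of 4 5 6 7] by (simp add: tb axis_nth T_def)
  have "T 1 1 = 0" "T 2 2 = 0" "T 3 3 = 0" "T 4 4 = 0" "T 5 5 = 0" "T 6 6 = 0" "T 7 7 = 0"
    using d1247 d1256 d1346 d1357 d2345 d2367 d4567 by linarith+
  have d1345: "- T 1 2 + T 4 7 + T 5 6 = 0" using d2[of 1 3 4 5] by (simp add: tb axis_nth T_def)
  have d1367: "- T 1 2 - T 6 5 - T 7 4 = 0" using d2[of 1 3 6 7] by (simp add: tb axis_nth T_def)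
  have d2346: "T 2 1 + T 4 7 - T 6 5 = 0" using d2[of 2 3 4 6] by (simp add: tb axis_nth T_def)
  have d2357: "- T 2 1 - T 5 6 + T 7 4 = 0" using d2[of 2 3 5 7] by (simp add: tb axis_nth T_def)
  have s12: "- T 4 7 - T 5 6 + T 6 5 + T 7 4 = 0" using s2[of 1 2] by (simp add: sum_7 tb axis_nth T_def)
  have s47: "- T 1 2 + T 2 1 + T 5 6 - T 6 5 = 0" using s2[of 4 7] by (simp add: sum_7 tb axis_nth T_def)
  have s56: "- T 1 2 + T 2 1 + T 4 7 - T 7 4 = 0" using s2[of 5 6] by (simp add: sum_7 tb axis_nth T_def)
  have "T 1 2 = 0" "T 2 1 = 0" "T 4 7 = 0" "T 5 6 = 0" "T 6 5 = 0" "T 7 4 = 0"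
    using d1345 d1367 d2346 d2357 s12 s47 s56 by linarith+
  have "\<forall>u k. T u k = 0"
    unfolding forall_7 by (intro conjI; fact)
  then show ?thesis using der0_eq_0_iff[OF A, of u] by (simp add: T_def)
qed

section \<open>The volume form and the Hodge star\<close>

lemma alt_forms_append:
  assumes T: "T \<in> alt_forms (length us + p)"
  shows "(\<lambda>ws. T (us @ ws)) \<in> alt_forms p"
proof (rule alt_formsI)
  show "T (us @ vs) = 0" if "length vs \<noteq> p" for vs using that by (intro alt_forms_len[OF T]) simp
  show "multilin (\<lambda>ws. T (us @ ws))"
    unfolding multilin_def
  proof (intro allI impI)
    fix vs :: "(real^7) list" and l assume "l < length vs"
    then show "linear (\<lambda>v. T (us @ vs[l := v]))"
      using multilinD[OF alt_forms_multilin[OF T], of "length us + l" "us @ vs"] by (simp add: list_update_append)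
  qed
  show "T (us @ vs) = 0" if "length vs = p" "i < p" "j < p" "i \<noteq> j" "vs ! i = vs ! j" for vs i j
    using that by (intro alt_forms_eq0[OF T, of "length us + i" _ "length us + j"]) (auto simp: nth_append)
qed

lemma alt_forms_map:
  assumes T: "T \<in> alt_forms p" and f: "linear f"
  shows "(\<lambda>ws. T (map f ws)) \<in> alt_forms p"
proof (rule alt_formsI)
  show "T (map f vs) = 0" if "length vs \<noteq> p" for vs using that by (intro alt_forms_len[OF T]) simp
  show "multilin (\<lambda>ws. T (map f ws))"
    unfolding multilin_def
  proof (intro allI impI)
    fix vs :: "(real^7) list" and l assume "l < length vs"
    then have "linear (\<lambda>v. T ((map f vs)[l := v]))" using multilinD[OF alt_forms_multilin[OF T]] by simp
    from linear_compose[OF f this] show "linear (\<lambda>v. T (map f (vs[l := v])))" by (simp add: o_def map_update)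
  qed
  show "T (map f vs) = 0" if "length vs = p" "i < p" "j < p" "i \<noteq> j" "vs ! i = vs ! j" for vs i j
    using that by (intro alt_forms_eq0[OF T, of i _ j]) auto
qed

text \<open>The function \<open>vector\<close> fills the rows \<open>1, \<dots>, 7\<close> in this order, and the row with index \<open>7 = 0\<close> comes last.\<close>

definition pos7 :: "7 \<Rightarrow> nat" where
  "pos7 i = (if i = 1 then 0 else if i = 2 then 1 else if i = 3 then 2 else if i = 4 then 3
     else if i = 5 then 4 else if i = 6 then 5 else 6)"

lemma pos7_simps [simp]: "pos7 1 = 0" "pos7 2 = 1" "pos7 3 = 2" "pos7 4 = 3" "pos7 5 = 4" "pos7 6 = 5" "pos7 7 = 6"
  by (simp_all add: pos7_def)

lemma bij_pos7: "bij_betw pos7 UNIV {..<7}"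
proof -
  have "inj pos7" unfolding inj_def forall_7 by simp
  moreover have "range pos7 = {..<7}" unfolding UNIV_7 by (auto simp: less_Suc_eq numeral_eq_Suc)
  ultimately show ?thesis by (simp add: bij_betw_def)
qed

lemma vector_nth_pos7:
  fixes L :: "'b::zero list"
  assumes "length L = 7" shows "(vector L :: 'b^7) $ i = L ! pos7 i"
proof -
  obtain a b c d e f h where L: "L = [a, b, c, d, e, f, h]"
    using assms by (auto simp: numeral_eq_Suc length_Suc_conv)
  have "\<forall>i. (vector L :: 'b^7) $ i = L ! pos7 i"
    unfolding forall_7 L vector_def by simp
  then show ?thesis by blast
qed

definition vform :: "real tensor_form" where
  "vform vs = (if length vs = 7 then det (vector vs :: real^7^7) else 0)"

lemma vector_update_row:
  fixes L :: "(real^7) list"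
  assumes "length L = 7"
  shows "(vector (L[pos7 k := v]) :: real^7^7) = (\<chi> i. if i = k then v else vector L $ i)"
proof -
  have inj: "inj pos7" using bij_pos7 by (simp add: bij_betw_def)
  have len: "pos7 i < length L" for i using bij_pos7 assms by (auto simp: bij_betw_def)
  have "L[pos7 k := v] ! pos7 i = (if i = k then v else L ! pos7 i)" for i
  proof (cases "i = k")
    case False
    then have "pos7 k \<noteq> pos7 i" using inj by (metis injD)
    then show ?thesis using False by simp
  qed (simp add: len)
  then show ?thesis using assms by (simp add: vec_eq_iff vector_nth_pos7)
qed

lemma pos7_surj: "l < 7 \<Longrightarrow> \<exists>k. l = pos7 k"
  using bij_pos7 by (auto simp: bij_betw_def)

lemma vform_alt: "vform \<in> alt_forms 7"
proof (rule alt_formsI)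
  show "vform vs = 0" if "length vs \<noteq> 7" for vs using that by (simp add: vform_def)
  show "multilin vform"
    unfolding multilin_def
  proof (intro allI impI)
    fix vs :: "(real^7) list" and l assume l: "l < length vs"
    show "linear (\<lambda>v. vform (vs[l := v]))"
    proof (cases "length vs = 7")
      case True
      then obtain k where k: "l = pos7 k" using l pos7_surj by auto
      have "vform (vs[l := v]) = det (\<chi> i. if i = k then v else vector vs $ i)" for v
        using True by (simp add: vform_def k vector_update_row)
      then show ?thesis
        using det_row_add[of k "\<lambda>i. _" "\<lambda>i. _" "\<lambda>i. (vector vs :: real^7^7) $ i"]
          det_row_mul[of k _ "\<lambda>i. _" "\<lambda>i. (vector vs :: real^7^7) $ i"]
        unfolding scalar_mult_eq_scaleR linear_iff by simp
    next
      case False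
      then show ?thesis by (simp add: vform_def linear_iff)
    qed
  qed
  show "vform vs = 0" if h: "length vs = 7" "i < 7" "j < 7" "i \<noteq> j" "vs ! i = vs ! j" for vs i j
  proof -
    obtain k l where kl: "i = pos7 k" "j = pos7 l" using pos7_surj h by meson
    have "k \<noteq> l" using kl h by auto
    moreover have "row k (vector vs :: real^7^7) = row l (vector vs)"
      using h kl by (simp add: row_def vector_nth_pos7)
    ultimately show ?thesis using det_identical_rows by (auto simp: vform_def)
  qed
qed

lemma vform_map:
  "vform (map ((*v) A) L) = det A * vform L"
proof (cases "length L = 7")
  case True
  have "(vector (map ((*v) A) L) :: real^7^7) = vector L ** transpose A"
  proof -
    have "(vector (map ((*v) A) L) :: real^7^7) $ i = A *v (vector L $ i)" for i
    proof -
      have "pos7 i < length L" using bij_pos7 True by (auto simp: bij_betw_def)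
      then show ?thesis using True by (simp add: vector_nth_pos7)
    qed
    then show ?thesis
      by (simp add: vec_eq_iff matrix_matrix_mult_def matrix_vector_mult_def transpose_def mult.commute)
  qed
  then show ?thesis using True by (simp add: vform_def det_mul mult.commute)
qed (simp add: vform_def)

lemma vform_axis_nonzero:
  assumes "distinct K" "length K = 7"
  shows "vform (map (\<lambda>i. axis i 1) K) \<noteq> 0"
proof -
  define \<pi> where "\<pi> = (\<lambda>i. K ! pos7 i)"
  have "inj \<pi>"
  proof (rule injI)
    fix i j assume "\<pi> i = \<pi> j"
    moreover have "pos7 i < length K" "pos7 j < length K"
      using bij_pos7 assms(2) by (auto simp: bij_betw_def)
    ultimately have "pos7 i = pos7 j" by (simp add: \<pi>_def nth_eq_iff_index_eq[OF assms(1)])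
    then show "i = j" using bij_pos7 by (simp add: bij_betw_def inj_eq)
  qed
  then have "\<pi> permutes UNIV"
    by (intro bij_imp_permutes) (simp_all add: bij_betw_def finite_UNIV_inj_surj)
  moreover have "(vector (map (\<lambda>i. axis i 1) K) :: real^7^7) = (\<chi> i. mat 1 $ \<pi> i)"
  proof -
    have "pos7 i < length K" for i using bij_pos7 assms by (auto simp: bij_betw_def)
    then show ?thesis using assms
      by (simp add: vec_eq_iff vector_nth_pos7 \<pi>_def mat_def axis_def eq_commute)
  qed
  ultimately show ?thesis
    using assms det_permute_rows[of \<pi> "mat 1 :: real^7^7"] by (simp add: vform_def sign_def)
qed

text \<open>A skew endomorphism annihilates the volume form. On basis vectors: if they are distinct, only the
  diagonal entries could contribute; if two of them agree, the two terms that do not vanish are opposite.\<close>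

lemma vform_skew:
  assumes B: "transpose B = - B"
  shows "(\<Sum>l<length K. vform ((map (\<lambda>i. axis i 1) K)[l := B *v axis (K ! l) 1])) = 0"
proof (cases "distinct K")
  case True
  have "vform ((map (\<lambda>i. axis i 1) K)[l := B *v axis (K ! l) 1]) = 0" if l: "l < length K" for l
  proof (cases "length K = 7")
    case False
    then show ?thesis by (simp add: vform_def)
  next
    case len: True
    let ?L = "map (\<lambda>i. axis i (1::real)) K :: (real^7) list"
    have lin: "linear (\<lambda>v. vform (?L[l := v]))"
      using multilinD[OF alt_forms_multilin[OF vform_alt]] l by simp
    have "vform (?L[l := axis a 1]) = 0" if "a \<noteq> K ! l" for a
    proof -
      have "set K = UNIV" using True len by (intro card_subset_eq) (simp_all add: distinct_card)
      then obtain m where m: "m < length K" "K ! m = a" by (metis UNIV_I in_set_conv_nth)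
      then show ?thesis
        using l that by (intro alt_forms_eq0[OF vform_alt, of l _ m]) (auto simp: nth_list_update)
    qed
    then have "(\<Sum>a\<in>UNIV. (B $ a $ (K ! l)) *\<^sub>R vform (?L[l := axis a 1])) = 0"
      using skew_entries(2)[OF B] by (intro sum.neutral) (metis scale_zero_left scale_zero_right)
    moreover have "B *v axis (K ! l) 1 = (\<Sum>a\<in>UNIV. (B $ a $ (K ! l)) *\<^sub>R axis a 1)"
      using axis_expand[of "B *v axis (K ! l) 1"] by (simp add: matrix_vector_mult_basis column_def)
    ultimately show ?thesis by (simp add: linear_sum[OF lin] linear_cmul[OF lin])
  qed
  then show ?thesis by (intro sum.neutral) auto
next
  case False
  let ?L = "map (\<lambda>i. axis i (1::real)) K :: (real^7) list"
  obtain i j where ij: "i < length K" "j < length K" "i \<noteq> j" "K ! i = K ! j"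
    using False by (auto simp: distinct_conv_nth)
  have z: "vform (?L[l := B *v axis (K ! l) 1]) = 0" if "l \<noteq> i" "l \<noteq> j" for l
    using ij that by (intro alt_forms_eq0[OF vform_alt, of i _ j]) auto
  have "(\<Sum>l<length K. vform (?L[l := B *v axis (K ! l) 1])) = (\<Sum>l\<in>{i, j}. vform (?L[l := B *v axis (K ! l) 1]))"
    using ij z by (intro sum.mono_neutral_right) auto
  also have "\<dots> = vform (?L[i := B *v axis (K ! i) 1]) + vform (?L[j := B *v axis (K ! j) 1])" using ij by simp
  also have "?L[i := B *v axis (K ! i) 1] = ?L[i := B *v axis (K ! i) 1, j := axis (K ! i) 1]"
    using list_update_id[of "?L[i := B *v axis (K ! i) 1]" j] ij by simp
  also have "?L[j := B *v axis (K ! j) 1] = ?L[i := axis (K ! i) 1, j := B *v axis (K ! i) 1]"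
    using list_update_id[of ?L i] ij by simp
  finally show ?thesis
    using alt_forms_update_swap[OF vform_alt, of i ?L j "B *v axis (K ! i) 1" "axis (K ! i) 1"] ij by simp
qed

lemma contraction_skew:
  fixes F :: "real^7 \<Rightarrow> real^7 \<Rightarrow> real"
  assumes B: "transpose B = - B" and F: "bilinear F"
  shows "(\<Sum>j\<in>UNIV. F (B *v axis j 1) (axis j 1)) = - (\<Sum>j\<in>UNIV. F (axis j 1) (B *v axis j 1))"
proof -
  have l: "linear (\<lambda>u. F u v)" "linear (F u)" for u v using F by (simp_all add: bilinear_def)
  have ex: "B *v axis j 1 = (\<Sum>a\<in>UNIV. (B $ a $ j) *\<^sub>R axis a 1)" for j
    using axis_expand[of "B *v axis j 1"] by (simp add: matrix_vector_mult_basis column_def)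
  have "(\<Sum>j\<in>UNIV. F (B *v axis j 1) (axis j 1)) = (\<Sum>j\<in>UNIV. \<Sum>a\<in>UNIV. B $ a $ j * F (axis a 1) (axis j 1))"
    by (simp add: ex linear_sum[OF l(1)] linear_cmul[OF l(1)])
  also have "\<dots> = (\<Sum>a\<in>UNIV. \<Sum>j\<in>UNIV. B $ a $ j * F (axis a 1) (axis j 1))" by (rule sum.swap)
  also have "\<dots> = (\<Sum>a\<in>UNIV. \<Sum>j\<in>UNIV. - (B $ j $ a * F (axis a 1) (axis j 1)))"
    by (intro sum.cong refl) (metis skew_entries(1)[OF B] minus_mult_left)
  finally show ?thesis by (simp add: ex linear_sum[OF l(2)] linear_cmul[OF l(2)] sum_negf)
qed

text \<open>The form \<open>\<psi> = *\<phi>\<close> of the standard G2 structure.\<close>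

definition psi0 :: "real tensor_form" where
  "psi0 ws = (\<Sum>i\<in>UNIV. \<Sum>j\<in>UNIV. \<Sum>k\<in>UNIV.
     phi0 (axis i 1) (axis j 1) (axis k 1) * vform (axis i 1 # axis j 1 # axis k 1 # ws)) / 6"

lemma psi0_alt: "psi0 \<in> alt_forms 4"
proof -
  let ?v = "\<lambda>i j k ws. vform ([axis i 1, axis j 1, axis k 1] @ ws)"
    and ?p = "\<lambda>i j k. phi0 (axis i 1) (axis j 1) (axis k 1)"
  have "?v i j k \<in> alt_forms 4" for i j k
    by (rule alt_forms_append) (use vform_alt in simp)
  then have "(\<lambda>ws. ?p i j k * ?v i j k ws) \<in> alt_forms 4" for i j k
    by (rule alt_forms_compose_linear) (simp add: linear_iff algebra_simps)
  then have "(\<lambda>ws. \<Sum>i\<in>UNIV. \<Sum>j\<in>UNIV. \<Sum>k\<in>UNIV. ?p i j k * ?v i j k ws) \<in> alt_forms 4"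
    by (intro alt_forms_sum)
  then have "(\<lambda>ws. (\<Sum>i\<in>UNIV. \<Sum>j\<in>UNIV. \<Sum>k\<in>UNIV. ?p i j k * ?v i j k ws) / 6) \<in> alt_forms 4"
    by (rule alt_forms_compose_linear[where f = "\<lambda>r. r / 6"]) (simp add: linear_iff add_divide_distrib)
  then show ?thesis by (simp add: psi0_def[abs_def])
qed

lemma vform_linear3:
  "linear (\<lambda>v. vform (v # a # b # ws))" "linear (\<lambda>v. vform (a # v # b # ws))" "linear (\<lambda>v. vform (a # b # v # ws))"
  using multilinD[OF alt_forms_multilin[OF vform_alt], of 0 "0 # a # b # ws"]
    multilinD[OF alt_forms_multilin[OF vform_alt], of 1 "a # 0 # b # ws"]
    multilinD[OF alt_forms_multilin[OF vform_alt], of 2 "a # b # 0 # ws"]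
  by (simp_all add: numeral_2_eq_2)

text \<open>The Hodge star commutes with skew endomorphisms: these annihilate the volume form, and moving one across a
  contraction changes its sign.\<close>

lemma psi0_der:
  assumes B: "transpose B = - B"
  shows "(\<Sum>l<length K. psi0 ((map (\<lambda>i. axis i 1) K)[l := B *v axis (K ! l) 1]))
    = (\<Sum>i\<in>UNIV. \<Sum>j\<in>UNIV. \<Sum>k\<in>UNIV. der0 B (axis i 1) (axis j 1) (axis k 1)
        * vform (axis i 1 # axis j 1 # axis k 1 # map (\<lambda>i. axis i 1) K)) / 6"
proof -
  let ?a = "\<lambda>i. axis i (1::real) :: real^7" and ?ws = "map (\<lambda>i. axis i (1::real)) K :: (real^7) list"
  let ?p = "\<lambda>i j k. phi0 (?a i) (?a j) (?a k)"
  have v: "(\<Sum>l<length K. vform (?a i # ?a j # ?a k # ?ws[l := B *v ?a (K ! l)]))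
      = - (vform (B *v ?a i # ?a j # ?a k # ?ws) + vform (?a i # B *v ?a j # ?a k # ?ws)
          + vform (?a i # ?a j # B *v ?a k # ?ws))" for i j k
    using vform_skew[OF B, of "i # j # k # K"]
    by (simp add: sum.lessThan_Suc_shift del: sum.lessThan_Suc)
  have c1: "(\<Sum>i\<in>UNIV. ?p i j k * vform (B *v ?a i # ?a j # ?a k # ?ws))
      = - (\<Sum>i\<in>UNIV. phi0 (B *v ?a i) (?a j) (?a k) * vform (?a i # ?a j # ?a k # ?ws))" for j k
  proof -
    have "bilinear (\<lambda>u w. phi0 u (?a j) (?a k) * vform (w # ?a j # ?a k # ?ws))"
      unfolding bilinear_def using phi0_linear(1) vform_linear3(1)
      by (auto simp: linear_iff algebra_simps)
    from contraction_skew[OF B this] show ?thesis by simp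
  qed
  have c2: "(\<Sum>j\<in>UNIV. ?p i j k * vform (?a i # B *v ?a j # ?a k # ?ws))
      = - (\<Sum>j\<in>UNIV. phi0 (?a i) (B *v ?a j) (?a k) * vform (?a i # ?a j # ?a k # ?ws))" for i k
  proof -
    have "bilinear (\<lambda>u w. phi0 (?a i) u (?a k) * vform (?a i # w # ?a k # ?ws))"
      unfolding bilinear_def using phi0_linear(2) vform_linear3(2)
      by (auto simp: linear_iff algebra_simps)
    from contraction_skew[OF B this] show ?thesis by simp
  qed
  have c3: "(\<Sum>k\<in>UNIV. ?p i j k * vform (?a i # ?a j # B *v ?a k # ?ws))
      = - (\<Sum>k\<in>UNIV. phi0 (?a i) (?a j) (B *v ?a k) * vform (?a i # ?a j # ?a k # ?ws))" for i j
  proof -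
    have "bilinear (\<lambda>u w. phi0 (?a i) (?a j) u * vform (?a i # ?a j # w # ?ws))"
      unfolding bilinear_def using phi0_linear(3) vform_linear3(3)
      by (auto simp: linear_iff algebra_simps)
    from contraction_skew[OF B this] show ?thesis by simp
  qed
  have s1: "(\<Sum>i\<in>UNIV. \<Sum>j\<in>UNIV. \<Sum>k\<in>UNIV. f i j k) = (\<Sum>j\<in>UNIV. \<Sum>k\<in>UNIV. \<Sum>i\<in>UNIV. f i j k)"
    for f :: "7 \<Rightarrow> 7 \<Rightarrow> 7 \<Rightarrow> real"
    by (subst sum.swap) (intro sum.cong refl sum.swap)
  have s2: "(\<Sum>i\<in>UNIV. \<Sum>j\<in>UNIV. \<Sum>k\<in>UNIV. f i j k) = (\<Sum>i\<in>UNIV. \<Sum>k\<in>UNIV. \<Sum>j\<in>UNIV. f i j k)"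
    for f :: "7 \<Rightarrow> 7 \<Rightarrow> 7 \<Rightarrow> real"
    by (intro sum.cong refl sum.swap)
  have "(\<Sum>l<length K. psi0 (?ws[l := B *v ?a (K ! l)]))
      = (\<Sum>i\<in>UNIV. \<Sum>j\<in>UNIV. \<Sum>k\<in>UNIV. ?p i j k * (\<Sum>l<length K. vform (?a i # ?a j # ?a k # ?ws[l := B *v ?a (K ! l)]))) / 6"
  proof -
    have "(\<Sum>l<length K. \<Sum>i\<in>UNIV. \<Sum>j\<in>UNIV. \<Sum>k\<in>UNIV. f l i j k)
        = (\<Sum>i\<in>UNIV. \<Sum>j\<in>UNIV. \<Sum>k\<in>UNIV. \<Sum>l<length K. f l i j k)" for f :: "nat \<Rightarrow> 7 \<Rightarrow> 7 \<Rightarrow> 7 \<Rightarrow> real"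
      by (subst sum.swap, intro sum.cong refl, subst sum.swap, intro sum.cong refl, rule sum.swap)
    then show ?thesis by (simp add: psi0_def sum_divide_distrib[symmetric] sum_distrib_left)
  qed
  also have "\<dots> = - ((\<Sum>i\<in>UNIV. \<Sum>j\<in>UNIV. \<Sum>k\<in>UNIV. ?p i j k * vform (B *v ?a i # ?a j # ?a k # ?ws))
      + (\<Sum>i\<in>UNIV. \<Sum>j\<in>UNIV. \<Sum>k\<in>UNIV. ?p i j k * vform (?a i # B *v ?a j # ?a k # ?ws))
      + (\<Sum>i\<in>UNIV. \<Sum>j\<in>UNIV. \<Sum>k\<in>UNIV. ?p i j k * vform (?a i # ?a j # B *v ?a k # ?ws))) / 6"
    unfolding v by (simp add: algebra_simps sum.distrib sum_negf sum_subtractf)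
  also have "(\<Sum>i\<in>UNIV. \<Sum>j\<in>UNIV. \<Sum>k\<in>UNIV. ?p i j k * vform (B *v ?a i # ?a j # ?a k # ?ws))
      = - (\<Sum>i\<in>UNIV. \<Sum>j\<in>UNIV. \<Sum>k\<in>UNIV. phi0 (B *v ?a i) (?a j) (?a k) * vform (?a i # ?a j # ?a k # ?ws))"
    unfolding s1[of "\<lambda>i j k. ?p i j k * vform (B *v ?a i # ?a j # ?a k # ?ws)"]
      s1[of "\<lambda>i j k. phi0 (B *v ?a i) (?a j) (?a k) * vform (?a i # ?a j # ?a k # ?ws)"] c1
    by (simp add: sum_negf)
  also have "(\<Sum>i\<in>UNIV. \<Sum>j\<in>UNIV. \<Sum>k\<in>UNIV. ?p i j k * vform (?a i # B *v ?a j # ?a k # ?ws))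
      = - (\<Sum>i\<in>UNIV. \<Sum>j\<in>UNIV. \<Sum>k\<in>UNIV. phi0 (?a i) (B *v ?a j) (?a k) * vform (?a i # ?a j # ?a k # ?ws))"
    unfolding s2[of "\<lambda>i j k. ?p i j k * vform (?a i # B *v ?a j # ?a k # ?ws)"]
      s2[of "\<lambda>i j k. phi0 (?a i) (B *v ?a j) (?a k) * vform (?a i # ?a j # ?a k # ?ws)"] c2
    by (simp add: sum_negf)
  also have "(\<Sum>i\<in>UNIV. \<Sum>j\<in>UNIV. \<Sum>k\<in>UNIV. ?p i j k * vform (?a i # ?a j # B *v ?a k # ?ws))
      = - (\<Sum>i\<in>UNIV. \<Sum>j\<in>UNIV. \<Sum>k\<in>UNIV. phi0 (?a i) (?a j) (B *v ?a k) * vform (?a i # ?a j # ?a k # ?ws))"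
    unfolding c3 by (simp add: sum_negf)
  finally show ?thesis
    by (simp add: der0_def distrib_right sum.distrib algebra_simps)
qed

text \<open>Only the six permutations of \<open>(p, q, r)\<close> contribute.\<close>

lemma sum_triples_symmetric:
  fixes F :: "'b::finite \<Rightarrow> 'b \<Rightarrow> 'b \<Rightarrow> real"
  assumes pqr: "p \<noteq> q" "p \<noteq> r" "q \<noteq> r"
    and sym: "\<And>a b c. F b a c = F a b c" "\<And>a b c. F a c b = F a b c"
    and diag: "\<And>a b. F a a b = 0"
    and supp: "\<And>a b c. a \<notin> {p, q, r} \<Longrightarrow> F a b c = 0"
  shows "(\<Sum>a\<in>UNIV. \<Sum>b\<in>UNIV. \<Sum>c\<in>UNIV. F a b c) = 6 * F p q r"
proof -
  have sb: "F a b c = 0" if "b \<notin> {p, q, r}" for a b c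
    using supp[OF that] sym(1)[where a = b and b = a and c = c] by (rule trans[rotated])
  have sc: "F a b c = 0" if "c \<notin> {p, q, r}" for a b c
    using sb[OF that] sym(2)[where a = a and b = c and c = b] by (rule trans[rotated])
  have d3: "F a b a = 0" for a b
    using diag sym(2)[where a = a and b = a and c = b] by (rule trans[rotated])
  have d2: "F a b b = 0" for a b
    using d3 sym(1)[where a = b and b = a and c = b] by (rule trans[rotated])
  have "(\<Sum>a\<in>UNIV. \<Sum>b\<in>UNIV. \<Sum>c\<in>UNIV. F a b c) = (\<Sum>a\<in>{p, q, r}. \<Sum>b\<in>UNIV. \<Sum>c\<in>UNIV. F a b c)"
    by (intro sum.mono_neutral_right) (auto simp: supp)
  also have "\<dots> = (\<Sum>a\<in>{p, q, r}. \<Sum>b\<in>{p, q, r}. \<Sum>c\<in>UNIV. F a b c)"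
    by (intro sum.cong refl sum.mono_neutral_right) (auto simp: sb)
  also have "\<dots> = (\<Sum>a\<in>{p, q, r}. \<Sum>b\<in>{p, q, r}. \<Sum>c\<in>{p, q, r}. F a b c)"
    by (intro sum.cong refl sum.mono_neutral_right) (auto simp: sc)
  also have "\<dots> = F p q r + F p r q + F q p r + F q r p + F r p q + F r q p"
    using pqr by (simp add: diag d2 d3)
  also have "\<dots> = 6 * F p q r"
    using sym(2)[where a = p and b = q and c = r] sym(1)[where a = p and b = q and c = r]
      sym(1)[where a = p and b = r and c = q] sym(2)[where a = q and b = p and c = r]
      sym(2)[where a = r and b = p and c = q] by linarith
  finally show ?thesis .
qed

section \<open>Torsion-free G2 structures have a parallel three-form\<close>

lemma der0_swap: "der0 A y x z = - der0 A x y z"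
  unfolding der0_def phi0_alt(3)[of y x z] phi0_alt(3)[of "A *v y" x z] phi0_alt(3)[of y "A *v x" z]
    phi0_alt(3)[of y x "A *v z"] by simp

lemma der0_cyc: "der0 A z x y = der0 A x y z"
  using der0_swap[of A z x y] der0_antisym(1)[of A x z y] by simp

text \<open>Evaluated on a basis list \<open>K\<close> complementary to \<open>p, q\<close>, closedness of \<open>\<psi>\<close> says that the divergence of
  \<open>\<phi>\<close> vanishes on \<open>p, q\<close>: only the summands of the Hodge star with indices \<open>p, q, K ! i\<close> survive, and
  moving \<open>K ! i\<close> back to its place in \<open>K\<close> cancels the sign of the alternation.\<close>

lemma coclosed_divergence:
  assumes B: "\<And>j. transpose (B j) = - B j"
    and cl: "\<And>K. length K = 5 \<Longrightarrow> (\<Sum>i<5. (-1) ^ i * (\<Sum>l<4.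
      psi0 ((map (\<lambda>i. axis i 1) (drop_nth i K))[l := B (K ! i) *v axis (drop_nth i K ! l) 1]))) = 0"
  shows "(\<Sum>j\<in>UNIV. der0 (B j) (axis j 1) (axis p 1) (axis q 1)) = 0"
proof (cases "p = q")
  case True
  then show ?thesis by (simp add: der0_antisym(2))
next
  case pq: False
  let ?a = "\<lambda>i. axis i (1::real) :: real^7"
  obtain K where K: "distinct K" "set K = UNIV - {p, q}"
    using finite_distinct_list[of "UNIV - {p, q}"] by auto
  have lenK: "length K = 5"
    using distinct_card[OF K(1)] K(2) pq by (simp add: card_Diff_subset)
  define W where "W = (\<lambda>ws. vform (?a p # ?a q # ws))"
  have W: "W \<in> alt_forms 5"
    using alt_forms_append[of vform "[?a p, ?a q]" 5] vform_alt by (simp add: W_def)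
  have W0: "W (map ?a K) \<noteq> 0"
    using vform_axis_nonzero[of "p # q # K"] K lenK pq by (simp add: W_def)
  have summand: "(\<Sum>l<4. psi0 ((map ?a (drop_nth i K))[l := B (K ! i) *v ?a (drop_nth i K ! l)]))
      = der0 (B (K ! i)) (?a (K ! i)) (?a p) (?a q) * ((-1) ^ i * W (map ?a K))" if i: "i < 5" for i
  proof -
    let ?r = "K ! i" and ?K = "drop_nth i K"
    define F where "F = (\<lambda>a b d. der0 (B ?r) (?a a) (?a b) (?a d) * vform (?a a # ?a b # ?a d # map ?a ?K))"
    have r: "?r \<in> set K" using i lenK by simp
    have len: "length ?K = 4" using i lenK by simp
    have v1: "vform (?a b # ?a a # ?a d # map ?a ?K) = - vform (?a a # ?a b # ?a d # map ?a ?K)" for a b d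
      using alt_forms_update_swap[OF vform_alt, of 0 "?a a # ?a b # ?a d # map ?a ?K" 1 "?a b" "?a a"] by simp
    have v2: "vform (?a a # ?a d # ?a b # map ?a ?K) = - vform (?a a # ?a b # ?a d # map ?a ?K)" for a b d
      using alt_forms_update_swap[OF vform_alt, of 1 "?a a # ?a b # ?a d # map ?a ?K" 2 "?a d" "?a b"]
      by (simp add: numeral_2_eq_2)
    have sup: "F a b d = 0" if "a \<notin> {p, q, ?r}" for a b d
    proof -
      have "set K \<subseteq> insert ?r (set ?K)"
        using id_take_nth_drop[of i K] i lenK set_append[of "take i K" "K ! i # drop (Suc i) K"]
        by (auto simp: drop_nth_def)
      then have "a \<in> set ?K" using that K(2) by auto
      then obtain m where "m < length ?K" "?K ! m = a" by (auto simp: in_set_conv_nth)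
      then have "vform (?a a # ?a b # ?a d # map ?a ?K) = 0"
        by (intro alt_forms_eq0[OF vform_alt, of 0 _ "Suc (Suc (Suc m))"]) auto
      then show ?thesis by (simp add: F_def)
    qed
    have "(\<Sum>a\<in>UNIV. \<Sum>b\<in>UNIV. \<Sum>d\<in>UNIV. F a b d) = 6 * F p q ?r"
    proof (rule sum_triples_symmetric)
      show "p \<noteq> q" by (rule pq)
      show "p \<noteq> ?r" "q \<noteq> ?r" using r K(2) by auto
      show "F b a d = F a b d" for a b d
        unfolding F_def v1[of b a d] der0_swap[of _ "?a b" "?a a"] by simp
      show "F a d b = F a b d" for a b d
        unfolding F_def v2[of a d b] der0_antisym(1)[of _ _ "?a d" "?a b"] by simp
      show "F a a b = 0" for a b
        using der0_swap[of "B ?r" "?a a" "?a a" "?a b"] by (simp add: F_def)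
    qed (rule sup)
    then have "(\<Sum>l<4. psi0 ((map ?a ?K)[l := B ?r *v ?a (?K ! l)])) = F p q ?r"
      using psi0_der[OF B, of ?K ?r] len unfolding F_def by simp
    also have "F p q ?r = der0 (B ?r) (?a ?r) (?a p) (?a q) * W (?a ?r # map ?a ?K)"
      by (simp add: F_def W_def der0_cyc)
    also have "W (?a ?r # map ?a ?K) = (-1) ^ i * W (map ?a K)"
    proof -
      have "W (map ?a K) = W (map ?a (take i K) @ ?a ?r # map ?a (drop (Suc i) K))"
        using id_take_nth_drop[of i K] i lenK by (metis list.simps(9) map_append)
      also have "\<dots> = (-1) ^ i * W (?a ?r # map ?a ?K)"
        using alt_forms_move[OF W, of "map ?a (take i K)" "?a ?r" "map ?a (drop (Suc i) K)"] i lenK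
        by (simp add: drop_nth_def min_def)
      finally show ?thesis by (simp flip: power_add mult.assoc mult_2)
    qed
    finally show ?thesis .
  qed
  have "0 = (\<Sum>i<5. (-1) ^ i * (der0 (B (K ! i)) (?a (K ! i)) (?a p) (?a q) * ((-1) ^ i * W (map ?a K))))"
    using cl[OF lenK] summand by simp
  also have "\<dots> = (\<Sum>i<5. der0 (B (K ! i)) (?a (K ! i)) (?a p) (?a q)) * W (map ?a K)"
    unfolding sum_distrib_right
  proof (rule sum.cong[OF refl])
    fix i
    have alg: "s * (h * (s * w)) = h * w" if "s * s = 1" for s h w :: real
    proof -
      have "s * (h * (s * w)) = (s * s) * (h * w)" by (simp only: ac_simps)
      then show ?thesis unfolding that by simp
    qed
    show "(-1) ^ i * (der0 (B (K ! i)) (?a (K ! i)) (?a p) (?a q) * ((-1) ^ i * W (map ?a K)))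
      = der0 (B (K ! i)) (?a (K ! i)) (?a p) (?a q) * W (map ?a K)"
      by (rule alg) (simp flip: power_add mult_2)
  qed
  finally have 1: "(\<Sum>i<5. der0 (B (K ! i)) (?a (K ! i)) (?a p) (?a q)) = 0" using W0 by simp
  have 2: "(\<Sum>i<5. h (K ! i)) = (\<Sum>j\<in>set K. h j)" for h :: "7 \<Rightarrow> real"
    using sum_list_sum_nth[of "map h K"] sum_list_distinct_conv_sum_set[OF K(1), of h] lenK
    by (simp add: atLeast0LessThan)
  have 3: "(\<Sum>j\<in>set K. der0 (B j) (?a j) (?a p) (?a q)) = (\<Sum>j\<in>UNIV. der0 (B j) (?a j) (?a p) (?a q))"
  proof (rule sum.mono_neutral_left)
    show "\<forall>j\<in>UNIV - set K. der0 (B j) (?a j) (?a p) (?a q) = 0"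
    proof
      fix j assume "j \<in> UNIV - set K"
      then have "j = p \<or> j = q" using K(2) by auto
      moreover have "der0 (B p) (?a p) (?a p) (?a q) = 0" using der0_swap[of "B p" "?a p" "?a p" "?a q"] by simp
      moreover have "der0 (B q) (?a q) (?a p) (?a q) = 0"
        using der0_swap[of "B q" "?a p" "?a q" "?a q"] der0_antisym(2) by simp
      ultimately show "der0 (B j) (?a j) (?a p) (?a q) = 0" by auto
    qed
  qed auto
  show ?thesis
    unfolding 3[symmetric] 2[of "\<lambda>j. der0 (B j) (?a j) (?a p) (?a q)", symmetric] by (rule 1)
qed

lemma multilin_append: "multilin T \<Longrightarrow> multilin (\<lambda>vs. T (vs @ ws))"
  unfolding multilin_def
proof (intro allI impI)
  fix vs :: "(real^7) list" and l
  assume T: "\<forall>vs l. l < length vs \<longrightarrow> linear (\<lambda>v. T (vs[l := v]))" and l: "l < length vs"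
  then have "linear (\<lambda>v. T ((vs @ ws)[l := v]))" by simp
  then show "linear (\<lambda>v. T (vs[l := v] @ ws))" using l by (simp add: list_update_append)
qed

lemma multilin_append2: "multilin T \<Longrightarrow> multilin (\<lambda>vs. T (ws @ vs))"
proof (induction ws arbitrary: T)
  case (Cons w ws)
  show ?case using Cons.IH[OF multilin_Cons[OF Cons.prems, of w]] by simp
qed simp

text \<open>By induction on the list: the matrix function is differentiated in one slot at a time.\<close>

lemma has_derivative_pullback:
  fixes T :: "real tensor_form" and \<theta> :: "real^7 \<Rightarrow> real^7^7"
  assumes T: "multilin T" and \<theta>: "(\<theta> has_derivative \<theta>') (at x)"
  shows "((\<lambda>y. T (map ((*v) (\<theta> y)) ws)) has_derivative
    (\<lambda>h. \<Sum>l<length ws. T ((map ((*v) (\<theta> x)) ws)[l := \<theta>' h *v (ws ! l)]))) (at x)"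
  using T
proof (induction ws arbitrary: T)
  case Nil
  then show ?case by simp
next
  case (Cons w ws)
  define S where "S = (\<lambda>y vs. T (vs @ map ((*v) (\<theta> y)) ws))"
  have mS: "multilin (S y)" for y unfolding S_def by (rule multilin_append[OF Cons.prems])
  have dS: "((\<lambda>y. S y vs) has_derivative
      (\<lambda>h. \<Sum>l<length ws. T (vs @ (map ((*v) (\<theta> x)) ws)[l := \<theta>' h *v (ws ! l)]))) (at x)" for vs
    unfolding S_def
    by (rule Cons.IH[of "\<lambda>ws. T (vs @ ws)"]) (rule multilin_append2[OF Cons.prems])
  have z: "((\<lambda>y. \<theta> y *v w) has_derivative (\<lambda>h. \<theta>' h *v w)) (at x)"
    by (rule bounded_linear.has_derivative[OF bounded_bilinear.bounded_linear_left
          [OF bounded_bilinear_matrix_vector_mult] \<theta>])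
  have "((\<lambda>y. S y ([0][0 := \<theta> y *v w])) has_derivative
      (\<lambda>h. dirder (\<lambda>y. S y ([0][0 := \<theta> x *v w])) x h + S x ([0][0 := \<theta>' h *v w]))) (at x)"
    by (rule has_derivative_slot[of UNIV x S, OF _ _ mS _ z])
       (use dS in \<open>auto simp: differentiable_def\<close>)
  then show ?case
    unfolding dirder_eq[OF dS]
    by (simp add: S_def sum.lessThan_Suc_shift add.commute del: sum.lessThan_Suc)
qed

definition phi0_form :: "real tensor_form" where
  "phi0_form L = (if length L = 3 then phi0 (L ! 0) (L ! 1) (L ! 2) else 0)"

lemma phi0_form_alt: "phi0_form \<in> alt_forms 3"
proof (rule alt_formsI)
  show "multilin phi0_form"
    unfolding multilin_def
  proof (intro allI impI)
    fix vs :: "(real^7) list" and l assume l: "l < length vs"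
    show "linear (\<lambda>v. phi0_form (vs[l := v]))"
    proof (cases "length vs = 3")
      case True
      then have "l = 0 \<or> l = 1 \<or> l = 2" using l by auto
      then show ?thesis using True phi0_linear by (auto simp: phi0_form_def nth_list_update)
    next
      case False
      then show ?thesis by (simp add: phi0_form_def linear_iff)
    qed
  qed
  show "phi0_form vs = 0" if "length vs = 3" "i < 3" "j < 3" "i \<noteq> j" "vs ! i = vs ! j" for vs i j
  proof -
    have c: "phi0 u v u = 0" for u v using phi0_alt(4)[of u v u] phi0_alt(1) by simp
    have "i \<in> {0, 1, 2}" "j \<in> {0, 1, 2}" using that by auto
    then show ?thesis using that by (auto simp: phi0_form_def phi0_alt(1,2) c)
  qed
qed (simp add: phi0_form_def)

lemma metric_eq_coframe:
  fixes G \<theta> :: "real^7^7"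
  assumes "\<And>u v. bil G u v = (\<theta> *v u) \<bullet> (\<theta> *v v)"
  shows "G = transpose \<theta> ** \<theta>"
proof -
  have b: "bil X (axis i 1) (axis j 1) = X $ i $ j" for X :: "real^7^7" and i j
    by (simp add: bil_def matrix_vector_mult_basis column_def inner_commute[of "axis i 1"] inner_axis)
  have "(\<theta> *v u) \<bullet> (\<theta> *v v) = bil (transpose \<theta> ** \<theta>) u v" for u v
    by (simp add: bil_def matrix_vector_mul_assoc[symmetric] inner_matrix_transpose)
  then have "G $ i $ j = (transpose \<theta> ** \<theta>) $ i $ j" for i j
    using assms[of "axis i 1" "axis j 1"] by (simp add: b)
  then show ?thesis by (simp add: vec_eq_iff)
qed

lemma coframe_onb:
  assumes G: "\<And>u v. bil G u v = (\<theta> *v u) \<bullet> (\<theta> *v v)" and inv: "invertible \<theta>"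
  shows "onb G (\<lambda>i. matrix_inv \<theta> *v axis i 1)"
  unfolding onb_def G matrix_vector_mul_assoc matrix_inv_both(1)[OF inv]
  by (simp add: inner_axis_axis)

text \<open>The coframe pulls back the determinant to the volume form, since \<open>det g = (det \<theta>)\<^sup>2\<close> and the orientation
  fixes the sign of \<open>det \<theta>\<close>.\<close>

lemma hodge_coframe:
  assumes G: "\<And>u v. bil G u v = (\<theta> *v u) \<bullet> (\<theta> *v v)" and s: "s \<in> {1, -1}" "s * det \<theta> > 0"
    and \<alpha>: "\<alpha> \<in> alt_forms 3" "\<And>u v w. \<alpha> [u, v, w] = phi0 (\<theta> *v u) (\<theta> *v v) (\<theta> *v w)"
  shows "hodge G s 3 \<alpha> ws = psi0 (map ((*v) \<theta>) ws)"
proof -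
  have inv: "invertible \<theta>" using s by (auto simp: invertible_det_nz)
  define \<epsilon> where "\<epsilon> = (\<lambda>i. matrix_inv \<theta> *v axis i (1::real))"
  have \<epsilon>: "onb G \<epsilon>" unfolding \<epsilon>_def by (rule coframe_onb[OF G inv])
  have \<theta>\<epsilon>: "\<theta> *v \<epsilon> i = axis i 1" for i
    by (simp add: \<epsilon>_def matrix_vector_mul_assoc matrix_inv_both(1)[OF inv])
  have e: "onb G (onframe G)"
  proof -
    have "\<exists>e :: 7 \<Rightarrow> real^7. \<forall>i j. bil G (e i) (e j) = (if i = j then 1 else 0)"
      using \<epsilon> unfolding onb_def by blast
    from someI_ex[OF this] show ?thesis unfolding onb_def onframe_def .
  qed
  have vol: "vol G s L = vform (map ((*v) \<theta>) L)" for L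
  proof -
    have "det G = (det \<theta>)\<^sup>2" by (simp add: metric_eq_coframe[OF G] det_mul power2_eq_square)
    then have "s * sqrt (det G) = det \<theta>" using s by (auto simp: abs_if)
    then show ?thesis by (simp add: vol_def vform_map) (simp add: vform_def)
  qed
  define F where "F = (\<lambda>us vs. \<alpha> us * vol G s (vs @ ws))"
  have F: "bimultilin F"
  proof -
    have "multilin (\<lambda>vs. vol G s (vs @ ws))"
      unfolding vol
      by (rule multilin_append[of "\<lambda>L. vform (map ((*v) \<theta>) L)"])
         (rule alt_forms_multilin[OF alt_forms_map[OF vform_alt matrix_vector_mul_linear]])
    then show ?thesis
      using alt_forms_multilin[OF \<alpha>(1)] unfolding bimultilin_def multilin_def F_def
      by (auto simp: linear_iff algebra_simps)
  qed
  have "hodge G s 3 \<alpha> ws = (\<Sum>I | length I = 3. F (map (onframe G) I) (map (onframe G) I)) / fact 3"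
    by (simp add: hodge_def F_def)
  also have "\<dots> = (\<Sum>I | length I = Suc (Suc (Suc 0)). F (map \<epsilon> I) (map \<epsilon> I)) / 6"
    using list_contraction_frame_indep[OF e \<epsilon> F, of 3] by (simp add: numeral_3_eq_3 fact_numeral)
  finally show ?thesis
    unfolding sum_lists_Suc by (simp add: F_def \<alpha>(2) vol \<theta>\<epsilon> psi0_def)
qed

context levi_civita_chart
begin

text \<open>In the coframe \<open>\<theta>\<close> the field has constant coefficients, so only the matrix \<open>D\<theta> - \<theta> \<Gamma>\<close> of the connection in this
  coframe contributes.\<close>

lemma cov_pullback:
  fixes T :: "('a, real) field"
  assumes N: "open N" "x \<in> N" and \<theta>: "(\<theta> has_derivative \<theta>') (at x)" and T0: "multilin T0"
    and T: "\<And>y vs. y \<in> N \<Longrightarrow> T c y vs = T0 (map ((*v) (\<theta> y)) vs)"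
  shows "cov act_triv \<Gamma> T c x u vs
    = (\<Sum>l<length vs. T0 ((map ((*v) (\<theta> x)) vs)[l := (\<theta>' u - \<theta> x ** \<Gamma> c x u) *v (vs ! l)]))"
proof -
  have "((\<lambda>y. T c y vs) has_derivative
      (\<lambda>h. \<Sum>l<length vs. T0 ((map ((*v) (\<theta> x)) vs)[l := \<theta>' h *v (vs ! l)]))) (at x)"
    by (rule has_derivative_transform_within_open[OF has_derivative_pullback[OF T0 \<theta>] N]) (simp add: T)
  from dirder_eq[OF this, of u]
  have "cov act_triv \<Gamma> T c x u vs = (\<Sum>l<length vs. T0 ((map ((*v) (\<theta> x)) vs)[l := \<theta>' u *v (vs ! l)]))
      - (\<Sum>l<length vs. T0 ((map ((*v) (\<theta> x)) vs)[l := \<theta> x *v (\<Gamma> c x u *v (vs ! l))]))"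
    by (simp add: cov_def act_triv_def T[OF N(2)] map_update)
  then show ?thesis
    unfolding sum_subtractf[symmetric] mat_vec_simps matrix_vector_mul_assoc
    by (simp add: linear_diff[OF multilinD[OF T0]])
qed

text \<open>The theorem of Fernandez and Gray. In an adapted coframe the covariant derivative of \<open>\<phi>\<close> in direction
  \<open>u\<close> is the action of a skew matrix on the standard three-form, and the same matrix acts on the standard
  four-form to give the covariant derivative of \<open>*\<phi>\<close>. So \<open>d\<phi> = 0\<close> and \<open>d*\<phi> = 0\<close> constrain the same matrices.\<close>

lemma torsion_free_parallel:
  fixes \<phi> :: "('a, real) field"
  assumes N: "open N" "x \<in> N" "N \<subseteq> U" and \<theta>: "(\<theta> has_derivative \<theta>') (at x)"
    and \<phi>alt: "\<And>y. y \<in> U \<Longrightarrow> \<phi> c y \<in> alt_forms 3" and d\<phi>: "\<And>ws. (\<lambda>y. \<phi> c y ws) differentiable (at x)"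
    and s: "\<And>y. y \<in> N \<Longrightarrow> s c y \<in> {1, -1}" "\<And>y. y \<in> N \<Longrightarrow> s c y * det (\<theta> y) > 0"
    and G: "\<And>y u v. y \<in> N \<Longrightarrow> bil (g c y) u v = (\<theta> y *v u) \<bullet> (\<theta> y *v v)"
    and \<phi>0: "\<And>y u v w. y \<in> N \<Longrightarrow> \<phi> c y [u, v, w] = phi0 (\<theta> y *v u) (\<theta> y *v v) (\<theta> y *v w)"
    and closed: "\<And>vs. ext_d \<phi> c x vs = 0"
    and coclosed: "\<And>vs. ext_d (\<lambda>c x. hodge (g c x) (s c x) 3 (\<phi> c x)) c x vs = 0"
  shows "cov act_triv \<Gamma> \<phi> c x u vs = 0"
proof -
  have x: "x \<in> U" using N by auto
  have inv: "invertible (\<theta> x)" using s(2)[OF N(2)] by (auto simp: invertible_det_nz)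
  define \<epsilon> where "\<epsilon> = (\<lambda>i. matrix_inv (\<theta> x) *v axis i (1::real))"
  have onb\<epsilon>: "onb (g c x) \<epsilon>" unfolding \<epsilon>_def by (rule coframe_onb[OF G[OF N(2)] inv])
  have \<theta>\<epsilon>: "\<theta> x *v \<epsilon> i = axis i 1" for i
    by (simp add: \<epsilon>_def matrix_vector_mul_assoc matrix_inv_both(1)[OF inv])
  \<comment> \<open>The connection matrices of the coframe, and their conjugates \<open>B\<close> acting on its coordinates. They are skew
    because the coframe is orthonormal.\<close>
  define D where "D = (\<lambda>u. \<theta>' u - \<theta> x ** \<Gamma> c x u)"
  define B where "B = (\<lambda>j. D (\<epsilon> j) ** matrix_inv (\<theta> x))"
  have BD: "D (\<epsilon> j) *v v = B j *v (\<theta> x *v v)" for j v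
    by (simp add: B_def matrix_vector_mul_assoc matrix_mul_assoc[symmetric] matrix_inv_both(2)[OF inv])
  have skew: "transpose (B j) = - B j" for j
  proof -
    let ?t = "\<theta> x" and ?i = "matrix_inv (\<theta> x)" and ?D = "D (\<epsilon> j)"
    have "((\<lambda>y. transpose (\<theta> y) ** \<theta> y) has_derivative
        (\<lambda>h. transpose ?t ** \<theta>' h + transpose (\<theta>' h) ** ?t)) (at x)"
      by (rule bounded_bilinear.FDERIV[OF bounded_bilinear_matrix_mult
            bounded_linear.has_derivative[OF bounded_linear_transpose \<theta>] \<theta>])
    then have "(g c has_derivative (\<lambda>h. transpose ?t ** \<theta>' h + transpose (\<theta>' h) ** ?t)) (at x)"
      by (rule has_derivative_transform_within_open[OF _ N(1,2)]) (simp add: metric_eq_coframe[OF G])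
    then have "transpose ?t ** \<theta>' (\<epsilon> j) + transpose (\<theta>' (\<epsilon> j)) ** ?t
        = transpose (\<Gamma> c x (\<epsilon> j)) ** (transpose ?t ** ?t) + (transpose ?t ** ?t) ** \<Gamma> c x (\<epsilon> j)"
      using dirder_eq dirder_metric[OF x, of "\<epsilon> j"] by (metis (no_types, lifting) metric_eq_coframe[OF G[OF N(2)]])
    then have z: "transpose ?D ** ?t + transpose ?t ** ?D = 0"
      unfolding D_def
      by (simp add: transpose_diff matrix_transpose_mul matrix_diff_ldistrib' matrix_diff_rdistrib'
          matrix_mul_assoc algebra_simps)
    have ti: "transpose ?i ** transpose ?t = mat 1"
      by (simp add: matrix_transpose_mul[symmetric] matrix_inv_both(1)[OF inv])
    have "transpose ?i ** (transpose ?D ** ?t + transpose ?t ** ?D) ** ?i = transpose (B j) + B j"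
      by (simp add: matrix_add_ldistrib matrix_add_rdistrib' B_def matrix_transpose_mul matrix_mul_assoc ti)
         (simp add: matrix_mul_assoc[symmetric] matrix_inv_both(1)[OF inv])
    then show ?thesis unfolding z by (simp add: eq_neg_iff_add_eq_0)
  qed
  have \<phi>form: "\<phi> c y vs = phi0_form (map ((*v) (\<theta> y)) vs)" if y: "y \<in> N" for y vs
  proof (cases "length vs = 3")
    case True
    then obtain a b d where "vs = [a, b, d]" by (auto simp: numeral_3_eq_3 length_Suc_conv)
    then show ?thesis by (simp add: phi0_form_def \<phi>0[OF y] numeral_2_eq_2)
  next
    case False
    then show ?thesis using alt_forms_len[OF \<phi>alt] y N(3) by (auto simp: phi0_form_def)
  qed
  have cp\<phi>: "cov act_triv \<Gamma> \<phi> c x u vs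
      = (\<Sum>l<length vs. phi0_form ((map ((*v) (\<theta> x)) vs)[l := D u *v (vs ! l)]))" for u vs
    unfolding D_def
    by (rule cov_pullback[where T = \<phi>, OF N(1,2) \<theta> alt_forms_multilin[OF phi0_form_alt]]) (rule \<phi>form)
  have cov\<phi>: "cov act_triv \<Gamma> \<phi> c x (\<epsilon> j) [v1, v2, v3] = der0 (B j) (\<theta> x *v v1) (\<theta> x *v v2) (\<theta> x *v v3)" for j v1 v2 v3
    unfolding cp\<phi>
    by (simp add: BD phi0_form_def der0_def numeral_3_eq_3 numeral_2_eq_2)
  have exd: "ext_d \<omega> c x vs = (\<Sum>i<length vs. (-1) ^ i *\<^sub>R cov act_triv \<Gamma> \<omega> c x (vs ! i) (drop_nth i vs))"
    if "\<omega> c x \<in> alt_forms p" for \<omega> :: "('a, real) field" and vs p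
    using ext_cov_alternation[where \<omega> = \<omega> and act = act_triv, OF x that]
    by (simp add: ext_d_def ext_cov_def act_triv_def)
  \<comment> \<open>Closedness, evaluated on four vectors of the frame dual to the coframe.\<close>
  have dd: "der0 (B a) (axis b 1) (axis k 1) (axis d 1) - der0 (B b) (axis a 1) (axis k 1) (axis d 1)
      + der0 (B k) (axis a 1) (axis b 1) (axis d 1) - der0 (B d) (axis a 1) (axis b 1) (axis k 1) = 0" for a b k d
    using closed[of "[\<epsilon> a, \<epsilon> b, \<epsilon> k, \<epsilon> d]"] unfolding exd[where \<omega> = \<phi>, OF \<phi>alt[OF x]]
    by (simp add: drop_nth_def cov\<phi> \<theta>\<epsilon> numeral_3_eq_3)
  define \<psi> :: "('a, real) field" where "\<psi> = (\<lambda>c x. hodge (g c x) (s c x) 3 (\<phi> c x))"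
  have \<psi>form: "\<psi> c y vs = psi0 (map ((*v) (\<theta> y)) vs)" if y: "y \<in> N" for y vs
    unfolding \<psi>_def using y N(3) by (intro hodge_coframe G s \<phi>alt \<phi>0) auto
  have \<psi>alt: "\<psi> c x \<in> alt_forms 4"
    using alt_forms_map[OF psi0_alt matrix_vector_mul_linear[of "\<theta> x"]] by (simp add: \<psi>form[OF N(2), symmetric])
  have cp\<psi>: "cov act_triv \<Gamma> \<psi> c x u vs
      = (\<Sum>l<length vs. psi0 ((map ((*v) (\<theta> x)) vs)[l := D u *v (vs ! l)]))" for u vs
    unfolding D_def
    by (rule cov_pullback[where T = \<psi>, OF N(1,2) \<theta> alt_forms_multilin[OF psi0_alt]]) (rule \<psi>form)
  have div: "(\<Sum>j\<in>UNIV. der0 (B j) (axis j 1) (axis p 1) (axis q 1)) = 0" for p q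
  proof (rule coclosed_divergence[OF skew])
    fix K :: "7 list" assume K: "length K = 5"
    have dn: "drop_nth i (map \<epsilon> K) = map \<epsilon> (drop_nth i K)" for i by (simp add: drop_nth_def take_map drop_map)
    have "cov act_triv \<Gamma> \<psi> c x (\<epsilon> (K ! i)) (map \<epsilon> (drop_nth i K))
        = (\<Sum>l<4. psi0 ((map (\<lambda>i. axis i 1) (drop_nth i K))[l := B (K ! i) *v axis (drop_nth i K ! l) 1]))"
      if "i < 5" for i
      unfolding cp\<psi>
      using that K by (simp add: BD o_def \<theta>\<epsilon>)
    then show "(\<Sum>i<5. (-1) ^ i * (\<Sum>l<4.
      psi0 ((map (\<lambda>i. axis i 1) (drop_nth i K))[l := B (K ! i) *v axis (drop_nth i K ! l) 1]))) = 0"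
      using coclosed[of "map \<epsilon> K"] K unfolding \<psi>_def[symmetric] exd[where \<omega> = \<psi>, OF \<psi>alt] by (simp add: dn)
  qed
  have z: "cov act_triv \<Gamma> \<phi> c x (\<epsilon> j) vs = 0" for j vs
  proof (cases "length vs = 3")
    case True
    then obtain a b d where "vs = [a, b, d]" by (auto simp: numeral_3_eq_3 length_Suc_conv)
    then show ?thesis by (simp add: cov\<phi> intrinsic_torsion_zero[OF skew dd div])
  next
    case False
    then show ?thesis
      using alt_forms_len[OF cov_alt[where \<omega> = \<phi>, OF lie_action_triv x \<phi>alt d\<phi>]] by simp
  qed
  have l: "linear (\<lambda>u. cov act_triv \<Gamma> \<phi> c x u vs)"
    by (rule cov_linear_direction[where \<omega> = \<phi>, OF lie_action_triv x alt_forms_multilin[OF \<phi>alt[OF x]] d\<phi>])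
  have "u = (\<Sum>j\<in>UNIV. bil (g c x) (\<epsilon> j) u *\<^sub>R \<epsilon> j)" by (rule frame_expand[OF onb\<epsilon>])
  then have "cov act_triv \<Gamma> \<phi> c x u vs = (\<Sum>j\<in>UNIV. bil (g c x) (\<epsilon> j) u *\<^sub>R cov act_triv \<Gamma> \<phi> c x (\<epsilon> j) vs)"
    using linear_sum[OF l] linear_cmul[OF l] by (metis (mono_tags, lifting) sum.cong)
  then show ?thesis by (simp add: z)
qed

end

section \<open>Curvature of a torsion-free G2 structure\<close>

text \<open>The adapted coframe transports algebraic identities from \<open>phi0\<close> to \<open>\<phi>\<close>, for which a separate choice at each
  point suffices.\<close>

locale G2_chart = levi_civita_chart c U \<Gamma> g
  for c :: "'a chart" and U \<Gamma> g +
  fixes \<phi> :: "('a, real) field"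
  assumes phi_field: "smooth_field c U \<phi>"
    and phi_alt: "y \<in> U \<Longrightarrow> \<phi> c y \<in> alt_forms 3"
    and phi_parallel: "y \<in> U \<Longrightarrow> cov act_triv \<Gamma> \<phi> c y u vs = 0"
    and coframe: "y \<in> U \<Longrightarrow> \<exists>\<theta>. invertible \<theta> \<and> (\<forall>u v. bil (g c y) u v = (\<theta> *v u) \<bullet> (\<theta> *v v)) \<and>
      (\<forall>u v w. \<phi> c y [u, v, w] = phi0 (\<theta> *v u) (\<theta> *v v) (\<theta> *v w))"
begin

lemma phi_linear:
  assumes "x \<in> U"
  shows "linear (\<lambda>u. \<phi> c x [u, v, w])" "linear (\<lambda>v. \<phi> c x [u, v, w])" "linear (\<lambda>w. \<phi> c x [u, v, w])"
  using multilinD[OF alt_forms_multilin[OF phi_alt[OF assms]], of 0 "[0, v, w]"]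
    multilinD[OF alt_forms_multilin[OF phi_alt[OF assms]], of 1 "[u, 0, w]"]
    multilinD[OF alt_forms_multilin[OF phi_alt[OF assms]], of 2 "[u, v, 0]"]
  by (simp_all add: numeral_2_eq_2)

lemma phi_swap:
  assumes "x \<in> U"
  shows "\<phi> c x [v, u, w] = - \<phi> c x [u, v, w]" "\<phi> c x [u, w, v] = - \<phi> c x [u, v, w]"
  using alt_forms_update_swap[OF phi_alt[OF assms], of 0 "[u, v, w]" 1 v u]
    alt_forms_update_swap[OF phi_alt[OF assms], of 1 "[u, v, w]" 2 w v]
  by (simp_all add: numeral_2_eq_2)

lemma phi_cyc: "x \<in> U \<Longrightarrow> \<phi> c x [w, u, v] = \<phi> c x [u, v, w]"
  using phi_swap(1)[of x w u v] phi_swap(2)[of x u w v] by simp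

lemma phi_cross:
  assumes x: "x \<in> U"
  shows "(\<Sum>m\<in>UNIV. \<phi> c x [p, y, e x m] * \<phi> c x [z, w, e x m]) + (\<Sum>m\<in>UNIV. \<phi> c x [z, y, e x m] * \<phi> c x [p, w, e x m])
    = 2 * bil (g c x) p z * bil (g c x) y w - bil (g c x) p y * bil (g c x) z w - bil (g c x) z y * bil (g c x) p w"
proof -
  obtain \<theta> where inv: "invertible \<theta>" and G: "\<And>u v. bil (g c x) u v = (\<theta> *v u) \<bullet> (\<theta> *v v)"
    and P: "\<And>u v w. \<phi> c x [u, v, w] = phi0 (\<theta> *v u) (\<theta> *v v) (\<theta> *v w)"
    using coframe[OF x] by auto
  define \<epsilon> where "\<epsilon> = (\<lambda>i. matrix_inv \<theta> *v axis i (1::real))"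
  have \<epsilon>: "onb (g c x) \<epsilon>" unfolding \<epsilon>_def by (rule coframe_onb[OF G inv])
  have \<theta>\<epsilon>: "\<theta> *v \<epsilon> i = axis i 1" for i
    by (simp add: \<epsilon>_def matrix_vector_mul_assoc matrix_inv_both(1)[OF inv])
  have "(\<Sum>m\<in>UNIV. \<phi> c x [p, y, e x m] * \<phi> c x [z, w, e x m])
      = (\<Sum>m\<in>UNIV. phi0 (\<theta> *v p) (\<theta> *v y) (axis m 1) * phi0 (\<theta> *v z) (\<theta> *v w) (axis m 1))" for p z
  proof -
    have "bilinear (\<lambda>u v. \<phi> c x [p, y, u] * \<phi> c x [z, w, v])"
      using phi_linear(3)[OF x] unfolding bilinear_def linear_iff by (simp add: algebra_simps)
    from contraction_frame_indep[OF onb_e[OF x] \<epsilon> this]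
    show ?thesis by (simp add: P \<theta>\<epsilon>)
  qed
  then show ?thesis by (simp add: phi0_cross_polarised G)
qed

lemma phi_norm:
  assumes x: "x \<in> U"
  shows "(\<Sum>i\<in>UNIV. \<Sum>j\<in>UNIV. \<phi> c x [y, e x i, e x j] * \<phi> c x [w, e x i, e x j]) = 6 * bil (g c x) y w"
proof -
  let ?b = "bil (g c x)"
  have e1: "?b (e x i) (e x i) = 1" for i using onb_e[OF x] by (simp add: onb_def)
  have "(\<Sum>j\<in>UNIV. \<phi> c x [y, e x i, e x j] * \<phi> c x [w, e x i, e x j]) = ?b y w - ?b (e x i) y * ?b (e x i) w" for i
  proof -
    have "(\<Sum>j\<in>UNIV. \<phi> c x [y, e x i, e x j] * \<phi> c x [w, e x i, e x j])
        = (\<Sum>j\<in>UNIV. \<phi> c x [e x i, y, e x j] * \<phi> c x [e x i, w, e x j])"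
      by (simp add: phi_swap(1)[OF x, of y] phi_swap(1)[OF x, of w])
    then show ?thesis using phi_cross[OF x, of "e x i" y "e x i" w] by (simp add: e1 algebra_simps)
  qed
  moreover have "(\<Sum>i\<in>UNIV. ?b (e x i) y * ?b (e x i) w) = ?b y w"
  proof -
    have l: "linear (\<lambda>u. ?b u w)" by (simp add: linear_iff bil_linear)
    have "?b y w = ?b (\<Sum>i\<in>UNIV. ?b (e x i) y *\<^sub>R e x i) w" using frame_expand[OF onb_e[OF x], of y] by simp
    then show ?thesis by (simp add: linear_sum[OF l] bil_linear)
  qed
  ultimately show ?thesis by (simp add: sum_subtractf)
qed

text \<open>The holonomy condition: the curvature endomorphisms annihilate \<open>\<phi>\<close>, so as two-forms they lie in
  \<open>\<Lambda>\<^sup>2\<^sub>1\<^sub>4\<close> and are orthogonal to all contractions of \<open>\<phi>\<close>.\<close>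

lemma phi_curv:
  assumes x: "x \<in> U"
  shows "(\<Sum>j\<in>UNIV. \<phi> c x [R x u v *v e x j, e x j, y]) = 0"
proof -
  let ?R = "R x u v"
  obtain \<theta> where inv: "invertible \<theta>" and G: "\<And>u v. bil (g c x) u v = (\<theta> *v u) \<bullet> (\<theta> *v v)"
    and P: "\<And>u v w. \<phi> c x [u, v, w] = phi0 (\<theta> *v u) (\<theta> *v v) (\<theta> *v w)"
    using coframe[OF x] by auto
  define \<epsilon> where "\<epsilon> = (\<lambda>i. matrix_inv \<theta> *v axis i (1::real))"
  have \<epsilon>: "onb (g c x) \<epsilon>" unfolding \<epsilon>_def by (rule coframe_onb[OF G inv])
  have \<theta>i: "\<theta> *v (matrix_inv \<theta> *v v) = v" for v
    by (simp add: matrix_vector_mul_assoc matrix_inv_both(1)[OF inv])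
  define B where "B = \<theta> ** ?R ** matrix_inv \<theta>"
  have B: "B *v v = \<theta> *v (?R *v (matrix_inv \<theta> *v v))" for v by (simp add: B_def matrix_vector_mul_assoc matrix_mul_assoc)
  have t: "tact act_triv ?R (\<phi> c x) [p, q, r]
      = - (\<phi> c x [?R *v p, q, r] + \<phi> c x [p, ?R *v q, r] + \<phi> c x [p, q, ?R *v r])" for p q r
    by (simp add: tact_def act_triv_def)
  have inf: "\<phi> c x [?R *v p, q, r] + \<phi> c x [p, ?R *v q, r] + \<phi> c x [p, q, ?R *v r] = 0" for p q r
    using parallel_curvature[where \<omega> = \<phi>, OF lie_action_triv phi_field x phi_parallel, of u v "[p, q, r]"]
    by (simp only: t neg_equal_0_iff_equal)
  have "der0 B p q r = 0" for p q r
    using inf[of "matrix_inv \<theta> *v p" "matrix_inv \<theta> *v q" "matrix_inv \<theta> *v r"] by (simp add: P der0_def B \<theta>i)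
  moreover have "transpose B = - B"
  proof -
    have "(B *v p) \<bullet> q = - (p \<bullet> (B *v q))" for p q
      using curv_skew[OF x, of u v "matrix_inv \<theta> *v p" "matrix_inv \<theta> *v q"] by (simp add: G B \<theta>i)
    then have "p \<bullet> (transpose B *v q) = p \<bullet> ((- B) *v q)" for p q
      by (simp add: inner_matrix_transpose matrix_vector_uminus_left)
    then have "transpose B *v q = (- B) *v q" for q using vector_eq_ldot by blast
    then show ?thesis by (simp add: matrix_eq)
  qed
  ultimately have "tor B k = 0" for k using der0_eq_0_iff by blast
  then have z: "(\<Sum>j\<in>UNIV. \<phi> c x [?R *v \<epsilon> j, \<epsilon> j, \<epsilon> k]) = 0" for k
    unfolding tor_def P \<epsilon>_def B \<theta>i .
  have "(\<Sum>j\<in>UNIV. \<phi> c x [?R *v \<epsilon> j, \<epsilon> j, y]) = (\<Sum>j\<in>UNIV. \<Sum>k\<in>UNIV. bil (g c x) (\<epsilon> k) y * \<phi> c x [?R *v \<epsilon> j, \<epsilon> j, \<epsilon> k])"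
  proof (rule sum.cong[OF refl])
    fix j
    have "\<phi> c x [?R *v \<epsilon> j, \<epsilon> j, y] = \<phi> c x [?R *v \<epsilon> j, \<epsilon> j, \<Sum>k\<in>UNIV. bil (g c x) (\<epsilon> k) y *\<^sub>R \<epsilon> k]"
      using frame_expand[OF \<epsilon>, of y] by simp
    then show "\<phi> c x [?R *v \<epsilon> j, \<epsilon> j, y] = (\<Sum>k\<in>UNIV. bil (g c x) (\<epsilon> k) y * \<phi> c x [?R *v \<epsilon> j, \<epsilon> j, \<epsilon> k])"
      by (simp add: linear_sum[OF phi_linear(3)[OF x]] linear_cmul[OF phi_linear(3)[OF x]])
  qed
  also have "\<dots> = (\<Sum>k\<in>UNIV. bil (g c x) (\<epsilon> k) y * (\<Sum>j\<in>UNIV. \<phi> c x [?R *v \<epsilon> j, \<epsilon> j, \<epsilon> k]))"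
    by (subst sum.swap) (simp add: sum_distrib_left)
  finally have "(\<Sum>j\<in>UNIV. \<phi> c x [?R *v \<epsilon> j, \<epsilon> j, y]) = 0" by (simp add: z)
  moreover have bl: "bilinear (\<lambda>u w. \<phi> c x [?R *v u, w, y])"
    using phi_linear(1,2)[OF x] unfolding bilinear_def linear_iff
    by (simp add: matrix_vector_right_distrib matrix_vector_mult_scaleR)
  ultimately show ?thesis using contraction_frame_indep[OF onb_e[OF x] \<epsilon> bl] by simp
qed

lemma phi_curv_contraction:
  assumes x: "x \<in> U"
  shows "(\<Sum>k\<in>UNIV. \<Sum>l\<in>UNIV. \<phi> c x [e x k, e x l, y] * bil (g c x) (R x u v *v e x k) (e x l)) = 0"
proof -
  have "(\<Sum>l\<in>UNIV. \<phi> c x [e x k, e x l, y] * bil (g c x) (R x u v *v e x k) (e x l)) = - \<phi> c x [R x u v *v e x k, e x k, y]" for k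
  proof -
    have "\<phi> c x [e x k, R x u v *v e x k, y]
        = \<phi> c x [e x k, \<Sum>l\<in>UNIV. bil (g c x) (e x l) (R x u v *v e x k) *\<^sub>R e x l, y]"
      using frame_expand[OF onb_e[OF x], of "R x u v *v e x k"] by simp
    also have "\<dots> = (\<Sum>l\<in>UNIV. \<phi> c x [e x k, e x l, y] * bil (g c x) (R x u v *v e x k) (e x l))"
      by (simp add: linear_sum[OF phi_linear(2)[OF x]] linear_cmul[OF phi_linear(2)[OF x]]
          metric_sym[OF x, of "e x _" "R x u v *v e x k"] mult.commute)
    finally show ?thesis using phi_swap(1)[OF x, of "R x u v *v e x k" "e x k" y] by simp
  qed
  then show ?thesis by (simp add: sum_negf phi_curv[OF x])
qed

lemma sum3_rotate: "(\<Sum>j\<in>A. \<Sum>k\<in>A. \<Sum>l\<in>A. f j k l) = (\<Sum>j\<in>A. \<Sum>k\<in>A. \<Sum>l\<in>A. f l j k)"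
  for f :: "'i \<Rightarrow> 'i \<Rightarrow> 'i \<Rightarrow> real"
proof -
  have "(\<Sum>j\<in>A. \<Sum>k\<in>A. \<Sum>l\<in>A. f l j k) = (\<Sum>j\<in>A. \<Sum>l\<in>A. \<Sum>k\<in>A. f l j k)"
    by (intro sum.cong refl sum.swap)
  also have "\<dots> = (\<Sum>l\<in>A. \<Sum>j\<in>A. \<Sum>k\<in>A. f l j k)" by (rule sum.swap)
  finally show ?thesis by simp
qed

text \<open>The combinatorial core of Ricci flatness. Here \<open>ch\<close> is a contraction of \<open>\<phi>\<close> with itself and \<open>\<kappa>\<close> is the
  curvature. The Bianchi identity is multiplied by \<open>ch\<close> and summed. The cross product identity makes \<open>ch\<close> totally
  skew up to metric terms, so after renaming indices the three sums agree up to traces of \<open>\<kappa>\<close>, which are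
  components of the Ricci tensor. The first sum vanishes by the last hypothesis, hence so do these traces.\<close>

lemma ricci_core:
  fixes ch \<kappa> :: "7 \<Rightarrow> 7 \<Rightarrow> 7 \<Rightarrow> real" and y :: "7 \<Rightarrow> real"
  assumes ch1: "\<And>j k l. ch j l k = - ch j k l"
    and ch2: "\<And>j k l. ch j k l + ch k j l = 2 * of_bool (j = k) * y l - y j * of_bool (k = l) - y k * of_bool (j = l)"
    and \<kappa>1: "\<And>j k l. \<kappa> j l k = - \<kappa> j k l"
    and \<kappa>2: "\<And>j k l. \<kappa> j k l + \<kappa> k l j + \<kappa> l j k = 0"
    and z: "(\<Sum>j\<in>UNIV. \<Sum>k\<in>UNIV. \<Sum>l\<in>UNIV. ch j k l * \<kappa> j k l) = 0"
  shows "(\<Sum>j\<in>UNIV. \<Sum>k\<in>UNIV. y k * \<kappa> j k j) = 0"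
proof -
  let ?S = "\<lambda>f :: 7 \<Rightarrow> 7 \<Rightarrow> 7 \<Rightarrow> real. \<Sum>j\<in>UNIV. \<Sum>k\<in>UNIV. \<Sum>l\<in>UNIV. f j k l"
  have c1: "ch l j k = ch j k l + (2 * of_bool (l = j) * y k - y l * of_bool (j = k) - y j * of_bool (l = k))" for j k l
    using ch1[of j l k] ch2[of l j k] by simp
  have c2: "ch k l j = ch j k l - (2 * of_bool (j = k) * y l - y j * of_bool (k = l) - y k * of_bool (j = l))" for j k l
    using ch1[of k j l] ch2[of j k l] by simp
  have r1: "?S (\<lambda>j k l. ch j k l * \<kappa> k l j) = ?S (\<lambda>j k l. ch l j k * \<kappa> j k l)"
    by (rule sum3_rotate)
  have r2: "?S (\<lambda>j k l. ch j k l * \<kappa> l j k) = ?S (\<lambda>j k l. ch k l j * \<kappa> j k l)"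
    by (rule trans[OF sum3_rotate sum3_rotate])
  have pt: "(ch j k l + ch l j k + ch k l j) * \<kappa> j k l = 3 * (ch j k l * \<kappa> j k l)
      + 3 * (of_bool (l = j) * (y k * \<kappa> j k l)) - 3 * (of_bool (j = k) * (y l * \<kappa> j k l))" for j k l
    unfolding c1[of l j k] c2[of k l j] eq_commute[of l k] eq_commute[of l j] by (simp add: algebra_simps)
  have q: "\<kappa> j j l = - \<kappa> j l j" for j l by (rule \<kappa>1)
  have "0 = ?S (\<lambda>j k l. ch j k l * (\<kappa> j k l + \<kappa> k l j + \<kappa> l j k))" by (simp add: \<kappa>2)
  also have "\<dots> = ?S (\<lambda>j k l. ch j k l * \<kappa> j k l) + ?S (\<lambda>j k l. ch j k l * \<kappa> k l j) + ?S (\<lambda>j k l. ch j k l * \<kappa> l j k)"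
    by (simp add: distrib_left sum.distrib)
  also have "\<dots> = ?S (\<lambda>j k l. ch j k l * \<kappa> j k l) + ?S (\<lambda>j k l. ch l j k * \<kappa> j k l) + ?S (\<lambda>j k l. ch k l j * \<kappa> j k l)"
    unfolding r1 r2 ..
  also have "\<dots> = ?S (\<lambda>j k l. (ch j k l + ch l j k + ch k l j) * \<kappa> j k l)"
    by (simp add: distrib_right sum.distrib)
  also have "\<dots> = ?S (\<lambda>j k l. 3 * (ch j k l * \<kappa> j k l) + 3 * (of_bool (l = j) * (y k * \<kappa> j k l)) - 3 * (of_bool (j = k) * (y l * \<kappa> j k l)))"
    unfolding pt ..
  also have "\<dots> = 3 * ?S (\<lambda>j k l. ch j k l * \<kappa> j k l) + 3 * ?S (\<lambda>j k l. of_bool (l = j) * (y k * \<kappa> j k l))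
      - 3 * ?S (\<lambda>j k l. of_bool (j = k) * (y l * \<kappa> j k l))"
    by (simp only: sum.distrib sum_subtractf sum_distrib_left)
  also have "?S (\<lambda>j k l. of_bool (l = j) * (y k * \<kappa> j k l)) = (\<Sum>j\<in>UNIV. \<Sum>k\<in>UNIV. y k * \<kappa> j k j)"
    by (simp add: of_bool_def if_distrib[of "\<lambda>r. r * _"] cong: if_cong)
  also have "?S (\<lambda>j k l. of_bool (j = k) * (y l * \<kappa> j k l)) = (\<Sum>j\<in>UNIV. \<Sum>l\<in>UNIV. y l * \<kappa> j j l)"
  proof (rule sum.cong[OF refl])
    fix j :: 7
    have "(\<Sum>k\<in>UNIV. \<Sum>l\<in>UNIV. of_bool (j = k) * (y l * \<kappa> j k l)) = (\<Sum>k\<in>UNIV. if j = k then \<Sum>l\<in>UNIV. y l * \<kappa> j k l else 0)"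
      by (intro sum.cong refl) (simp add: of_bool_def)
    then show "(\<Sum>k\<in>UNIV. \<Sum>l\<in>UNIV. of_bool (j = k) * (y l * \<kappa> j k l)) = (\<Sum>l\<in>UNIV. y l * \<kappa> j j l)" by simp
  qed
  also have "(\<Sum>j\<in>UNIV. \<Sum>l\<in>UNIV. y l * \<kappa> j j l) = - (\<Sum>j\<in>UNIV. \<Sum>k\<in>UNIV. y k * \<kappa> j k j)"
    by (simp only: q mult_minus_right sum_negf)
  finally show ?thesis by (simp add: z)
qed

text \<open>The contraction \<open>ch\<close> of \<open>\<phi>\<close> with itself is chosen so that one of its factors is contracted with the curvature
  in two indices, which gives zero by \<open>phi_curv_contraction\<close>.\<close>

lemma ricci_flat:
  assumes x: "x \<in> U"
  shows "(\<Sum>j\<in>UNIV. R x v (e x j) *v e x j) = 0"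
proof -
  let ?b = "bil (g c x)" and ?P = "\<lambda>u v w. \<phi> c x [u, v, w]"
  have \<delta>: "?b (e x i) (e x j) = of_bool (i = j)" for i j using onb_e[OF x] by (simp add: onb_def)
  define \<kappa> where "\<kappa> = (\<lambda>j k l. ?b (R x v (e x j) *v e x k) (e x l))"
  define ch where "ch = (\<lambda>y j k l. \<Sum>m\<in>UNIV. ?P (e x j) y (e x m) * ?P (e x k) (e x l) (e x m))"
  have main: "(\<Sum>j\<in>UNIV. \<Sum>k\<in>UNIV. ?b y (e x k) * \<kappa> j k j) = 0" for y
  proof (rule ricci_core[where ch = "ch y" and y = "\<lambda>l. ?b y (e x l)" and \<kappa> = \<kappa>])
    show "ch y j l k = - ch y j k l" for j k l
      unfolding ch_def phi_swap(1)[OF x, of "e x l" "e x k"] by (simp add: sum_negf)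
    show "ch y j k l + ch y k j l = 2 * of_bool (j = k) * ?b y (e x l) - ?b y (e x j) * of_bool (k = l) - ?b y (e x k) * of_bool (j = l)" for j k l
      unfolding ch_def using phi_cross[OF x, of "e x j" y "e x k" "e x l"]
      by (simp add: \<delta> metric_sym[OF x, of "e x _" y])
    show "\<kappa> j l k = - \<kappa> j k l" for j k l
      unfolding \<kappa>_def using curv_skew[OF x, of v "e x j" "e x l" "e x k"]
        metric_sym[OF x, of "e x l" "R x v (e x j) *v e x k"] by simp
    show "\<kappa> j k l + \<kappa> k l j + \<kappa> l j k = 0" for j k l
    proof -
      have s: "?b (R x v (e x a) *v e x b) (e x d) = - ?b (R x (e x b) (e x d) *v e x a) v" for a b d
        using curv_pair_sym[OF x, of v "e x a" "e x b" "e x d"] curv_skew[OF x, of "e x b" "e x d" v "e x a"]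
          metric_sym[OF x, of v "R x (e x b) (e x d) *v e x a"] by simp
      have "?b (R x (e x k) (e x l) *v e x j) v + ?b (R x (e x l) (e x j) *v e x k) v + ?b (R x (e x j) (e x k) *v e x l) v = 0"
        unfolding bil_linear(1)[symmetric] using bianchi[OF x, of "e x k" "e x l" "e x j"] by (simp add: bil_linear)
      then show ?thesis unfolding \<kappa>_def s by linarith
    qed
    have "(\<Sum>k\<in>UNIV. \<Sum>l\<in>UNIV. ch y j k l * \<kappa> j k l) = 0" for j
    proof -
      have "(\<Sum>k\<in>UNIV. \<Sum>l\<in>UNIV. ch y j k l * \<kappa> j k l)
          = (\<Sum>k\<in>UNIV. \<Sum>l\<in>UNIV. \<Sum>m\<in>UNIV. ?P (e x j) y (e x m) * (?P (e x k) (e x l) (e x m) * \<kappa> j k l))"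
        by (simp add: ch_def sum_distrib_right mult.assoc)
      also have "\<dots> = (\<Sum>m\<in>UNIV. \<Sum>k\<in>UNIV. \<Sum>l\<in>UNIV. ?P (e x j) y (e x m) * (?P (e x k) (e x l) (e x m) * \<kappa> j k l))"
        by (rule sum3_rotate[where f = "\<lambda>m k l. ?P (e x j) y (e x m) * (?P (e x k) (e x l) (e x m) * \<kappa> j k l)", symmetric])
      also have "\<dots> = (\<Sum>m\<in>UNIV. ?P (e x j) y (e x m) * (\<Sum>k\<in>UNIV. \<Sum>l\<in>UNIV. ?P (e x k) (e x l) (e x m) * \<kappa> j k l))"
        by (simp add: sum_distrib_left)
      finally show ?thesis by (simp add: \<kappa>_def phi_curv_contraction[OF x])
    qed
    then show "(\<Sum>j\<in>UNIV. \<Sum>k\<in>UNIV. \<Sum>l\<in>UNIV. ch y j k l * \<kappa> j k l) = 0" by simp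
  qed
  have lb: "linear (\<lambda>u. ?b u y)" "linear (\<lambda>u. ?b y u)" for y by (simp_all add: linear_iff bil_linear)
  have "?b (e x m) (\<Sum>j\<in>UNIV. R x v (e x j) *v e x j) = 0" for m
  proof -
    have "(\<Sum>j\<in>UNIV. \<kappa> j m j) = (\<Sum>j\<in>UNIV. \<Sum>k\<in>UNIV. ?b (e x m) (e x k) * \<kappa> j k j)"
      by (simp add: \<delta> of_bool_def if_distrib[of "\<lambda>r. r * _"] cong: if_cong)
    then have "(\<Sum>j\<in>UNIV. \<kappa> j m j) = 0" using main by simp
    moreover have "?b (e x m) (R x v (e x j) *v e x j) = - \<kappa> j m j" for j
      unfolding \<kappa>_def using curv_skew[OF x, of v "e x j" "e x m" "e x j"] by simp
    ultimately show ?thesis by (simp add: linear_sum[OF lb(2)] sum_negf)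
  qed
  then show ?thesis
    using frame_expand[OF onb_e[OF x], of "\<Sum>j\<in>UNIV. R x v (e x j) *v e x j"] by simp
qed

text \<open>By the pair symmetry, the curvature lies in \<open>\<Lambda>\<^sup>2\<^sub>1\<^sub>4\<close> also as a two-form on \<open>Y\<close>.\<close>

lemma phi_curv_form:
  assumes x: "x \<in> U"
  shows "(\<Sum>i\<in>UNIV. \<Sum>k\<in>UNIV. \<phi> c x [e x i, e x k, y] *\<^sub>R (R x (e x i) (e x k) *v z)) = 0" (is "?S = 0")
proof -
  have lb: "linear (\<lambda>u. bil (g c x) w u)" for w by (simp add: linear_iff bil_linear)
  have "bil (g c x) w ?S = 0" for w
  proof -
    have "bil (g c x) w ?S = (\<Sum>i\<in>UNIV. \<Sum>k\<in>UNIV. \<phi> c x [e x i, e x k, y] * bil (g c x) (R x z w *v e x i) (e x k))"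
      by (simp add: linear_sum[OF lb] bil_linear metric_sym[OF x, of w] curv_pair_sym[OF x, of "e x _" "e x _" z w])
    then show ?thesis by (simp add: phi_curv_contraction[OF x])
  qed
  then show ?thesis using frame_expand[OF onb_e[OF x], of ?S] by simp
qed

end

section \<open>The canonical projections\<close>

lemma sum_lessThan_add: "(\<Sum>l<m + n. f l) = (\<Sum>l<m. f l) + (\<Sum>l<n. f (m + l))"
  for f :: "nat \<Rightarrow> 'b::comm_monoid_add"
  by (induction n) (simp_all add: ac_simps)

lemma proj_can_ge4:
  assumes "k \<ge> 4"
  shows "proj_can G \<phi> k \<omega> = (\<lambda>vs. 0)"
proof -
  have c: "can \<phi> k = {\<lambda>vs. 0}" using assms by (simp add: can_def)
  show ?thesis unfolding proj_can_def c by (rule the_equality) (simp_all add: form_inner_def)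
qed

lemma Pi_can_ge4: "k \<ge> 4 \<Longrightarrow> Pi_can g \<phi> k \<omega> c x vs = 0"
  by (simp add: Pi_can_def proj_can_ge4)

context G2_chart
begin

lemma proj_can_1:
  assumes x: "x \<in> U" and \<omega>: "\<omega> \<in> alt_forms 1"
  shows "proj_can (g c x) (\<phi> c x) 1 \<omega> = \<omega>"
  unfolding proj_can_def
proof (rule the_equality)
  show "\<omega> \<in> can (\<phi> c x) 1 \<and> (\<forall>\<zeta>\<in>can (\<phi> c x) 1. form_inner (g c x) 1 (\<lambda>vs. \<omega> vs - \<omega> vs) \<zeta> = 0)"
    using \<omega> by (simp add: can_def form_inner_def)
next
  fix \<eta> assume h: "\<eta> \<in> can (\<phi> c x) 1 \<and> (\<forall>\<zeta>\<in>can (\<phi> c x) 1. form_inner (g c x) 1 (\<lambda>vs. \<omega> vs - \<eta> vs) \<zeta> = 0)"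
  then have \<eta>: "\<eta> \<in> alt_forms 1" by (simp add: can_def)
  define \<delta> where "\<delta> = (\<lambda>vs. \<omega> vs - \<eta> vs)"
  have \<delta>: "\<delta> \<in> alt_forms 1" unfolding \<delta>_def by (rule alt_forms_diff[OF \<omega> \<eta>])
  have "form_inner (g c x) 1 \<delta> \<delta> = 0" using h \<delta> by (simp add: can_def \<delta>_def)
  then have "(\<Sum>i\<in>UNIV. \<delta> [e x i] * \<delta> [e x i]) = 0"
    unfolding form_inner_def One_nat_def sum_lists_Suc by simp
  then have z: "\<delta> [e x i] = 0" for i
    by (subst (asm) sum_nonneg_eq_0_iff) auto
  have "\<delta> vs = 0" for vs
  proof (cases "length vs = 1")
    case True
    then obtain v where v: "vs = [v]" by (auto simp: length_Suc_conv)
    have l: "linear (\<lambda>v. \<delta> [v])" using multilin_hd[OF alt_forms_multilin[OF \<delta>]] .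
    have "\<delta> [v] = \<delta> [\<Sum>i\<in>UNIV. bil (g c x) (e x i) v *\<^sub>R e x i]"
      using frame_expand[OF onb_e[OF x], of v] by simp
    then show ?thesis by (simp add: v z linear_sum[OF l] linear_cmul[OF l])
  qed (simp add: alt_forms_len[OF \<delta>])
  then show "\<eta> = \<omega>" by (auto simp: \<delta>_def)
qed

lemma Pi_can_1:
  assumes x: "x \<in> U" and \<omega>: "\<omega> c x \<in> alt_forms 1"
  shows "Pi_can g \<phi> 1 \<omega> c x vs = \<omega> c x vs"
proof -
  have "(\<lambda>us. \<omega> c x us \<bullet> b) \<in> alt_forms 1" for b
    by (rule alt_forms_compose_linear[OF \<omega>]) (simp add: linear_iff inner_add_left)
  then show ?thesis by (simp add: Pi_can_def proj_can_1[OF x] euclidean_representation del: One_nat_def)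
qed

text \<open>The map \<open>X \<mapsto> \<iota>\<^sub>X \<phi>\<close> from \<open>TY\<close> onto \<open>\<Lambda>\<^sup>2\<^sub>7\<close> multiplies the inner product by \<open>3\<close>; the sum over all pairs of indices
  doubles this.\<close>

lemma proj_can_2:
  assumes x: "x \<in> U"
  shows "proj_can (g c x) (\<phi> c x) 2 \<omega> = (\<lambda>vs. \<Sum>k\<in>UNIV.
     ((\<Sum>I | length I = 2. \<omega> (map (e x) I) * \<phi> c x (e x k # map (e x) I)) / 6) * \<phi> c x (e x k # vs))"
proof -
  let ?b = "bil (g c x)" and ?P = "\<phi> c x"
  have lh: "linear (\<lambda>u. ?P (u # vs))" for vs by (rule multilin_hd[OF alt_forms_multilin[OF phi_alt[OF x]]])
  define s where "s = (\<lambda>Y. (\<Sum>I | length I = 2. \<omega> (map (e x) I) * ?P (Y # map (e x) I)) / 6)"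
  have ls: "linear s"
    unfolding s_def
    by (auto simp: linear_iff linear_add[OF lh] linear_cmul[OF lh] distrib_left sum.distrib add_divide_distrib
        sum_distrib_left mult.left_commute)
  define X where "X = (\<Sum>k\<in>UNIV. s (e x k) *\<^sub>R e x k)"
  have lb: "linear (\<lambda>u. ?b u Y)" "linear (?b Y)" for Y by (simp_all add: linear_iff bil_linear)
  have sX: "s Y = ?b X Y" for Y
  proof -
    have "s Y = s (\<Sum>k\<in>UNIV. ?b (e x k) Y *\<^sub>R e x k)" using frame_expand[OF onb_e[OF x], of Y] by simp
    then show ?thesis
      by (simp add: X_def linear_sum[OF ls] linear_cmul[OF ls] linear_sum[OF lb(1)] bil_linear mult.commute)
  qed
  have fi: "form_inner (g c x) 2 (\<lambda>vs. \<omega> vs - ?P (Z # vs)) (\<lambda>vs. ?P (Y # vs)) = 3 * (?b X Y - ?b Z Y)" for Y Z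
  proof -
    have "(\<Sum>I | length I = 2. ?P (Z # map (e x) I) * ?P (Y # map (e x) I)) = 6 * ?b Z Y"
      unfolding numeral_2_eq_2 sum_lists_Suc using phi_norm[OF x, of Z Y] by simp
    moreover have "(\<Sum>I | length I = 2. \<omega> (map (e x) I) * ?P (Y # map (e x) I)) = 6 * ?b X Y"
      using sX[of Y] by (simp add: s_def)
    ultimately show ?thesis
      by (simp add: form_inner_def left_diff_distrib sum_subtractf)
  qed
  have "proj_can (g c x) ?P 2 \<omega> = (\<lambda>vs. ?P (X # vs))"
    unfolding proj_can_def
  proof (rule the_equality)
    show "(\<lambda>vs. ?P (X # vs)) \<in> can ?P 2 \<and>
        (\<forall>\<zeta>\<in>can ?P 2. form_inner (g c x) 2 (\<lambda>vs. \<omega> vs - ?P (X # vs)) \<zeta> = 0)"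
      by (auto simp: can_def fi)
  next
    fix \<eta> assume h: "\<eta> \<in> can ?P 2 \<and> (\<forall>\<zeta>\<in>can ?P 2. form_inner (g c x) 2 (\<lambda>vs. \<omega> vs - \<eta> vs) \<zeta> = 0)"
    then obtain Z where Z: "\<eta> = (\<lambda>vs. ?P (Z # vs))" by (auto simp: can_def)
    have "form_inner (g c x) 2 (\<lambda>vs. \<omega> vs - \<eta> vs) (\<lambda>vs. ?P (Y # vs)) = 0" for Y
      using h by (auto simp: can_def)
    then have "?b X Y = ?b Z Y" for Y by (simp add: Z fi)
    then have "?b (e x k) X = ?b (e x k) Z" for k
      using metric_sym[OF x, of "e x k" X] metric_sym[OF x, of "e x k" Z] by simp
    then have "X = Z" using frame_expand[OF onb_e[OF x], of X] frame_expand[OF onb_e[OF x], of Z] by simp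
    then show "\<eta> = (\<lambda>vs. ?P (X # vs))" by (simp add: Z)
  qed
  also have "\<dots> = (\<lambda>vs. \<Sum>k\<in>UNIV. s (e x k) * ?P (e x k # vs))"
    by (simp add: X_def linear_sum[OF lh] linear_cmul[OF lh])
  finally show ?thesis by (simp add: s_def)
qed

text \<open>The norm of \<open>\<phi>\<close> is given by \<open>|\<phi>|\<^sup>2 = 42 / 3! = 7\<close>.\<close>

lemma proj_can_3:
  assumes x: "x \<in> U"
  shows "proj_can (g c x) (\<phi> c x) 3 \<omega>
    = (\<lambda>vs. (\<Sum>I | length I = 3. \<omega> (map (e x) I) * \<phi> c x (map (e x) I)) / 42 * \<phi> c x vs)"
proof -
  let ?P = "\<phi> c x"
  define q where "q = (\<Sum>I | length I = 3. \<omega> (map (e x) I) * ?P (map (e x) I))"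
  have e1: "bil (g c x) (e x i) (e x i) = 1" for i using onb_e[OF x] by (simp add: onb_def)
  have n: "(\<Sum>I | length I = 3. ?P (map (e x) I) * ?P (map (e x) I)) = 42"
    unfolding numeral_3_eq_3 sum_lists_Suc using phi_norm[OF x] by (simp add: e1)
  have fi: "form_inner (g c x) 3 (\<lambda>vs. \<omega> vs - r * ?P vs) (\<lambda>vs. t * ?P vs) = t * (q - 42 * r) / 6" for r t
  proof -
    have "(\<Sum>I | length I = 3. (\<omega> (map (e x) I) - r * ?P (map (e x) I)) * (t * ?P (map (e x) I)))
        = (\<Sum>I | length I = 3. t * (\<omega> (map (e x) I) * ?P (map (e x) I)) - t * r * (?P (map (e x) I) * ?P (map (e x) I)))"
      by (intro sum.cong refl) (simp add: algebra_simps)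
    also have "\<dots> = t * q - t * r * 42" by (simp only: sum_subtractf sum_distrib_left[symmetric] n q_def)
    finally show ?thesis by (simp add: form_inner_def fact_numeral algebra_simps)
  qed
  have "proj_can (g c x) ?P 3 \<omega> = (\<lambda>vs. q / 42 * ?P vs)"
    unfolding proj_can_def
  proof (rule the_equality)
    have "(\<lambda>vs. q / 42 * ?P vs) \<in> can ?P 3"
      by (auto simp: can_def intro!: exI[of _ "q / 42"])
    moreover have "form_inner (g c x) 3 (\<lambda>vs. \<omega> vs - q / 42 * ?P vs) \<zeta> = 0" if "\<zeta> \<in> can ?P 3" for \<zeta>
      using that fi[of "q / 42"] by (auto simp: can_def)
    ultimately show "(\<lambda>vs. q / 42 * ?P vs) \<in> can ?P 3 \<and>
        (\<forall>\<zeta>\<in>can ?P 3. form_inner (g c x) 3 (\<lambda>vs. \<omega> vs - q / 42 * ?P vs) \<zeta> = 0)" by blast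
  next
    fix \<eta> assume h: "\<eta> \<in> can ?P 3 \<and> (\<forall>\<zeta>\<in>can ?P 3. form_inner (g c x) 3 (\<lambda>vs. \<omega> vs - \<eta> vs) \<zeta> = 0)"
    then obtain r where r: "\<eta> = (\<lambda>vs. r * ?P vs)" by (auto simp: can_def)
    have "(\<lambda>vs. 1 * ?P vs) \<in> can ?P 3" unfolding can_def by (auto intro!: exI[of _ 1])
    then have "form_inner (g c x) 3 (\<lambda>vs. \<omega> vs - \<eta> vs) (\<lambda>vs. 1 * ?P vs) = 0" using h by blast
    then have rq: "r = q / 42" unfolding r fi by simp
    show "\<eta> = (\<lambda>vs. q / 42 * ?P vs)" unfolding r rq ..
  qed
  then show ?thesis by (simp add: q_def)
qed

text \<open>The projections \<open>\<Pi>\<^sub>2\<close> and \<open>\<Pi>\<^sub>3\<close> are contractions with this kernel.\<close>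

definition pker :: "real^7 \<Rightarrow> nat \<Rightarrow> (real^7) list \<Rightarrow> (real^7) list \<Rightarrow> real" where
  "pker x p us vs = (if p = 2 then (\<Sum>k\<in>UNIV. \<phi> c x (e x k # us) * \<phi> c x (e x k # vs)) / 6
     else \<phi> c x us * \<phi> c x vs / 42)"

lemma Pi_can_kernel:
  fixes \<omega> :: "('a, 'w::euclidean_space) field"
  assumes x: "x \<in> U" and p: "p = 2 \<or> p = 3"
  shows "Pi_can g \<phi> p \<omega> c x vs = (\<Sum>I | length I = p. pker x p (map (e x) I) vs *\<^sub>R \<omega> c x (map (e x) I))"
    (is "_ = ?v")
proof -
  have "proj_can (g c x) (\<phi> c x) p (\<lambda>us. \<omega> c x us \<bullet> b) vs = ?v \<bullet> b" for b
  proof (cases "p = 2")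
    case True
    have "proj_can (g c x) (\<phi> c x) 2 (\<lambda>us. \<omega> c x us \<bullet> b) vs
        = (\<Sum>k\<in>UNIV. \<Sum>I | length I = 2. \<phi> c x (e x k # map (e x) I) * \<phi> c x (e x k # vs) / 6 * (\<omega> c x (map (e x) I) \<bullet> b))"
      unfolding proj_can_2[OF x] by (simp add: sum_distrib_right sum_distrib_left sum_divide_distrib mult_ac)
    also have "\<dots> = (\<Sum>I | length I = 2. \<Sum>k\<in>UNIV. \<phi> c x (e x k # map (e x) I) * \<phi> c x (e x k # vs) / 6 * (\<omega> c x (map (e x) I) \<bullet> b))"
      by (rule sum.swap)
    finally show ?thesis
      using True by (simp add: pker_def inner_sum_left sum_distrib_right sum_divide_distrib)
  next
    case False
    then have "p = 3" using p by simp
    then show ?thesis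
      unfolding \<open>p = 3\<close> proj_can_3[OF x]
      by (simp add: pker_def inner_sum_left sum_distrib_left sum_distrib_right sum_divide_distrib mult_ac)
  qed
  then show ?thesis by (simp add: Pi_can_def euclidean_representation)
qed

lemma dirder_phi:
  assumes "x \<in> U"
  shows "dirder (\<lambda>y. \<phi> c y vs) x h = (\<Sum>l<length vs. \<phi> c x (vs[l := \<Gamma> c x h *v (vs ! l)]))"
  using phi_parallel[OF assms, of h vs] by (simp add: cov_def act_triv_def)

lemma phi_has_derivative:
  assumes "x \<in> U" shows "((\<lambda>y. \<phi> c y vs) has_derivative dirder (\<lambda>y. \<phi> c y vs) x) (at x)"
  by (rule has_derivative_dirder[OF smooth_field_differentiable[OF phi_field assms]])

text \<open>Since \<open>\<phi>\<close> is parallel, differentiating it only produces connection terms. Those in the contracted slots complete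
  the derivative of \<open>\<omega>\<close> to a covariant one, and those in the free slots \<open>Y\<close> remain.\<close>

lemma phi_pairing_has_derivative:
  fixes \<omega> :: "('a, 'w::euclidean_space) field"
  assumes x: "x \<in> U" and m: "\<And>y. y \<in> U \<Longrightarrow> multilin (\<omega> c y)" and d: "\<And>ws. (\<lambda>y. \<omega> c y ws) differentiable (at x)"
  shows "((\<lambda>y. \<Sum>I | length I = p. \<phi> c y (Y @ map (e y) I) *\<^sub>R \<omega> c y (map (e y) I)) has_derivative
     (\<lambda>h. (\<Sum>l<length Y. \<Sum>I | length I = p. \<phi> c x (Y[l := \<Gamma> c x h *v (Y ! l)] @ map (e x) I) *\<^sub>R \<omega> c x (map (e x) I))
        + (\<Sum>I | length I = p. \<phi> c x (Y @ map (e x) I) *\<^sub>R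
            (cov act \<Gamma> \<omega> c x h (map (e x) I) - act (\<Gamma> c x h) (\<omega> c x (map (e x) I)))))) (at x)"
proof -
  define F where "F = (\<lambda>y us vs. \<phi> c y (Y @ us) *\<^sub>R \<omega> c y vs)"
  define F' where "F' = (\<lambda>us vs h. \<phi> c x (Y @ us) *\<^sub>R dirder (\<lambda>y. \<omega> c y vs) x h
      + dirder (\<lambda>y. \<phi> c y (Y @ us)) x h *\<^sub>R \<omega> c x vs)"
  have F: "bimultilin (F y)" if y: "y \<in> U" for y
    using multilin_append2[OF alt_forms_multilin[OF phi_alt[OF y]], of Y] m[OF y]
    unfolding bimultilin_def multilin_def F_def by (auto simp: linear_iff algebra_simps)
  have dF: "((\<lambda>y. F y us vs) has_derivative F' us vs) (at x)" for us vs
    unfolding F_def F'_def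
    by (rule has_derivative_scaleR[OF phi_has_derivative[OF x] has_derivative_dirder[OF d]])
  have eq: "F' (map (e x) I) (map (e x) I) h
        - (\<Sum>l<p. F x ((map (e x) I)[l := \<Gamma> c x h *v (map (e x) I ! l)]) (map (e x) I))
        - (\<Sum>l<p. F x (map (e x) I) ((map (e x) I)[l := \<Gamma> c x h *v (map (e x) I ! l)]))
      = (\<Sum>l<length Y. \<phi> c x (Y[l := \<Gamma> c x h *v (Y ! l)] @ map (e x) I) *\<^sub>R \<omega> c x (map (e x) I))
        + \<phi> c x (Y @ map (e x) I) *\<^sub>R (cov act \<Gamma> \<omega> c x h (map (e x) I) - act (\<Gamma> c x h) (\<omega> c x (map (e x) I)))"
    if I: "length I = p" for I h
  proof -
    let ?I = "map (e x) I" and ?M = "\<Gamma> c x h"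
    have "dirder (\<lambda>y. \<phi> c y (Y @ ?I)) x h = (\<Sum>l<length Y. \<phi> c x (Y[l := ?M *v (Y ! l)] @ ?I))
        + (\<Sum>l<p. \<phi> c x (Y @ ?I[l := ?M *v (?I ! l)]))"
      unfolding dirder_phi[OF x] length_append using I
      by (simp add: sum_lessThan_add nth_append list_update_append)
    then show ?thesis
      using I unfolding F_def F'_def cov_def
      by (simp add: scaleR_add_left scaleR_sum_left scaleR_diff_right scaleR_sum_right)
  qed
  have der: "((\<lambda>y. \<Sum>I | length I = p. F y (map (e y) I) (map (e y) I)) has_derivative
     (\<lambda>h. \<Sum>I | length I = p. F' (map (e x) I) (map (e x) I) h
        - (\<Sum>l<p. F x ((map (e x) I)[l := \<Gamma> c x h *v (map (e x) I ! l)]) (map (e x) I))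
        - (\<Sum>l<p. F x (map (e x) I) ((map (e x) I)[l := \<Gamma> c x h *v (map (e x) I ! l)])))) (at x)"
    by (rule list_contraction_has_derivative[where F = F and F' = F', OF x F dF])
  have fe: "(\<Sum>I | length I = p. \<phi> c y (Y @ map (e y) I) *\<^sub>R \<omega> c y (map (e y) I))
      = (\<Sum>I | length I = p. F y (map (e y) I) (map (e y) I))" for y
    by (simp add: F_def)
  show ?thesis
    unfolding fe
  proof (rule has_derivative_eq_rhs[OF der], intro ext)
    fix h
    show "(\<Sum>I | length I = p. F' (map (e x) I) (map (e x) I) h
        - (\<Sum>l<p. F x ((map (e x) I)[l := \<Gamma> c x h *v (map (e x) I ! l)]) (map (e x) I))
        - (\<Sum>l<p. F x (map (e x) I) ((map (e x) I)[l := \<Gamma> c x h *v (map (e x) I ! l)])))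
      = (\<Sum>l<length Y. \<Sum>I | length I = p. \<phi> c x (Y[l := \<Gamma> c x h *v (Y ! l)] @ map (e x) I) *\<^sub>R \<omega> c x (map (e x) I))
        + (\<Sum>I | length I = p. \<phi> c x (Y @ map (e x) I) *\<^sub>R
            (cov act \<Gamma> \<omega> c x h (map (e x) I) - act (\<Gamma> c x h) (\<omega> c x (map (e x) I))))"
      by (subst sum.swap, subst sum.distrib[symmetric], rule sum.cong[OF refl], rule eq) simp
  qed
qed

lemma Pi_can_2_has_derivative:
  fixes \<omega> :: "('a, 'w::euclidean_space) field"
  assumes x: "x \<in> U" and m: "\<And>y. y \<in> U \<Longrightarrow> multilin (\<omega> c y)" and d: "\<And>ws. (\<lambda>y. \<omega> c y ws) differentiable (at x)"
    and act: "lie_action act"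
  shows "((\<lambda>y. Pi_can g \<phi> 2 \<omega> c y vs) has_derivative
     (\<lambda>h. (\<Sum>I | length I = 2. pker x 2 (map (e x) I) vs *\<^sub>R cov act \<Gamma> \<omega> c x h (map (e x) I))
       - act (\<Gamma> c x h) (Pi_can g \<phi> 2 \<omega> c x vs)
       + (\<Sum>l<length vs. Pi_can g \<phi> 2 \<omega> c x (vs[l := \<Gamma> c x h *v (vs ! l)])))) (at x)"
proof -
  interpret lie_action act by (rule act)
  define s where "s = (\<lambda>y v. \<Sum>I | length I = 2. \<phi> c y ([v] @ map (e y) I) *\<^sub>R \<omega> c y (map (e y) I))"
  define sc where "sc = (\<lambda>h v. \<Sum>I | length I = 2. \<phi> c x ([v] @ map (e x) I) *\<^sub>R
            (cov act \<Gamma> \<omega> c x h (map (e x) I) - act (\<Gamma> c x h) (\<omega> c x (map (e x) I))))"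
  have ds: "((\<lambda>y. s y v) has_derivative (\<lambda>h. s x (\<Gamma> c x h *v v) + sc h v)) (at x)" for v
    using phi_pairing_has_derivative[where \<omega> = \<omega> and Y = "[v]" and p = 2 and act = act, OF x m d]
    unfolding s_def sc_def by simp
  have lh: "linear (\<lambda>u. \<phi> c y (u # ws))" if "y \<in> U" for y ws
    by (rule multilin_hd[OF alt_forms_multilin[OF phi_alt[OF that]]])
  have ls: "linear (s y)" if y: "y \<in> U" for y
    unfolding s_def
    by (auto simp: linear_iff linear_add[OF lh[OF y]] linear_cmul[OF lh[OF y]] scaleR_add_left sum.distrib scaleR_sum_right)
  define B where "B = (\<lambda>y u v. \<phi> c y (u # vs) *\<^sub>R s y v)"
  define B' where "B' = (\<lambda>u v h. \<phi> c x (u # vs) *\<^sub>R (s x (\<Gamma> c x h *v v) + sc h v)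
      + dirder (\<lambda>y. \<phi> c y (u # vs)) x h *\<^sub>R s x v)"
  have B: "bilinear (B y)" if y: "y \<in> U" for y
    using lh[OF y] ls[OF y] unfolding B_def bilinear_def by (auto simp: linear_iff algebra_simps)
  have dB: "((\<lambda>y. B y u v) has_derivative B' u v) (at x)" for u v
    unfolding B_def B'_def by (rule has_derivative_scaleR[OF phi_has_derivative[OF x] ds])
  have PiB: "Pi_can g \<phi> 2 \<omega> c y ws = (1/6) *\<^sub>R (\<Sum>k\<in>UNIV. \<phi> c y (e y k # ws) *\<^sub>R s y (e y k))" if "y \<in> U" for y ws
  proof -
    have "Pi_can g \<phi> 2 \<omega> c y ws = (\<Sum>I | length I = 2. \<Sum>k\<in>UNIV.
        (1/6) *\<^sub>R \<phi> c y (e y k # ws) *\<^sub>R \<phi> c y (e y k # map (e y) I) *\<^sub>R \<omega> c y (map (e y) I))"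
      by (simp add: Pi_can_kernel[OF that] pker_def scaleR_sum_left sum_divide_distrib mult_ac)
    also have "\<dots> = (\<Sum>k\<in>UNIV. \<Sum>I | length I = 2.
        (1/6) *\<^sub>R \<phi> c y (e y k # ws) *\<^sub>R \<phi> c y (e y k # map (e y) I) *\<^sub>R \<omega> c y (map (e y) I))" by (rule sum.swap)
    finally show ?thesis by (simp add: s_def scaleR_sum_right)
  qed
  have d6: "((\<lambda>y. (1/6) *\<^sub>R (\<Sum>k\<in>UNIV. B y (e y k) (e y k))) has_derivative
     (\<lambda>h. (1/6) *\<^sub>R (\<Sum>k\<in>UNIV. B' (e x k) (e x k) h - B x (\<Gamma> c x h *v e x k) (e x k) - B x (e x k) (\<Gamma> c x h *v e x k)))) (at x)"
    by (rule has_derivative_scaleR_right, rule contraction_has_derivative[where B = B and B' = B', OF x B dB])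
  have "((\<lambda>y. Pi_can g \<phi> 2 \<omega> c y vs) has_derivative
     (\<lambda>h. (1/6) *\<^sub>R (\<Sum>k\<in>UNIV. B' (e x k) (e x k) h - B x (\<Gamma> c x h *v e x k) (e x k) - B x (e x k) (\<Gamma> c x h *v e x k)))) (at x)"
    by (rule has_derivative_transform_within_open[OF d6 open_U x]) (simp add: PiB B_def)
  then show ?thesis
  proof (rule has_derivative_eq_rhs, intro ext)
    fix h
    let ?M = "\<Gamma> c x h"
    have t: "B' (e x k) (e x k) h - B x (?M *v e x k) (e x k) - B x (e x k) (?M *v e x k)
        = \<phi> c x (e x k # vs) *\<^sub>R sc h (e x k) + (\<Sum>l<length vs. \<phi> c x (e x k # vs[l := ?M *v (vs ! l)]) *\<^sub>R s x (e x k))" for k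
      unfolding B_def B'_def dirder_phi[OF x]
      by (simp add: sum.lessThan_Suc_shift scaleR_add_left scaleR_add_right scaleR_sum_left del: sum.lessThan_Suc)
    have sca: "(1/6) *\<^sub>R (\<Sum>k\<in>UNIV. \<phi> c x (e x k # vs) *\<^sub>R sc h (e x k))
        = (\<Sum>I | length I = 2. pker x 2 (map (e x) I) vs *\<^sub>R cov act \<Gamma> \<omega> c x h (map (e x) I))
          - act ?M (Pi_can g \<phi> 2 \<omega> c x vs)"
    proof -
      have "(1/6) *\<^sub>R (\<Sum>k\<in>UNIV. \<phi> c x (e x k # vs) *\<^sub>R sc h (e x k)) = (\<Sum>k\<in>UNIV. \<Sum>I | length I = 2.
          (\<phi> c x (e x k # map (e x) I) * \<phi> c x (e x k # vs) / 6) *\<^sub>R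
          (cov act \<Gamma> \<omega> c x h (map (e x) I) - act ?M (\<omega> c x (map (e x) I))))"
        by (simp add: sc_def scaleR_sum_right mult_ac)
      also have "\<dots> = (\<Sum>I | length I = 2. \<Sum>k\<in>UNIV.
          (\<phi> c x (e x k # map (e x) I) * \<phi> c x (e x k # vs) / 6) *\<^sub>R
          (cov act \<Gamma> \<omega> c x h (map (e x) I) - act ?M (\<omega> c x (map (e x) I))))" by (rule sum.swap)
      also have "\<dots> = (\<Sum>I | length I = 2. pker x 2 (map (e x) I) vs *\<^sub>R
          (cov act \<Gamma> \<omega> c x h (map (e x) I) - act ?M (\<omega> c x (map (e x) I))))"
        by (simp add: pker_def scaleR_sum_left sum_divide_distrib)
      finally show ?thesis
        by (simp add: Pi_can_kernel[OF x] act_sum_right act_scaleR_right scaleR_diff_right sum_subtractf)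
    qed
    have "(1/6) *\<^sub>R (\<Sum>k\<in>UNIV. \<Sum>l<length vs. \<phi> c x (e x k # vs[l := ?M *v (vs ! l)]) *\<^sub>R s x (e x k))
        = (\<Sum>l<length vs. Pi_can g \<phi> 2 \<omega> c x (vs[l := ?M *v (vs ! l)]))"
      unfolding PiB[OF x] by (subst sum.swap) (simp add: scaleR_sum_right)
    then show "(1/6) *\<^sub>R (\<Sum>k\<in>UNIV. B' (e x k) (e x k) h - B x (?M *v e x k) (e x k) - B x (e x k) (?M *v e x k))
      = (\<Sum>I | length I = 2. pker x 2 (map (e x) I) vs *\<^sub>R cov act \<Gamma> \<omega> c x h (map (e x) I))
       - act ?M (Pi_can g \<phi> 2 \<omega> c x vs) + (\<Sum>l<length vs. Pi_can g \<phi> 2 \<omega> c x (vs[l := ?M *v (vs ! l)]))"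
      unfolding t sum.distrib scaleR_add_right sca by simp
  qed
qed

lemma Pi_can_3_has_derivative:
  fixes \<omega> :: "('a, 'w::euclidean_space) field"
  assumes x: "x \<in> U" and m: "\<And>y. y \<in> U \<Longrightarrow> multilin (\<omega> c y)" and d: "\<And>ws. (\<lambda>y. \<omega> c y ws) differentiable (at x)"
    and act: "lie_action act"
  shows "((\<lambda>y. Pi_can g \<phi> 3 \<omega> c y vs) has_derivative
     (\<lambda>h. (\<Sum>I | length I = 3. pker x 3 (map (e x) I) vs *\<^sub>R cov act \<Gamma> \<omega> c x h (map (e x) I))
       - act (\<Gamma> c x h) (Pi_can g \<phi> 3 \<omega> c x vs)
       + (\<Sum>l<length vs. Pi_can g \<phi> 3 \<omega> c x (vs[l := \<Gamma> c x h *v (vs ! l)])))) (at x)"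
proof -
  interpret lie_action act by (rule act)
  define q where "q = (\<lambda>y. \<Sum>I | length I = 3. \<phi> c y (map (e y) I) *\<^sub>R \<omega> c y (map (e y) I))"
  define qc where "qc = (\<lambda>h. \<Sum>I | length I = 3. \<phi> c x (map (e x) I) *\<^sub>R
            (cov act \<Gamma> \<omega> c x h (map (e x) I) - act (\<Gamma> c x h) (\<omega> c x (map (e x) I))))"
  have dq: "(q has_derivative qc) (at x)"
    using phi_pairing_has_derivative[where \<omega> = \<omega> and Y = "[]" and p = 3 and act = act, OF x m d]
    unfolding q_def qc_def by simp
  have Piq: "Pi_can g \<phi> 3 \<omega> c y ws = (1/42) *\<^sub>R (\<phi> c y ws *\<^sub>R q y)" if "y \<in> U" for y ws
    by (simp add: Pi_can_kernel[OF that] pker_def q_def scaleR_sum_right mult_ac)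
  have d42: "((\<lambda>y. (1/42) *\<^sub>R (\<phi> c y vs *\<^sub>R q y)) has_derivative
      (\<lambda>h. (1/42) *\<^sub>R (\<phi> c x vs *\<^sub>R qc h + dirder (\<lambda>y. \<phi> c y vs) x h *\<^sub>R q x))) (at x)"
    by (rule has_derivative_scaleR_right, rule has_derivative_scaleR[OF phi_has_derivative[OF x] dq])
  have "((\<lambda>y. Pi_can g \<phi> 3 \<omega> c y vs) has_derivative
      (\<lambda>h. (1/42) *\<^sub>R (\<phi> c x vs *\<^sub>R qc h + dirder (\<lambda>y. \<phi> c y vs) x h *\<^sub>R q x))) (at x)"
    by (rule has_derivative_transform_within_open[OF d42 open_U x]) (simp add: Piq)
  then show ?thesis
  proof (rule has_derivative_eq_rhs, intro ext)
    fix h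
    let ?M = "\<Gamma> c x h"
    have "(1/42) *\<^sub>R (\<phi> c x vs *\<^sub>R qc h) = (\<Sum>I | length I = 3. pker x 3 (map (e x) I) vs *\<^sub>R
          (cov act \<Gamma> \<omega> c x h (map (e x) I) - act ?M (\<omega> c x (map (e x) I))))"
      by (simp add: qc_def pker_def scaleR_sum_right mult_ac)
    then have a: "(1/42) *\<^sub>R (\<phi> c x vs *\<^sub>R qc h)
        = (\<Sum>I | length I = 3. pker x 3 (map (e x) I) vs *\<^sub>R cov act \<Gamma> \<omega> c x h (map (e x) I))
          - act ?M (Pi_can g \<phi> 3 \<omega> c x vs)"
      by (simp add: Pi_can_kernel[OF x] act_sum_right act_scaleR_right scaleR_diff_right sum_subtractf)
    have b: "(1/42) *\<^sub>R (dirder (\<lambda>y. \<phi> c y vs) x h *\<^sub>R q x)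
        = (\<Sum>l<length vs. Pi_can g \<phi> 3 \<omega> c x (vs[l := ?M *v (vs ! l)]))"
      unfolding Piq[OF x] dirder_phi[OF x] by (simp add: scaleR_sum_left scaleR_sum_right)
    show "(1/42) *\<^sub>R (\<phi> c x vs *\<^sub>R qc h + dirder (\<lambda>y. \<phi> c y vs) x h *\<^sub>R q x)
      = (\<Sum>I | length I = 3. pker x 3 (map (e x) I) vs *\<^sub>R cov act \<Gamma> \<omega> c x h (map (e x) I))
       - act ?M (Pi_can g \<phi> 3 \<omega> c x vs) + (\<Sum>l<length vs. Pi_can g \<phi> 3 \<omega> c x (vs[l := ?M *v (vs ! l)]))"
      unfolding scaleR_add_right a b ..
  qed
qed

lemma Pi_can_has_derivative:
  fixes \<omega> :: "('a, 'w::euclidean_space) field"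
  assumes "x \<in> U" "\<And>y. y \<in> U \<Longrightarrow> multilin (\<omega> c y)" "\<And>ws. (\<lambda>y. \<omega> c y ws) differentiable (at x)"
    "lie_action act" and p: "p = 2 \<or> p = 3"
  shows "((\<lambda>y. Pi_can g \<phi> p \<omega> c y vs) has_derivative
     (\<lambda>h. (\<Sum>I | length I = p. pker x p (map (e x) I) vs *\<^sub>R cov act \<Gamma> \<omega> c x h (map (e x) I))
       - act (\<Gamma> c x h) (Pi_can g \<phi> p \<omega> c x vs)
       + (\<Sum>l<length vs. Pi_can g \<phi> p \<omega> c x (vs[l := \<Gamma> c x h *v (vs ! l)])))) (at x)"
  using Pi_can_2_has_derivative[where \<omega> = \<omega>, OF assms(1-4)]
    Pi_can_3_has_derivative[where \<omega> = \<omega>, OF assms(1-4)] p by auto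

lemma cov_Pi_can:
  fixes \<omega> :: "('a, 'w::euclidean_space) field"
  assumes "x \<in> U" "\<And>y. y \<in> U \<Longrightarrow> multilin (\<omega> c y)" "\<And>ws. (\<lambda>y. \<omega> c y ws) differentiable (at x)"
    "lie_action act" "p = 2 \<or> p = 3"
  shows "cov act \<Gamma> (Pi_can g \<phi> p \<omega>) c x u vs
    = (\<Sum>I | length I = p. pker x p (map (e x) I) vs *\<^sub>R cov act \<Gamma> \<omega> c x u (map (e x) I))"
proof -
  have "((\<lambda>y. Pi_can g \<phi> p \<omega> c y vs) has_derivative
     (\<lambda>h. (\<Sum>I | length I = p. pker x p (map (e x) I) vs *\<^sub>R cov act \<Gamma> \<omega> c x h (map (e x) I))
       - act (\<Gamma> c x h) (Pi_can g \<phi> p \<omega> c x vs)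
       + (\<Sum>l<length vs. Pi_can g \<phi> p \<omega> c x (vs[l := \<Gamma> c x h *v (vs ! l)])))) (at x)"
    by (rule Pi_can_has_derivative[where \<omega> = \<omega>]) (use assms in auto)
  from dirder_eq[OF this, of u] show ?thesis by (simp add: cov_def)
qed

text \<open>The projection acts on the form indices and the contraction in \<open>\<ell>\<close> on the values, so they commute once the
  covariant derivative passes through the projection.\<close>

lemma ell_Pi_can:
  assumes x: "x \<in> U" and m: "\<And>y. y \<in> U \<Longrightarrow> multilin (\<omega> c y)" and d: "\<And>ws. (\<lambda>y. \<omega> c y ws) differentiable (at x)"
    and p: "p = 2 \<or> p = 3"
  shows "ell g \<Gamma> (Pi_can g \<phi> p \<omega>) c x vs
    = (\<Sum>I | length I = p. pker x p (map (e x) I) vs *\<^sub>R ell g \<Gamma> \<omega> c x (map (e x) I))"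
proof -
  have dP: "(\<lambda>y. Pi_can g \<phi> p \<omega> c y vs) differentiable (at x)"
    using Pi_can_has_derivative[where \<omega> = \<omega>, OF x m d lie_action_End p] unfolding differentiable_def by blast
  have "ell g \<Gamma> (Pi_can g \<phi> p \<omega>) c x vs = (\<Sum>j\<in>UNIV. \<Sum>I | length I = p. pker x p (map (e x) I) vs *\<^sub>R
      codiff_term (g c x) (e x j) (cov act_End \<Gamma> \<omega> c x (e x j) (map (e x) I)))"
    unfolding ell_eq[where a = "Pi_can g \<phi> p \<omega>", OF x dP]
    by (simp add: cov_Pi_can[where \<omega> = \<omega>, OF x m d lie_action_End p] linear_sum[OF codiff_term_linear]
        linear_cmul[OF codiff_term_linear])
  also have "\<dots> = (\<Sum>I | length I = p. \<Sum>j\<in>UNIV. pker x p (map (e x) I) vs *\<^sub>R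
      codiff_term (g c x) (e x j) (cov act_End \<Gamma> \<omega> c x (e x j) (map (e x) I)))" by (rule sum.swap)
  finally show ?thesis by (simp add: ell_eq[where a = \<omega>, OF x d] scaleR_sum_right)
qed

end

section \<open>The null-homotopy\<close>

lemma trace_sum: "trace (\<Sum>i\<in>S. f i) = (\<Sum>i\<in>S. trace (f i))" for f :: "'i \<Rightarrow> real^7^7"
  by (induction S rule: infinite_finite_induct) (simp_all add: trace_def sum.distrib)

lemma trace_scaleR: "trace (r *\<^sub>R A) = r * trace A" for A :: "real^7^7"
  by (simp add: trace_def sum_distrib_left)

lemma eps_linear: "linear (eps :: 'w::real_vector \<Rightarrow> 'w \<times> 'w)"
  by (auto simp: linear_iff eps_def)

context levi_civita_chart
begin

lemma ext_cov_multilin: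
  assumes a: "smooth_field c U a" and x: "x \<in> U" and alt: "\<And>y. y \<in> U \<Longrightarrow> a c y \<in> alt_forms p"
    and act: "lie_action act"
  shows "multilin (ext_cov act \<Gamma> a c x)"
  unfolding multilin_def
proof (intro allI impI)
  fix vs :: "(real^7) list" and l assume l: "l < length vs"
  let ?C = "cov act \<Gamma> a c x"
  have d: "(\<lambda>y. a c y ws) differentiable (at x)" for ws by (rule smooth_field_differentiable[OF a x])
  have C: "?C u \<in> alt_forms p" for u by (rule cov_alt[where \<omega> = a, OF act x alt d])
  have lC: "linear (\<lambda>u. ?C u ws)" for ws
    by (rule cov_linear_direction[where \<omega> = a, OF act x alt_forms_multilin[OF alt[OF x]] d])
  have "linear (\<lambda>v. (-1) ^ i *\<^sub>R ?C (vs[l := v] ! i) (drop_nth i (vs[l := v])))" if i: "i < length vs" for i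
  proof (cases "i = l")
    case True
    then show ?thesis using lC[of "drop_nth l vs"] l
      by (simp add: drop_nth_update_same linear_iff algebra_simps)
  next
    case False
    then have "pos_after i l < length (drop_nth i vs)" using pos_after_less[OF i l] i by simp
    from multilinD[OF alt_forms_multilin[OF C[of "vs ! i"]] this]
    show ?thesis using False i l by (simp add: drop_nth_update linear_iff algebra_simps)
  qed
  then have "linear (\<lambda>v. \<Sum>i<length vs. (-1) ^ i *\<^sub>R ?C (vs[l := v] ! i) (drop_nth i (vs[l := v])))"
    by (intro linear_compose_sum) auto
  then show "linear (\<lambda>v. ext_cov act \<Gamma> a c x (vs[l := v]))"
    by (simp add: ext_cov_alternation[where \<omega> = a, OF x alt[OF x]])
qed

lemma ext_cov_alt_0:
  assumes x: "x \<in> U" and alt: "\<And>y. y \<in> U \<Longrightarrow> \<omega> c y \<in> alt_forms 0"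
    and d: "\<And>ws. (\<lambda>y. \<omega> c y ws) differentiable (at x)" and act: "lie_action act"
  shows "ext_cov act \<Gamma> \<omega> c x \<in> alt_forms 1"
proof -
  have C: "cov act \<Gamma> \<omega> c x u \<in> alt_forms 0" for u by (rule cov_alt[where \<omega> = \<omega>, OF act x alt d])
  have ex: "ext_cov act \<Gamma> \<omega> c x vs = (\<Sum>i<length vs. (-1) ^ i *\<^sub>R cov act \<Gamma> \<omega> c x (vs ! i) (drop_nth i vs))" for vs
    by (rule ext_cov_alternation[where \<omega> = \<omega>, OF x alt[OF x]])
  have lC: "linear (\<lambda>u. cov act \<Gamma> \<omega> c x u ws)" for ws
    by (rule cov_linear_direction[where \<omega> = \<omega>, OF act x alt_forms_multilin[OF alt[OF x]] d])
  have z: "ext_cov act \<Gamma> \<omega> c x vs = 0" if "length vs \<noteq> 1" for vs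
    unfolding ex using that by (intro sum.neutral) (auto intro!: alt_forms_len[OF C] simp: drop_nth_def)
  have one: "ext_cov act \<Gamma> \<omega> c x [v] = cov act \<Gamma> \<omega> c x v []" for v
    by (simp add: ex drop_nth_def)
  show ?thesis
  proof (rule alt_formsI)
    show "multilin (ext_cov act \<Gamma> \<omega> c x)"
      unfolding multilin_def
    proof (intro allI impI)
      fix vs :: "(real^7) list" and l assume l: "l < length vs"
      show "linear (\<lambda>v. ext_cov act \<Gamma> \<omega> c x (vs[l := v]))"
      proof (cases "length vs = 1")
        case True
        then obtain w where "vs = [w]" by (auto simp: length_Suc_conv)
        then show ?thesis using l lC by (simp add: one)
      qed (simp add: z linear_iff)
    qed
  qed (auto simp: z)
qed

lemma ell_cong:
  assumes x: "x \<in> U" and eq: "\<And>y vs. y \<in> U \<Longrightarrow> a c y vs = b c y vs"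
  shows "ell g \<Gamma> a c x vs = ell g \<Gamma> b c x vs"
proof -
  have s: "skew_part g a c y ws = skew_part g b c y ws" if "y \<in> U" for y ws
    by (simp add: skew_part_def eq[OF that])
  have "dirder (\<lambda>y. skew_part g a c y ws) x u = dirder (\<lambda>y. skew_part g b c y ws) x u" for ws u
    using frechet_derivative_cong_open[OF open_U x s] by simp
  then show ?thesis by (simp add: ell_def cov_def s[OF x])
qed

end

context G2_chart
begin

text \<open>The part of the commutator in which the curvature acts on the form indices.\<close>

definition form_defect :: "('a, real^7^7) field \<Rightarrow> real^7 \<Rightarrow> (real^7) list \<Rightarrow> real^7" where
  "form_defect a x vs = - (\<Sum>i<length vs. (-1) ^ i *\<^sub>R (\<Sum>j\<in>UNIV. codiff_term (g c x) (e x j)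
     (\<Sum>l<length vs - 1. a c x ((drop_nth i vs)[l := R x (vs ! i) (e x j) *v (drop_nth i vs ! l)]))))"

text \<open>The curvature acts on the values, which gives the coupling, and on the form indices.\<close>

lemma commutator_coupling:
  assumes a: "smooth_field c U a" and x: "x \<in> U" and alt: "\<And>y. y \<in> U \<Longrightarrow> a c y \<in> alt_forms p"
  shows "ext_cov act_cot \<Gamma> (ell g \<Gamma> a) c x vs - ell g \<Gamma> (ext_cov act_End \<Gamma> a) c x vs
    = snd (frakb \<Gamma> a c x vs) + form_defect a x vs"
proof -
  let ?G = "g c x"
  have E: "(\<Sum>j\<in>UNIV. codiff_term ?G (e x j) (act_End (R x v (e x j)) S))
      = (\<chi> i. - (1/4) * trace (R x (axis i 1) v ** S))" for v S
  proof (subst vec_eq_iff, rule allI)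
    fix i
    show "(\<Sum>j\<in>UNIV. codiff_term ?G (e x j) (act_End (R x v (e x j)) S)) $ i
        = (\<chi> i. - (1/4) * trace (R x (axis i 1) v ** S)) $ i"
      using codiff_curvature_End[OF x ricci_flat[OF x], of v S "axis i 1"] by (simp add: inner_axis)
  qed
  define \<beta> where "\<beta> = (\<lambda>i. \<chi> k. - (1/4) * trace (R x (axis k 1) (vs ! i) ** a c x (drop_nth i vs)))"
  define \<delta> where "\<delta> = (\<lambda>i. \<Sum>j\<in>UNIV. codiff_term ?G (e x j)
     (\<Sum>l<length vs - 1. a c x ((drop_nth i vs)[l := R x (vs ! i) (e x j) *v (drop_nth i vs ! l)])))"
  have s: "(\<Sum>j\<in>UNIV. codiff_term ?G (e x j) (tact act_End (R x (vs ! i) (e x j)) (a c x) (drop_nth i vs)))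
      = \<beta> i - \<delta> i" if "i < length vs" for i
    using that by (simp add: tact_def linear_diff[OF codiff_term_linear] sum_subtractf E \<beta>_def \<delta>_def)
  have "ext_cov act_cot \<Gamma> (ell g \<Gamma> a) c x vs - ell g \<Gamma> (ext_cov act_End \<Gamma> a) c x vs
    = (\<Sum>i<length vs. (-1) ^ i *\<^sub>R (\<beta> i - \<delta> i))"
    by (subst ell_ext_cov_commutator[where a = a, OF a x])
      (erule alt, intro sum.cong refl, simp only: s lessThan_iff)
  also have "\<dots> = (\<Sum>i<length vs. (-1) ^ i *\<^sub>R \<beta> i) + form_defect a x vs"
    by (simp only: scaleR_diff_right sum_subtractf)
      (simp only: form_defect_def \<delta>_def diff_conv_add_uminus)
  also have "(\<Sum>i<length vs. (-1) ^ i *\<^sub>R \<beta> i) = snd (frakb \<Gamma> a c x vs)"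
    by (simp add: \<beta>_def vec_eq_iff frakb_def eps_def wedge1_def trace_sum trace_scaleR sum_distrib_left mult_ac)
  finally show ?thesis .
qed

lemma phi_curv_linear:
  fixes L :: "real^7^7 \<Rightarrow> real^7"
  assumes x: "x \<in> U" and L: "linear L"
  shows "(\<Sum>i\<in>UNIV. \<Sum>k\<in>UNIV. \<phi> c x [e x i, e x k, y] *\<^sub>R L (R x (e x i) (e x k))) = 0"
proof -
  let ?S = "\<Sum>i\<in>UNIV. \<Sum>k\<in>UNIV. \<phi> c x [e x i, e x k, y] *\<^sub>R R x (e x i) (e x k)"
  have lz: "linear (\<lambda>M :: real^7^7. M *v z)" for z
    by (simp add: linear_iff mat_vec_simps)
  have "?S *v z = 0 *v z" for z
    using phi_curv_form[OF x, of y z] by (simp add: linear_sum[OF lz] linear_cmul[OF lz])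
  then have "?S = 0" unfolding matrix_eq by blast
  then have "L ?S = 0" by (simp add: linear_0[OF L])
  then show ?thesis by (simp add: linear_sum[OF L] linear_cmul[OF L])
qed

lemma bianchi_diff:
  "x \<in> U \<Longrightarrow> R x v0 w *v v1 - R x v1 w *v v0 = R x v0 v1 *v w"
  using bianchi[of x v0 w v1] curv_antisym[of x v1 w] curv_antisym[of x v0 v1]
  by (simp add: matrix_vector_uminus_left eq_neg_iff_add_eq_0[symmetric] algebra_simps)

text \<open>In degree two the Bianchi identity turns the defect into a contraction with the curvature two-form,
  which is orthogonal to \<open>\<Lambda>\<^sup>2\<^sub>7\<close>.\<close>

lemma form_defect_2:
  assumes x: "x \<in> U" and alt: "a c x \<in> alt_forms 1"
  shows "(\<Sum>I | length I = 2. \<phi> c x (y # map (e x) I) *\<^sub>R form_defect a x (map (e x) I)) = 0"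
proof -
  let ?G = "g c x"
  have la: "linear (\<lambda>v. a c x [v])" by (rule multilin_hd[OF alt_forms_multilin[OF alt]])
  define L where "L = (\<lambda>M :: real^7^7. \<Sum>j\<in>UNIV. codiff_term ?G (e x j) (a c x [M *v e x j]))"
  have L: "linear L"
    by (simp add: L_def linear_iff mat_vec_simps linear_add[OF la] linear_cmul[OF la]
        linear_add[OF codiff_term_linear] linear_cmul[OF codiff_term_linear] sum.distrib scaleR_sum_right)
  have F: "form_defect a x [v0, v1] = - L (R x v0 v1)" for v0 v1
  proof -
    have "form_defect a x [v0, v1] = - ((\<Sum>j\<in>UNIV. codiff_term ?G (e x j) (a c x [R x v0 (e x j) *v v1]))
        - (\<Sum>j\<in>UNIV. codiff_term ?G (e x j) (a c x [R x v1 (e x j) *v v0])))"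
      by (simp add: form_defect_def drop_nth_def)
    also have "\<dots> = - L (R x v0 v1)"
      by (simp only: L_def bianchi_diff[OF x, of v0 "e x _" v1, symmetric]
          linear_diff[OF la] linear_diff[OF codiff_term_linear] sum_subtractf)
    finally show ?thesis .
  qed
  have "(\<Sum>I | length I = 2. \<phi> c x (y # map (e x) I) *\<^sub>R form_defect a x (map (e x) I))
      = (\<Sum>i\<in>UNIV. \<Sum>k\<in>UNIV. \<phi> c x [y, e x i, e x k] *\<^sub>R form_defect a x [e x i, e x k])"
    unfolding numeral_2_eq_2 sum_lists_Suc by simp
  also have "\<dots> = - (\<Sum>i\<in>UNIV. \<Sum>k\<in>UNIV. \<phi> c x [e x i, e x k, y] *\<^sub>R L (R x (e x i) (e x k)))"
    by (simp only: F phi_cyc[OF x, of y] scaleR_minus_right sum_negf)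
  also have "\<dots> = 0" by (simp only: phi_curv_linear[OF x L] minus_zero)
  finally show ?thesis .
qed

text \<open>In degree three the Bianchi identity leaves, for each pair of the three arguments, one term with the curvature
  in this pair. The three terms vanish separately after contraction with \<open>\<phi>\<close>.\<close>

lemma form_defect_3:
  assumes x: "x \<in> U" and alt: "a c x \<in> alt_forms 2"
  shows "(\<Sum>I | length I = 3. \<phi> c x (map (e x) I) *\<^sub>R form_defect a x (map (e x) I)) = 0"
proof -
  let ?G = "g c x"
  have la: "linear (\<lambda>v. a c x [v, w])" "linear (\<lambda>v. a c x [w, v])" for w
    using multilinD[OF alt_forms_multilin[OF alt], of 0 "[0, w]"] multilinD[OF alt_forms_multilin[OF alt], of 1 "[w, 0]"]
    by simp_all
  define L where "L = (\<lambda>w M. \<Sum>j\<in>UNIV. codiff_term ?G (e x j) (a c x [M *v e x j, w]))"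
  define L' where "L' = (\<lambda>w M. \<Sum>j\<in>UNIV. codiff_term ?G (e x j) (a c x [w, M *v e x j]))"
  have L: "linear (L w)" for w
    by (simp add: L_def linear_iff mat_vec_simps linear_add[OF la(1)] linear_cmul[OF la(1)]
        linear_add[OF codiff_term_linear] linear_cmul[OF codiff_term_linear] sum.distrib scaleR_sum_right)
  have L': "linear (L' w)" for w
    by (simp add: L'_def linear_iff mat_vec_simps linear_add[OF la(2)] linear_cmul[OF la(2)]
        linear_add[OF codiff_term_linear] linear_cmul[OF codiff_term_linear] sum.distrib scaleR_sum_right)
  have sw: "a c x [v, w] = - a c x [w, v]" for v w
    using alt_forms_update_swap[OF alt, of 0 "[v, w]" 1 v w] by simp
  have F: "form_defect a x [v0, v1, v2] = - (L v2 (R x v0 v1) + L' v1 (R x v0 v2) - L' v0 (R x v1 v2))" for v0 v1 v2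
  proof -
    let ?t = "\<lambda>v w j. R x v (e x j) *v w"
    have "form_defect a x [v0, v1, v2] = - (\<Sum>j\<in>UNIV. codiff_term ?G (e x j)
        ((a c x [?t v0 v1 j, v2] + a c x [v1, ?t v0 v2 j]) - (a c x [?t v1 v0 j, v2] + a c x [v0, ?t v1 v2 j])
         + (a c x [?t v2 v0 j, v1] + a c x [v0, ?t v2 v1 j])))"
      by (simp add: form_defect_def drop_nth_def linear_diff[OF codiff_term_linear]
          linear_add[OF codiff_term_linear] sum_subtractf sum.distrib algebra_simps numeral_2_eq_2)
    also have "\<dots> = - (\<Sum>j\<in>UNIV. codiff_term ?G (e x j)
        (a c x [R x v0 v1 *v e x j, v2] + a c x [v1, R x v0 v2 *v e x j] - a c x [v0, R x v1 v2 *v e x j]))"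
    proof (intro arg_cong[where f = uminus] sum.cong refl arg_cong[where f = "codiff_term _ _"])
      fix j
      show "(a c x [?t v0 v1 j, v2] + a c x [v1, ?t v0 v2 j]) - (a c x [?t v1 v0 j, v2] + a c x [v0, ?t v1 v2 j])
         + (a c x [?t v2 v0 j, v1] + a c x [v0, ?t v2 v1 j])
        = a c x [R x v0 v1 *v e x j, v2] + a c x [v1, R x v0 v2 *v e x j] - a c x [v0, R x v1 v2 *v e x j]"
        unfolding bianchi_diff[OF x, of v0 "e x j" v1, symmetric] bianchi_diff[OF x, of v0 "e x j" v2, symmetric]
          bianchi_diff[OF x, of v1 "e x j" v2, symmetric] sw[of "?t v2 v0 j" v1]
        by (simp only: linear_diff[OF la(1)] linear_diff[OF la(2)]) (simp add: algebra_simps)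
    qed
    also have "\<dots> = - (L v2 (R x v0 v1) + L' v1 (R x v0 v2) - L' v0 (R x v1 v2))"
      by (simp only: L_def L'_def linear_diff[OF codiff_term_linear] linear_add[OF codiff_term_linear]
          sum_subtractf sum.distrib)
    finally show ?thesis .
  qed
  have s1: "(\<Sum>i\<in>UNIV. \<Sum>k\<in>UNIV. \<Sum>l\<in>UNIV. \<phi> c x [e x i, e x k, e x l] *\<^sub>R L (e x l) (R x (e x i) (e x k))) = 0"
  proof -
    have "(\<Sum>i\<in>UNIV. \<Sum>k\<in>UNIV. \<Sum>l\<in>UNIV. \<phi> c x [e x i, e x k, e x l] *\<^sub>R L (e x l) (R x (e x i) (e x k)))
      = (\<Sum>i\<in>UNIV. \<Sum>l\<in>UNIV. \<Sum>k\<in>UNIV. \<phi> c x [e x i, e x k, e x l] *\<^sub>R L (e x l) (R x (e x i) (e x k)))"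
      by (intro sum.cong refl sum.swap)
    also have "\<dots> = (\<Sum>l\<in>UNIV. \<Sum>i\<in>UNIV. \<Sum>k\<in>UNIV. \<phi> c x [e x i, e x k, e x l] *\<^sub>R L (e x l) (R x (e x i) (e x k)))"
      by (rule sum.swap)
    finally show ?thesis by (simp add: phi_curv_linear[OF x L])
  qed
  have s2: "(\<Sum>i\<in>UNIV. \<Sum>k\<in>UNIV. \<Sum>l\<in>UNIV. \<phi> c x [e x i, e x k, e x l] *\<^sub>R L' (e x k) (R x (e x i) (e x l))) = 0"
  proof -
    have "(\<Sum>i\<in>UNIV. \<Sum>k\<in>UNIV. \<Sum>l\<in>UNIV. \<phi> c x [e x i, e x k, e x l] *\<^sub>R L' (e x k) (R x (e x i) (e x l)))
      = (\<Sum>k\<in>UNIV. \<Sum>i\<in>UNIV. \<Sum>l\<in>UNIV. \<phi> c x [e x i, e x k, e x l] *\<^sub>R L' (e x k) (R x (e x i) (e x l)))"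
      by (rule sum.swap)
    also have "\<dots> = (\<Sum>k\<in>UNIV. - (\<Sum>i\<in>UNIV. \<Sum>l\<in>UNIV. \<phi> c x [e x i, e x l, e x k] *\<^sub>R L' (e x k) (R x (e x i) (e x l))))"
    proof (rule sum.cong[OF refl])
      fix k
      have "\<phi> c x [e x i, e x k, e x l] = - \<phi> c x [e x i, e x l, e x k]" for i l by (rule phi_swap(2)[OF x])
      then show "(\<Sum>i\<in>UNIV. \<Sum>l\<in>UNIV. \<phi> c x [e x i, e x k, e x l] *\<^sub>R L' (e x k) (R x (e x i) (e x l)))
        = - (\<Sum>i\<in>UNIV. \<Sum>l\<in>UNIV. \<phi> c x [e x i, e x l, e x k] *\<^sub>R L' (e x k) (R x (e x i) (e x l)))"
        by (simp only: sum_negf scaleR_minus_left)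
    qed
    finally show ?thesis by (simp add: phi_curv_linear[OF x L'])
  qed
  have s3: "(\<Sum>i\<in>UNIV. \<Sum>k\<in>UNIV. \<Sum>l\<in>UNIV. \<phi> c x [e x i, e x k, e x l] *\<^sub>R L' (e x i) (R x (e x k) (e x l))) = 0"
  proof -
    have "(\<Sum>i\<in>UNIV. \<Sum>k\<in>UNIV. \<Sum>l\<in>UNIV. \<phi> c x [e x i, e x k, e x l] *\<^sub>R L' (e x i) (R x (e x k) (e x l)))
      = (\<Sum>i\<in>UNIV. \<Sum>k\<in>UNIV. \<Sum>l\<in>UNIV. \<phi> c x [e x k, e x l, e x i] *\<^sub>R L' (e x i) (R x (e x k) (e x l)))"
      by (intro sum.cong refl) (subst phi_cyc[OF x], rule refl)
    then show ?thesis by (simp only: phi_curv_linear[OF x L'] sum.neutral_const)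
  qed
  have "(\<Sum>I | length I = 3. \<phi> c x (map (e x) I) *\<^sub>R form_defect a x (map (e x) I))
      = (\<Sum>i\<in>UNIV. \<Sum>k\<in>UNIV. \<Sum>l\<in>UNIV. \<phi> c x [e x i, e x k, e x l] *\<^sub>R form_defect a x [e x i, e x k, e x l])"
    unfolding numeral_3_eq_3 sum_lists_Suc by simp
  also have "\<dots> = 0"
    by (simp only: F scaleR_minus_right scaleR_add_right scaleR_diff_right sum.distrib sum_subtractf sum_negf s1 s2 s3) simp
  finally show ?thesis .
qed

lemma form_defect_projection:
  assumes x: "x \<in> U" and alt: "a c x \<in> alt_forms p" and p: "p = 1 \<or> p = 2"
  shows "(\<Sum>I | length I = p + 1. pker x (p + 1) (map (e x) I) vs *\<^sub>R form_defect a x (map (e x) I)) = 0"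
proof (cases "p = 1")
  case True
  have "(\<Sum>I | length I = 2. pker x 2 (map (e x) I) vs *\<^sub>R form_defect a x (map (e x) I))
      = (\<Sum>I | length I = 2. \<Sum>k\<in>UNIV. (\<phi> c x (e x k # vs) / 6) *\<^sub>R
          \<phi> c x (e x k # map (e x) I) *\<^sub>R form_defect a x (map (e x) I))"
    by (simp add: pker_def scaleR_sum_left sum_divide_distrib mult_ac)
  also have "\<dots> = (\<Sum>k\<in>UNIV. \<Sum>I | length I = 2. (\<phi> c x (e x k # vs) / 6) *\<^sub>R
          \<phi> c x (e x k # map (e x) I) *\<^sub>R form_defect a x (map (e x) I))"
    by (rule sum.swap)
  also have "\<dots> = (\<Sum>k\<in>UNIV. (\<phi> c x (e x k # vs) / 6) *\<^sub>R (\<Sum>I | length I = 2.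
          \<phi> c x (e x k # map (e x) I) *\<^sub>R form_defect a x (map (e x) I)))"
    by (simp only: scaleR_sum_right)
  also have "\<dots> = 0" using alt True by (simp only: form_defect_2[OF x]) simp
  finally show ?thesis using True by (simp add: numeral_2_eq_2)
next
  case False
  then have p2: "p = 2" using p by simp
  have "(\<Sum>I | length I = 3. pker x 3 (map (e x) I) vs *\<^sub>R form_defect a x (map (e x) I))
      = (\<phi> c x vs / 42) *\<^sub>R (\<Sum>I | length I = 3. \<phi> c x (map (e x) I) *\<^sub>R form_defect a x (map (e x) I))"
    by (simp add: pker_def scaleR_sum_right mult_ac)
  also have "\<dots> = 0" using alt p2 by (simp add: form_defect_3[OF x])
  finally show ?thesis using p2 by (simp add: numeral_3_eq_3)
qed

lemma homotopy_degree_1_2: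
  assumes a: "smooth_field c U a" and alt: "\<And>y. y \<in> U \<Longrightarrow> a c y \<in> alt_forms p" and p: "p = 1 \<or> p = 2" and x: "x \<in> U"
  shows "b_map g \<phi> \<Gamma> p a c x vs
      = d_G1 g \<phi> \<Gamma> p (L_E g \<Gamma> a) c x vs - L_E g \<Gamma> (d_E g \<phi> \<Gamma> p a) c x vs"
proof -
  have p1: "p + 1 = 2 \<or> p + 1 = 3" using p by auto
  let ?K = "\<lambda>I. pker x (p + 1) (map (e x) I) vs" and ?I = "\<lambda>I. map (e x) I"
  have fb: "frakb \<Gamma> a c x us = eps (snd (frakb \<Gamma> a c x us))" for us by (simp add: frakb_def eps_def)
  have "b_map g \<phi> \<Gamma> p a c x vs = (\<Sum>I | length I = p + 1. ?K I *\<^sub>R frakb \<Gamma> a c x (?I I))"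
    unfolding b_map_def by (rule Pi_can_kernel[OF x p1])
  also have "\<dots> = (\<Sum>I | length I = p + 1. ?K I *\<^sub>R eps (snd (frakb \<Gamma> a c x (?I I))))"
    by (subst fb) (rule refl)
  also have "\<dots> = eps (\<Sum>I | length I = p + 1. ?K I *\<^sub>R snd (frakb \<Gamma> a c x (?I I)))"
    by (simp add: linear_sum[OF eps_linear] linear_cmul[OF eps_linear])
  finally have b: "b_map g \<phi> \<Gamma> p a c x vs = eps (\<Sum>I | length I = p + 1. ?K I *\<^sub>R snd (frakb \<Gamma> a c x (?I I)))" .
  have "d_G1 g \<phi> \<Gamma> p (L_E g \<Gamma> a) c x vs = eps (Pi_can g \<phi> (p + 1) (ext_cov act_cot \<Gamma> (ell g \<Gamma> a)) c x vs)"
    by (simp add: d_G1_def d_G_def L_E_def eps_def)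
  then have d: "d_G1 g \<phi> \<Gamma> p (L_E g \<Gamma> a) c x vs
      = eps (\<Sum>I | length I = p + 1. ?K I *\<^sub>R ext_cov act_cot \<Gamma> (ell g \<Gamma> a) c x (?I I))"
    by (simp only: Pi_can_kernel[OF x p1])
  have l: "L_E g \<Gamma> (d_E g \<phi> \<Gamma> p a) c x vs
      = eps (\<Sum>I | length I = p + 1. ?K I *\<^sub>R ell g \<Gamma> (ext_cov act_End \<Gamma> a) c x (?I I))"
    unfolding L_E_def d_E_def
    by (subst ell_Pi_can[where \<omega> = "ext_cov act_End \<Gamma> a", OF x _ _ p1])
      (use ext_cov_multilin[where a = a, OF a _ alt lie_action_End]
         ext_cov_differentiable[where a = a, OF a x alt lie_action_End] in auto)
  have comm: "ext_cov act_cot \<Gamma> (ell g \<Gamma> a) c x us - ell g \<Gamma> (ext_cov act_End \<Gamma> a) c x us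
      = snd (frakb \<Gamma> a c x us) + form_defect a x us" for us
    by (rule commutator_coupling[where a = a, OF a x alt])
  have "(\<Sum>I | length I = p + 1. ?K I *\<^sub>R ext_cov act_cot \<Gamma> (ell g \<Gamma> a) c x (?I I))
      - (\<Sum>I | length I = p + 1. ?K I *\<^sub>R ell g \<Gamma> (ext_cov act_End \<Gamma> a) c x (?I I))
      = (\<Sum>I | length I = p + 1. ?K I *\<^sub>R (snd (frakb \<Gamma> a c x (?I I)) + form_defect a x (?I I)))"
    unfolding sum_subtractf[symmetric] scaleR_diff_right[symmetric] comm ..
  also have "\<dots> = (\<Sum>I | length I = p + 1. ?K I *\<^sub>R snd (frakb \<Gamma> a c x (?I I)))"
    using form_defect_projection[where a = a, OF x alt[OF x] p, of vs]
    by (simp only: scaleR_add_right sum.distrib add_0_right)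
  finally show ?thesis
    unfolding b d l by (simp add: linear_diff[OF eps_linear, symmetric])
qed

text \<open>On one-forms the projection is the identity, and a zero-form has no form indices for the curvature to act on.\<close>

lemma homotopy_degree_0:
  assumes a: "smooth_field c U a" and alt: "\<And>y. y \<in> U \<Longrightarrow> a c y \<in> alt_forms 0" and x: "x \<in> U"
  shows "b_map g \<phi> \<Gamma> 0 a c x vs
      = d_G1 g \<phi> \<Gamma> 0 (L_E g \<Gamma> a) c x vs - L_E g \<Gamma> (d_E g \<phi> \<Gamma> 0 a) c x vs"
proof -
  have da: "(\<lambda>z. a c z ws) differentiable (at y)" if "y \<in> U" for y ws
    by (rule smooth_field_differentiable[OF a that])
  have ext1: "ext_cov act_End \<Gamma> a c y \<in> alt_forms 1" if "y \<in> U" for y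
    by (rule ext_cov_alt_0[where \<omega> = a, OF that alt da[OF that] lie_action_End])
  have dext: "(\<lambda>y. ext_cov act_End \<Gamma> a c y ws) differentiable (at x)" for ws
    by (rule ext_cov_differentiable[where a = a, OF a x alt lie_action_End])
  have ell0: "ell g \<Gamma> a c y \<in> alt_forms 0" if "y \<in> U" for y
    by (rule ell_alt[where a = a, OF that alt da[OF that]])
  have del: "(\<lambda>y. ell g \<Gamma> a c y ws) differentiable (at x)" for ws by (rule ell_differentiable[OF a x])
  have A1: "ext_cov act_cot \<Gamma> (ell g \<Gamma> a) c x \<in> alt_forms 1"
    by (rule ext_cov_alt_0[where \<omega> = "ell g \<Gamma> a", OF x ell0 del lie_action_cot])
  have A2: "ell g \<Gamma> (ext_cov act_End \<Gamma> a) c x \<in> alt_forms 1"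
    by (rule ell_alt[where a = "ext_cov act_End \<Gamma> a", OF x ext1 dext])
  have "form_defect a x us = 0" for us
  proof -
    have "(\<Sum>l<length us - 1. a c x ((drop_nth i us)[l := w l])) = 0" if "i < length us" for i w
      using that by (intro sum.neutral ballI alt_forms_len[OF alt[OF x]]) auto
    then show ?thesis by (simp add: form_defect_def linear_0[OF codiff_term_linear])
  qed
  then have fb: "frakb \<Gamma> a c x us = eps (ext_cov act_cot \<Gamma> (ell g \<Gamma> a) c x us - ell g \<Gamma> (ext_cov act_End \<Gamma> a) c x us)" for us
    using commutator_coupling[where a = a, OF a x alt, of us] by (simp add: frakb_def eps_def)
  have fb1: "frakb \<Gamma> a c x \<in> alt_forms 1"
    using alt_forms_compose_linear[OF alt_forms_diff[OF A1 A2] eps_linear] by (simp add: fb[symmetric])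
  have b: "b_map g \<phi> \<Gamma> 0 a c x vs = frakb \<Gamma> a c x vs"
    using Pi_can_1[where \<omega> = "frakb \<Gamma> a", OF x fb1] by (simp add: b_map_def)
  have d: "d_G1 g \<phi> \<Gamma> 0 (L_E g \<Gamma> a) c x vs = eps (ext_cov act_cot \<Gamma> (ell g \<Gamma> a) c x vs)"
    using Pi_can_1[where \<omega> = "ext_cov act_cot \<Gamma> (ell g \<Gamma> a)", OF x A1]
    by (simp add: d_G1_def d_G_def L_E_def eps_def)
  have "d_E g \<phi> \<Gamma> 0 a c y us = ext_cov act_End \<Gamma> a c y us" if "y \<in> U" for y us
    using Pi_can_1[where \<omega> = "ext_cov act_End \<Gamma> a", OF that ext1[OF that]] by (simp add: d_E_def)
  then have l: "L_E g \<Gamma> (d_E g \<phi> \<Gamma> 0 a) c x vs = eps (ell g \<Gamma> (ext_cov act_End \<Gamma> a) c x vs)"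
    unfolding L_E_def by (subst ell_cong[OF x]) auto
  show ?thesis unfolding b d l fb by (rule linear_diff[OF eps_linear])
qed

end

lemma homotopy_degree_3:
  "b_map g \<phi> \<Gamma> 3 a c x vs = d_G1 g \<phi> \<Gamma> 3 (L_E g \<Gamma> a) c x vs - L_E g \<Gamma> (d_E g \<phi> \<Gamma> 3 a) c x vs"
proof -
  have "d_E g \<phi> \<Gamma> 3 a = (\<lambda>c x vs. 0)" by (intro ext) (simp add: d_E_def Pi_can_ge4)
  moreover have "skew_part g (\<lambda>c x vs. 0) = (\<lambda>c x vs. 0)"
    by (intro ext) (simp add: skew_part_def bil_def vec_eq_iff)
  ultimately show ?thesis
    by (simp add: b_map_def d_G1_def d_G_def Pi_can_ge4 L_E_def eps_def ell_def cov_def act_bil_def bil_def vec_eq_iff zero_prod_def)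
qed

theorem proposition5p1:
  fixes A :: "'a::{t2_space,second_countable_topology} chart set"
    and \<phi> :: "('a, real) field"
    and g :: "'a chart \<Rightarrow> real^7 \<Rightarrow> real^7^7"
    and ori :: "'a chart \<Rightarrow> real^7 \<Rightarrow> real"
    and \<Gamma> :: "'a conn"
    and k :: nat
    and a :: "('a, real^7^7) field"
  assumes "smooth_atlas A"
    and "G2_structure A \<phi> g ori"
    and "torsion_free A \<phi> g ori"
    and "levi_civita A g \<Gamma>"
    and "k \<in> {0, 1, 2, 3}"
    and "a \<in> E_cx A \<phi> k"
  shows "\<forall>c\<in>A. \<forall>x\<in>chart_im c. \<forall>vs.
    b_map g \<phi> \<Gamma> k a c x vs
      = d_G1 g \<phi> \<Gamma> k (L_E g \<Gamma> a) c x vs - L_E g \<Gamma> (d_E g \<phi> \<Gamma> k a) c x vs"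
proof (intro ballI allI)
  fix c x vs assume c: "c \<in> A" and x: "x \<in> chart_im c"
  let ?U = "chart_im c"
  have op: "open ?U" using assms(1) c by (auto simp: smooth_atlas_def)
  have met: "riemannian_metric A g" and ori: "orientation A ori" and \<phi>f: "\<phi> \<in> forms A chg_triv 3"
    using assms(2) by (auto simp: G2_structure_def)
  have \<phi>alt: "\<phi> c y \<in> alt_forms 3" if "y \<in> ?U" for y using \<phi>f c that by (auto simp: forms_def)
  have \<phi>sm: "smooth_field c ?U \<phi>"
    using \<phi>f c alt_forms_multilin[OF \<phi>alt] by (auto simp: forms_def smooth_field_def)
  have cof: "\<exists>N \<theta>. open N \<and> y \<in> N \<and> N \<subseteq> ?U \<and> smooth_on N \<theta> \<and>
        (\<forall>y\<in>N. ori c y * det (\<theta> y) > 0 \<and>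
           (\<forall>u v. bil (g c y) u v = (\<theta> y *v u) \<bullet> (\<theta> y *v v)) \<and>
           (\<forall>u v w. \<phi> c y [u, v, w] = phi0 (\<theta> y *v u) (\<theta> y *v v) (\<theta> y *v w)))" if "y \<in> ?U" for y
    using assms(2) c that unfolding G2_structure_def by blast
  have lc: "levi_civita A g \<Gamma>" by (rule assms(4))
  interpret levi_civita_chart c ?U \<Gamma> g
  proof (intro levi_civita_chart.intro torsion_free_chart.intro levi_civita_chart_axioms.intro)
    show "open ?U" by (rule op)
    show "smooth_on ?U (\<lambda>y. \<Gamma> c y u)" for u using lc c by (auto simp: levi_civita_def connection_def)
    show "smooth_on ?U (g c)" using met c by (auto simp: riemannian_metric_def)
    fix y assume y: "y \<in> ?U"
    show "linear (\<Gamma> c y)" using lc c y by (auto simp: levi_civita_def connection_def)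
    show "\<Gamma> c y u *v v = \<Gamma> c y v *v u" for u v using lc c y unfolding levi_civita_def by blast
    show "bil (g c y) v w = bil (g c y) w v" for v w using met c y unfolding riemannian_metric_def by blast
    show "dirder (g c) y u + act_bil (\<Gamma> c y u) (g c y) = 0" for u using lc c y unfolding levi_civita_def by blast
    obtain N \<theta> where N: "y \<in> N" "\<forall>y\<in>N. ori c y * det (\<theta> y) > 0 \<and>
           (\<forall>u v. bil (g c y) u v = (\<theta> y *v u) \<bullet> (\<theta> y *v v)) \<and>
           (\<forall>u v w. \<phi> c y [u, v, w] = phi0 (\<theta> y *v u) (\<theta> y *v v) (\<theta> y *v w))"
      using cof[OF y] by blast
    have "invertible (\<theta> y)" using N by (auto simp: invertible_det_nz)
    then have "onb (g c y) (\<lambda>i. matrix_inv (\<theta> y) *v axis i 1)"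
      using N by (intro coframe_onb) auto
    then show "\<exists>e :: 7 \<Rightarrow> real^7. \<forall>i j. bil (g c y) (e i) (e j) = (if i = j then 1 else 0)"
      unfolding onb_def by (intro exI[of _ "\<lambda>i. matrix_inv (\<theta> y) *v axis i 1"])
  qed
  interpret G2_chart c ?U \<Gamma> g \<phi>
  proof unfold_locales
    show "smooth_field c ?U \<phi>" by (rule \<phi>sm)
    fix y assume y: "y \<in> ?U"
    show "\<phi> c y \<in> alt_forms 3" by (rule \<phi>alt[OF y])
    obtain N \<theta> where N: "open N" "y \<in> N" "N \<subseteq> ?U" "smooth_on N \<theta>"
      and h: "\<forall>y\<in>N. ori c y * det (\<theta> y) > 0 \<and>
           (\<forall>u v. bil (g c y) u v = (\<theta> y *v u) \<bullet> (\<theta> y *v v)) \<and>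
           (\<forall>u v w. \<phi> c y [u, v, w] = phi0 (\<theta> y *v u) (\<theta> y *v v) (\<theta> y *v w))"
      using cof[OF y] by blast
    have "invertible (\<theta> y)" using h N(2) by (auto simp: invertible_det_nz)
    then show "\<exists>\<theta>. invertible \<theta> \<and> (\<forall>u v. bil (g c y) u v = (\<theta> *v u) \<bullet> (\<theta> *v v)) \<and>
      (\<forall>u v w. \<phi> c y [u, v, w] = phi0 (\<theta> *v u) (\<theta> *v v) (\<theta> *v w))"
      using h N(2) by blast
    have d\<theta>: "(\<theta> has_derivative dirder \<theta> y) (at y)"
      by (rule has_derivative_dirder[OF smooth_on_differentiable[OF N(4,1,2)]])
    show "cov act_triv \<Gamma> \<phi> c y u ws = 0" for u ws
    proof (rule torsion_free_parallel[where \<phi> = \<phi> and s = ori and \<theta> = \<theta> and N = N, OF N(1-3) d\<theta>])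
      show "\<phi> c z \<in> alt_forms 3" if "z \<in> ?U" for z by (rule \<phi>alt[OF that])
      show "(\<lambda>y. \<phi> c y ws) differentiable (at y)" for ws by (rule smooth_field_differentiable[OF \<phi>sm y])
      show "ori c z \<in> {1, -1}" if "z \<in> N" for z using ori c N(3) that unfolding orientation_def by blast
      show "ext_d \<phi> c y vs = 0" "ext_d (\<lambda>c x. hodge (g c x) (ori c x) 3 (\<phi> c x)) c y vs = 0" for vs
        using assms(3) c y unfolding torsion_free_def by blast+
    qed (use h in auto)
  qed
  have af: "a \<in> forms A chg_End k" using assms(6) by (auto simp: E_cx_def can_forms_def)
  have aalt: "a c y \<in> alt_forms k" if "y \<in> ?U" for y using af c that by (auto simp: forms_def)
  have asm: "smooth_field c ?U a"
    using af c alt_forms_multilin[OF aalt] by (auto simp: forms_def smooth_field_def)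
  consider "k = 0" | "k = 1 \<or> k = 2" | "k = 3" using assms(5) by auto
  then show "b_map g \<phi> \<Gamma> k a c x vs
      = d_G1 g \<phi> \<Gamma> k (L_E g \<Gamma> a) c x vs - L_E g \<Gamma> (d_E g \<phi> \<Gamma> k a) c x vs"
  proof cases
    case 1
    have "a c y \<in> alt_forms 0" if "y \<in> ?U" for y using aalt[OF that] 1 by simp
    then show ?thesis using homotopy_degree_0[where a = a, OF asm _ x] 1 by simp
  next
    case 2
    show ?thesis by (rule homotopy_degree_1_2[where a = a, OF asm aalt 2 x])
  next
    case 3
    then show ?thesis by (simp add: homotopy_degree_3)
  qed
qed

end
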